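(* Suppose the sequence of (random or deterministic) vectors $\mathbf{w}^{(n)}=(w_1^{(n)},\ldots,w_n^{(n)})$, $n\in\mathbb{N}$, of nonnegative real numbers satisfies condition LLN-$P$ (defined in the context), where $P$ is a Borel probability measure on $\mathbb{R}_+$ with finite mean $\mu\neq 0$ and Laplace transform $\phi(u)=\int_{\mathbb{R}_+}e^{-ux}P(dx)$, $u\ge 0$. For $\lambda\geq 0$ and $t\geq 0$ define $$A_n(t,\lambda):=\mathbb{E}\Bigl(\exp\{-\lambda S_{\mathbf{e}}^{(n)}(t)\}\,\mathbf{1}_{\{S_{\mathbf{e}}^{(n)}(t)>0\}}\Bigr),$$ where $S^{(n)}_{\mathbf{e}}(t)$ is the equilibrium part of the search-cost in the move-to-front Markov chain with popularities $p^{(n)}_i=w^{(n)}_i/\sum_{j=1}^n w^{(n)}_j$. Then, for all $\lambda\ge 0$ and $t\ge 0$, $$\lim_{n\to\infty}A_n(n\mu t,\lambda/n)=\frac{1}{\mu}\int_0^t\int_{\mathbb{R}_+}x^2e^{-xu}\,P(dx)\,\exp\{-\lambda(1-\phi(u))\}\,du.$$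
   Context: Condition LLN-$P$. A sequence of random or deterministic vectors $\mathbf{w}^{(n)}=(w_1^{(n)},\ldots,w_n^{(n)})$, $n\in\mathbb{N}$, with nonnegative coordinates satisfies LLN-$P$, where $P$ is a Borel probability measure on $\mathbb{R}_+=[0,\infty)$ with finite first moment $\mu\neq0$, if there exist positive random variables $Z_n$ (with $Z_n$ defined on the same probability space as $\mathbf{w}^{(n)}$) such that the random probability measures $\hat\nu^{(n)}:=\frac1n\sum_{i=1}^n\delta_{Z_nw_i^{(n)}}$ converge in law to the deterministic limit $P$ (as random elements of the space $\mathcal{P}(\mathbb{R}_+)$ of Borel probability measures with the weak topology), and the empirical means $\frac1n\sum_{i=1}^nZ_nw_i^{(n)}$ converge in law to $\mu$. Move-to-front chain. Let $p_i^{(n)}:=w_i^{(n)}/\sum_{j=1}^nw_j^{(n)}$ (convention $0/0:=0$). Objects labeled $1,\ldots,n$ are kept in a list; at time $0$ object $i$ is at position $\pi(i)$, where $\pi$ is some permutation of $\{1,\ldots,n\}$ (position $1$ is the front of the list). Conditionally on $\mathbf{w}^{(n)}$, object $i$ is requested at the instants of a Poisson process on $[0,\infty)$ of rate $p_i^{(n)}$, independently for different $i$. Instantaneously after a request the requested object is moved to the front of the list, the relative order of the other objects being unchanged. $N_t$ is the total number of requests up to time $t$, and $I_k\in\{1,\ldots,n\}$ is the label of the $k$-th requested object, so that $I_{N_{t^-}+1}$ is the first object requested in $[t,\infty)$. $S^{(n,i)}(t)$ is the position of object $i$ at time $t$ (left-continuous in $t$: a request occurring exactly at time $t$ has not yet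 modified the list). The search-cost is $S^{(n)}(t):=\sum_{i=1}^nS^{(n,i)}(t)\mathbf{1}_{\{I_{N_{t^-}+1}=i\}}$; if all $w_j^{(n)}$ are zero there are no requests and $S^{(n)}(t)=0$. $R_t$ is the set of objects requested at least once in $[0,t)$. The equilibrium part and the out-of-equilibrium part of the search-cost are $$S_{\mathbf{e}}^{(n)}(t):=S^{(n)}(t)\mathbf{1}_{\{I_{N_{t^-}+1}\in R_t\}},\qquad S_{\mathbf{o}}^{(n)}(t):=S^{(n)}(t)\mathbf{1}_{\{I_{N_{t^-}+1}\notin R_t\}}.$$ When some $w_j^{(n)}$ is nonzero, $\{S_{\mathbf{e}}^{(n)}(t)>0\}=\{S^{(n)}(t)\le|R_t|\}$. *)

theory Defs
  imports "HOL-Probability.Probability"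
begin

section \<open>Condition LLN-P\<close>

definition Rplus :: "real measure" where
  "Rplus = restrict_space borel {0..}"

definition prob_Rplus :: "real measure set" where
  "prob_Rplus = {Q. prob_space Q \<and> sets Q = sets Rplus}"

definition weak_topology :: "real measure topology" where
  "weak_topology = topology_generated_by
     {{Q \<in> prob_Rplus. (\<integral>x. f x \<partial>Q) \<in> U} | (f :: real \<Rightarrow> real) U.
        continuous_on {0..} f \<and> bounded (f ` {0..}) \<and> open U}"

text \<open>Random elements \<open>X n\<close> of a topological space, each defined on its own probability space
  \<open>M n\<close>, converging in law to the constant \<open>x\<close>.\<close>

definition converges_in_law_to_const ::
    "(nat \<Rightarrow> 'a measure) \<Rightarrow> 'b topology \<Rightarrow> (nat \<Rightarrow> 'a \<Rightarrow> 'b) \<Rightarrow> 'b \<Rightarrow> bool" where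
  "converges_in_law_to_const M T X x \<longleftrightarrow>
     (\<forall>F. continuous_map T euclideanreal F \<and> bounded (F ` topspace T) \<longrightarrow>
        (\<lambda>n. \<integral>\<omega>. F (X n \<omega>) \<partial>M n) \<longlonglongrightarrow> F x)"

definition empirical_measure :: "nat \<Rightarrow> (nat \<Rightarrow> real) \<Rightarrow> real measure" where
  "empirical_measure n x = measure_of (space Rplus) (sets Rplus)
     (\<lambda>A. ennreal (1 / real n) * (\<Sum>i=1..n. emeasure (return Rplus (x i)) A))"

text \<open>The coordinates of the \<open>n\<close>-th vector are \<open>w n 1, \<dots>, w n n\<close>; only \<open>n \<ge> 1\<close> matters.\<close>

definition LLN ::
    "real measure \<Rightarrow> (nat \<Rightarrow> 'a measure) \<Rightarrow> (nat \<Rightarrow> nat \<Rightarrow> 'a \<Rightarrow> real) \<Rightarrow> bool" where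
  "LLN P M w \<longleftrightarrow>
     (\<exists>Z. (\<forall>n\<ge>1. Z n \<in> borel_measurable (M n) \<and> (\<forall>\<omega>\<in>space (M n). Z n \<omega> > 0)) \<and>
        converges_in_law_to_const M weak_topology
          (\<lambda>n \<omega>. empirical_measure n (\<lambda>i. Z n \<omega> * w n i \<omega>)) P \<and>
        weak_conv_m
          (\<lambda>n. distr (M n) borel (\<lambda>\<omega>. (1 / real n) * (\<Sum>i=1..n. Z n \<omega> * w n i \<omega>)))
          (return borel (\<integral>x. x \<partial>P)))"

definition laplace :: "real measure \<Rightarrow> real \<Rightarrow> real" where
  "laplace P u = (\<integral>x. exp (- u * x) \<partial>P)"

section \<open>Move-to-front dynamics for given request instants\<close>

text \<open>Here \<open>\<tau> i\<close> is the set of instants at which object \<open>i \<in> {1..n}\<close> is requested. Simultaneous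
  requests, which almost surely do not occur, are processed in the order of the labels.\<close>

definition requests :: "nat \<Rightarrow> (nat \<Rightarrow> real set) \<Rightarrow> (real \<times> nat) set" where
  "requests n \<tau> = {(s, i). i \<in> {1..n} \<and> s \<in> \<tau> i}"

definition request_rank :: "nat \<Rightarrow> (nat \<Rightarrow> real set) \<Rightarrow> real \<times> nat \<Rightarrow> nat" where
  "request_rank n \<tau> = (\<lambda>(s, i).
     card {(r, j). (r, j) \<in> requests n \<tau> \<and> (r < s \<or> r = s \<and> j \<le> i)})"

text \<open>The label \<open>I\<^sub>k\<close>, with the value \<open>0\<close>, which is not a label, if there are fewer than \<open>k\<close>
  requests. The search-cost is then \<open>0\<close> if nothing is requested any more.\<close>

definition requested_label :: "nat \<Rightarrow> (nat \<Rightarrow> real set) \<Rightarrow> nat \<Rightarrow> nat" where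
  "requested_label n \<tau> k =
     (if \<exists>q\<in>requests n \<tau>. request_rank n \<tau> q = k
      then snd (THE q. q \<in> requests n \<tau> \<and> request_rank n \<tau> q = k) else 0)"

text \<open>The left limit \<open>N\<^sub>t\<^sub>-\<close> of the number of requests.\<close>

definition num_requests_before :: "nat \<Rightarrow> (nat \<Rightarrow> real set) \<Rightarrow> real \<Rightarrow> nat" where
  "num_requests_before n \<tau> t = card {(s, i). (s, i) \<in> requests n \<tau> \<and> s < t}"

text \<open>A list is represented by the map from labels to positions.\<close>

definition move_to_front :: "nat \<Rightarrow> (nat \<Rightarrow> nat) \<Rightarrow> nat \<Rightarrow> nat" where
  "move_to_front i pos j =
     (if j = i then 1 else if pos j < pos i then pos j + 1 else pos j)"

primrec position_after :: "nat \<Rightarrow> (nat \<Rightarrow> nat) \<Rightarrow> (nat \<Rightarrow> real set) \<Rightarrow> nat \<Rightarrow> nat \<Rightarrow> nat" where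
  "position_after n \<pi> \<tau> 0 = \<pi>"
| "position_after n \<pi> \<tau> (Suc k) =
     move_to_front (requested_label n \<tau> (Suc k)) (position_after n \<pi> \<tau> k)"

definition position :: "nat \<Rightarrow> (nat \<Rightarrow> nat) \<Rightarrow> (nat \<Rightarrow> real set) \<Rightarrow> real \<Rightarrow> nat \<Rightarrow> nat" where
  "position n \<pi> \<tau> t i = position_after n \<pi> \<tau> (num_requests_before n \<tau> t) i"

definition next_label :: "nat \<Rightarrow> (nat \<Rightarrow> real set) \<Rightarrow> real \<Rightarrow> nat" where
  "next_label n \<tau> t = requested_label n \<tau> (num_requests_before n \<tau> t + 1)"

definition search_cost :: "nat \<Rightarrow> (nat \<Rightarrow> nat) \<Rightarrow> (nat \<Rightarrow> real set) \<Rightarrow> real \<Rightarrow> nat" where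
  "search_cost n \<pi> \<tau> t =
     (\<Sum>i=1..n. position n \<pi> \<tau> t i * of_bool (next_label n \<tau> t = i))"

definition requested_before :: "nat \<Rightarrow> (nat \<Rightarrow> real set) \<Rightarrow> real \<Rightarrow> nat set" where
  "requested_before n \<tau> t = {i \<in> {1..n}. \<exists>s\<in>\<tau> i. 0 \<le> s \<and> s < t}"

definition equilibrium_search_cost ::
    "nat \<Rightarrow> (nat \<Rightarrow> nat) \<Rightarrow> (nat \<Rightarrow> real set) \<Rightarrow> real \<Rightarrow> nat" where
  "equilibrium_search_cost n \<pi> \<tau> t =
     search_cost n \<pi> \<tau> t * of_bool (next_label n \<tau> t \<in> requested_before n \<tau> t)"

section \<open>The request processes\<close>

text \<open>The convention \<open>0 / 0 = 0\<close> is that of the library.\<close>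

definition popularity :: "nat \<Rightarrow> (nat \<Rightarrow> 'a \<Rightarrow> real) \<Rightarrow> nat \<Rightarrow> 'a \<Rightarrow> real" where
  "popularity n w i \<omega> = w i \<omega> / (\<Sum>j=1..n. w j \<omega>)"

text \<open>Unlike \<open>poisson_pmf\<close>, this covers the mean \<open>0\<close>, where it is the point mass at \<open>0\<close>.\<close>

definition poisson_prob :: "real \<Rightarrow> nat \<Rightarrow> real" where
  "poisson_prob a m = a ^ m / fact m * exp (- a)"

definition generated_by_vector ::
    "'a measure \<Rightarrow> nat \<Rightarrow> (nat \<Rightarrow> 'a \<Rightarrow> real) \<Rightarrow> 'a measure" where
  "generated_by_vector M n w =
     vimage_algebra (space M) (\<lambda>\<omega>. \<lambda>i\<in>{1..n}. w i \<omega>) (\<Pi>\<^sub>M i\<in>{1..n}. borel)"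

text \<open>Conditionally on \<open>w\<close>, the point processes \<open>T 1, \<dots>, T n\<close> on \<open>[0,\<infinity>)\<close> are independent and
  \<open>T i\<close> is Poisson with rate \<open>popularity n w i\<close>: given \<open>w\<close>, the numbers of points of the
  different \<open>T i\<close> in the consecutive intervals \<open>[s j, s (j + 1))\<close> are independent Poisson variables.\<close>

definition conditionally_poisson_requests ::
    "'a measure \<Rightarrow> nat \<Rightarrow> (nat \<Rightarrow> 'a \<Rightarrow> real) \<Rightarrow> (nat \<Rightarrow> 'a \<Rightarrow> real set) \<Rightarrow> bool" where
  "conditionally_poisson_requests M n w T \<longleftrightarrow>
     (\<forall>i\<in>{1..n}. \<forall>\<omega>\<in>space M. T i \<omega> \<subseteq> {0..} \<and> (\<forall>t. finite (T i \<omega> \<inter> {0..<t}))) \<and>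
     (\<forall>i\<in>{1..n}. \<forall>t. (\<lambda>\<omega>. card (T i \<omega> \<inter> {0..<t})) \<in> measurable M (count_space UNIV)) \<and>
     (\<forall>k (s :: nat \<Rightarrow> real) (m :: nat \<Rightarrow> nat \<Rightarrow> nat). 0 \<le> s 0 \<and> mono s \<longrightarrow>
        (AE \<omega> in M.
           real_cond_exp M (generated_by_vector M n w)
             (indicator {\<omega>' \<in> space M. \<forall>i\<in>{1..n}. \<forall>j<k.
                card (T i \<omega>' \<inter> {s j..<s (Suc j)}) = m i j}) \<omega>
           = (\<Prod>i=1..n. \<Prod>j<k.
                poisson_prob (popularity n w i \<omega> * (s (Suc j) - s j)) (m i j))))"

definition equilibrium_transform ::
    "'a measure \<Rightarrow> nat \<Rightarrow> (nat \<Rightarrow> nat) \<Rightarrow> (nat \<Rightarrow> 'a \<Rightarrow> real set) \<Rightarrow> real \<Rightarrow> real \<Rightarrow> real" where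
  "equilibrium_transform M n \<pi> T t l =
     (\<integral>\<omega>. exp (- l * real (equilibrium_search_cost n \<pi> (\<lambda>i. T i \<omega>) t)) *
        of_bool (equilibrium_search_cost n \<pi> (\<lambda>i. T i \<omega>) t > 0) \<partial>M)"

end

theory Submission
  imports Defs "HOL-Real_Asymp.Real_Asymp"
begin

text \<open>
  Condition first on the weights, so that the popularities \<open>p\<^sub>i\<close> are fixed. The next request after
  time \<open>s\<close> is for \<open>i\<close> with probability \<open>p\<^sub>i\<close>, independently of the past. If \<open>i\<close> has been requested
  before \<open>s\<close>, last at \<open>s - u\<close>, then the objects in front of it are those requested during the last
  \<open>u\<close> units of time, so its position is \<open>1\<close> plus a sum of independent Bernoulli variables with
  parameters \<open>1 - exp (- p\<^sub>j u)\<close>. Since \<open>u\<close> has density \<open>p\<^sub>i exp (- p\<^sub>i u)\<close> on \<open>(0, s)\<close>, the transform is the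
  mean of
  \<open>\<Sum>i. p\<^sub>i \<integral>\<^sub>0\<^sup>s p\<^sub>i exp (- p\<^sub>i u) exp (- l) \<Prod>j\<noteq>i. (exp (- l) + (1 - exp (- l)) exp (- p\<^sub>j u)) du\<close>;
  this is \<open>equilibrium_transform_eq\<close>. The request processes are known only through their counts in
  finitely many consecutive intervals. The formula is therefore proved for a discretised search-cost, a
  function of the counts on a grid (\<open>grid_transform\<close>), whose mean is an explicit product
  (\<open>expectation_grid_transform\<close>). For each realisation the discretised value equals the true one on
  every fine grid (\<open>eventually_grid_transform_eq\<close>), and on the other side the explicit means converge
  to the integral (\<open>grid_value_tendsto\<close>).

  For \<open>s = n \<mu> t\<close> and \<open>l / n\<close> in place of \<open>l\<close>, put \<open>y\<^sub>i = n \<mu> p\<^sub>i\<close> and substitute \<open>u = n \<mu> v\<close>. Up to an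
  error of order \<open>1 / n\<close> the expression becomes
  \<open>1 / \<mu> \<integral>\<^sub>0\<^sup>t g\<^sub>n(v) exp (- l (1 - \<phi>\<^sub>n(v))) dv\<close>, where \<open>g\<^sub>n(v)\<close> and \<open>\<phi>\<^sub>n(v)\<close> are the averages over \<open>i\<close> of
  \<open>y\<^sub>i\<^sup>2 exp (- y\<^sub>i v)\<close> and \<open>exp (- y\<^sub>i v)\<close>. By the law of large numbers the averages of bounded
  Lipschitz functions of the \<open>y\<^sub>i\<close> converge in mean to their \<open>P\<close>-integrals (\<open>average_tendsto\<close>), which
  identifies the limits \<open>g(v)\<close> and \<open>\<phi>(v)\<close> for every \<open>v > 0\<close>. Near \<open>v = 0\<close> the densities \<open>g\<^sub>n\<close> have no
  common integrable bound, since \<open>P\<close> need not have a second moment. Instead, \<open>g\<close> has mass \<open>\<mu>\<close> and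
  \<open>g\<^sub>n\<close> has mass at most \<open>\<mu>\<close> on the half-line, so the \<open>L\<^sup>1\<close> distance is at most twice the integral of the
  positive part of \<open>g - g\<^sub>n\<close>, which is dominated by \<open>g\<close>. Dominated convergence in \<open>v\<close> concludes
  (\<open>integral_error\<close>, \<open>expected_integral_tendsto\<close>).
\<close>

section \<open>Positions under the move-to-front rule\<close>

lemma last_occurrence:
  fixes a :: "nat \<Rightarrow> 'b"
  assumes "b \<in> a ` {m<..k}"
  obtains m' where "m < m'" "m' \<le> k" "a m' = b" "b \<notin> a ` {m'<..k}"
proof -
  let ?S = "{x \<in> {m<..k}. a x = b}"
  have fin: "finite ?S" and ne: "?S \<noteq> {}" using assms by auto
  have M: "Max ?S \<in> ?S" using Max_in[OF fin ne] .
  have "b \<notin> a ` {Max ?S<..k}"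
  proof
    assume "b \<in> a ` {Max ?S<..k}"
    then obtain x where x: "Max ?S < x" "x \<le> k" "a x = b" by auto
    with M have "x \<in> ?S" by auto
    with Max_ge[OF fin this] x(1) show False by simp
  qed
  with M that show thesis by auto
qed

text \<open>The step sequence \<open>a 1, a 2, \<dots>\<close> determines the position of every label that it has already
  named: in front of it stand exactly the labels named since its last occurrence. The induction needs
  two more invariants, since a label is overtaken precisely when the label moved to the front stood
  behind it. Positions stay distinct, and labels not yet named stay behind all those that have been
  named; so a label named for the first time comes from
  behind all of them.\<close>

lemma move_to_front_invariant:
  fixes pos :: "nat \<Rightarrow> nat \<Rightarrow> nat" and a :: "nat \<Rightarrow> nat"
  assumes step: "\<And>k. k < N \<Longrightarrow> pos (Suc k) = move_to_front (a (Suc k)) (pos k)"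
    and label: "\<And>k. k < N \<Longrightarrow> a (Suc k) \<in> I"
    and init: "inj_on (pos 0) I" "\<And>j. j \<in> I \<Longrightarrow> 0 < pos 0 j"
    and "k \<le> N"
  shows "inj_on (pos k) I \<and> (\<forall>j\<in>I. 0 < pos k j) \<and>
    (\<forall>b\<in>I - a ` {0<..k}. card (a ` {0<..k}) < pos k b) \<and>
    (\<forall>m. 0 < m \<longrightarrow> m \<le> k \<longrightarrow> a m \<notin> a ` {m<..k} \<longrightarrow> pos k (a m) = Suc (card (a ` {m<..k})))"
  using \<open>k \<le> N\<close>
proof (induction k)
  case 0
  show ?case using init by auto
next
  case (Suc k)
  define b p where "b = a (Suc k)" and "p = pos k"
  have kN: "k < N" using Suc.prems by simp
  have inj: "inj_on p I" and pos: "\<And>j. j \<in> I \<Longrightarrow> 0 < p j"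
    and fresh: "\<And>c. c \<in> I \<Longrightarrow> c \<notin> a ` {0<..k} \<Longrightarrow> card (a ` {0<..k}) < p c"
    and old: "\<And>m. 0 < m \<Longrightarrow> m \<le> k \<Longrightarrow> a m \<notin> a ` {m<..k} \<Longrightarrow> p (a m) = Suc (card (a ` {m<..k}))"
    using Suc.IH kN unfolding p_def by auto
  have bI: "b \<in> I" using label[OF kN] unfolding b_def .
  have posS: "pos (Suc k) = move_to_front b p" using step[OF kN] unfolding b_def p_def .
  have ins: "a ` {m<..Suc k} = insert b (a ` {m<..k})" if "m \<le> k" for m
  proof -
    have "{m<..Suc k} = insert (Suc k) {m<..k}" using that by auto
    then show ?thesis unfolding b_def by simp
  qed
  have inj': "inj_on (move_to_front b p) I"
  proof (rule inj_onI)
    fix x y assume xy: "x \<in> I" "y \<in> I" "move_to_front b p x = move_to_front b p y"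
    have "p x = p b \<Longrightarrow> x = b" "p y = p b \<Longrightarrow> y = b" "p x = p y \<Longrightarrow> x = y"
      using inj bI xy(1,2) by (auto dest: inj_onD)
    then show "x = y" using xy(3) pos[OF xy(1)] pos[OF xy(2)] pos[OF bI]
      unfolding move_to_front_def by (auto split: if_splits)
  qed
  have pos': "\<forall>j\<in>I. 0 < move_to_front b p j"
    using pos unfolding move_to_front_def by auto
  \<comment> \<open>A first occurrence of \<open>b\<close> pushes an unnamed \<open>c\<close> back by one place exactly if \<open>c\<close> stood in front
    of \<open>b\<close>; otherwise \<open>c\<close> stood strictly behind \<open>b\<close>, which leaves room for one more named label.\<close>
  have fresh': "card (a ` {0<..Suc k}) < move_to_front b p c"
    if c: "c \<in> I" "c \<notin> a ` {0<..Suc k}" for c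
  proof -
    have cb: "c \<noteq> b" and ck: "c \<notin> a ` {0<..k}" using c(2) ins[of 0] by auto
    have pc: "card (a ` {0<..k}) < p c" using fresh[OF c(1) ck] .
    have ne: "p c \<noteq> p b" using inj bI c(1) cb by (auto dest: inj_onD)
    show ?thesis
    proof (cases "b \<in> a ` {0<..k}")
      case True
      then have "card (a ` {0<..Suc k}) = card (a ` {0<..k})" using ins[of 0] by (simp add: insert_absorb)
      then show ?thesis using pc cb unfolding move_to_front_def by auto
    next
      case False
      then have "card (a ` {0<..Suc k}) = Suc (card (a ` {0<..k}))" using ins[of 0] by simp
      moreover have "card (a ` {0<..k}) < p b" using fresh[OF bI False] .
      ultimately show ?thesis using pc cb ne unfolding move_to_front_def by auto
    qed
  qed
  have old': "move_to_front b p (a m) = Suc (card (a ` {m<..Suc k}))"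
    if m: "0 < m" "m \<le> Suc k" "a m \<notin> a ` {m<..Suc k}" for m
  proof (cases "m = Suc k")
    case True
    then show ?thesis unfolding move_to_front_def b_def by simp
  next
    case False
    then have mk: "m \<le> k" using m(2) by simp
    have am: "a m \<noteq> b" "a m \<notin> a ` {m<..k}" using m(3) ins[OF mk] by auto
    have pam: "p (a m) = Suc (card (a ` {m<..k}))" using old[OF m(1) mk am(2)] .
    show ?thesis
    proof (cases "b \<in> a ` {m<..k}")
      case True
      then obtain m' where m': "m < m'" "m' \<le> k" "a m' = b" "b \<notin> a ` {m'<..k}"
        by (rule last_occurrence)
      have "p b = Suc (card (a ` {m'<..k}))" using old[of m'] m' by auto
      also have "card (a ` {m'<..k}) \<le> card (a ` {m<..k})"
        using m'(1) by (intro card_mono image_mono) auto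
      finally have "\<not> p (a m) < p b" using pam by simp
      then show ?thesis using am pam True ins[OF mk]
        unfolding move_to_front_def by (simp add: insert_absorb)
    next
      case False
      have card_le: "Suc (card (a ` {m<..k})) \<le> card (a ` {x<..k})" if "x < m" for x
      proof -
        have "Suc (card (a ` {m<..k})) = card (insert (a m) (a ` {m<..k}))" using am(2) by simp
        also have "\<dots> \<le> card (a ` {x<..k})" using that mk by (intro card_mono) auto
        finally show ?thesis .
      qed
      have "p (a m) < p b"
      proof (cases "b \<in> a ` {0<..k}")
        case True
        then obtain m' where m': "0 < m'" "m' \<le> k" "a m' = b" "b \<notin> a ` {m'<..k}"
          by (rule last_occurrence)
        have "m' \<noteq> m" using m'(3) am(1) by auto
        moreover have "\<not> m < m'" using False m'(2,3) by auto
        ultimately have "m' < m" by simp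
        then show ?thesis using card_le[of m'] old[OF m'(1,2)] m'(3,4) pam by simp
      next
        case False
        then show ?thesis using card_le[of 0] fresh[OF bI False] pam m(1) by simp
      qed
      then show ?thesis using am(1) pam False ins[OF mk] unfolding move_to_front_def by simp
    qed
  qed
  show ?case unfolding posS using inj' pos' fresh' old' by auto
qed

text \<open>A deterministic realisation of the request instants. Requests are ordered lexicographically by
  (instant, label), so that coinciding instants are covered and every statement about positions holds
  for each realisation.\<close>

locale request_configuration =
  fixes n :: nat and \<tau> :: "nat \<Rightarrow> real set"
  assumes nonneg: "i \<in> {1..n} \<Longrightarrow> \<tau> i \<subseteq> {0..}"
    and locally_finite: "i \<in> {1..n} \<Longrightarrow> finite (\<tau> i \<inter> {0..<u})"
begin

definition precedes :: "real \<times> nat \<Rightarrow> real \<times> nat \<Rightarrow> bool" where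
  "precedes q q' \<longleftrightarrow> fst q < fst q' \<or> fst q = fst q' \<and> snd q \<le> snd q'"

definition before :: "real \<Rightarrow> (real \<times> nat) set" where
  "before t = {q \<in> requests n \<tau>. fst q < t}"

lemma request_rank_eq: "request_rank n \<tau> q = card {q' \<in> requests n \<tau>. precedes q' q}"
proof -
  have "{q' \<in> requests n \<tau>. precedes q' q} =
    {(r, j). (r, j) \<in> requests n \<tau> \<and> (r < fst q \<or> r = fst q \<and> j \<le> snd q)}"
    by (auto simp: precedes_def)
  then show ?thesis by (cases q) (simp add: request_rank_def)
qed

lemma num_requests_before_eq: "num_requests_before n \<tau> t = card (before t)"
  unfolding num_requests_before_def before_def by (rule arg_cong[of _ _ card]) auto

lemma finite_before: "finite (before t)"
proof (rule finite_subset)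
  show "before t \<subseteq> (\<Union>i\<in>{1..n}. (\<tau> i \<inter> {0..<t}) \<times> {i})"
    using nonneg by (force simp: before_def requests_def)
  show "finite (\<Union>i\<in>{1..n}. (\<tau> i \<inter> {0..<t}) \<times> {i})"
    using locally_finite by auto
qed

lemma finite_preceding: "finite {q' \<in> requests n \<tau>. precedes q' q}"
  by (rule finite_subset[OF _ finite_before[of "fst q + 1"]]) (auto simp: before_def precedes_def)

lemma rank_less:
  assumes "q' \<in> requests n \<tau>" "precedes q q'" "q \<noteq> q'"
  shows "request_rank n \<tau> q < request_rank n \<tau> q'"
  unfolding request_rank_eq
proof (rule psubset_card_mono[OF finite_preceding])
  have "\<not> precedes q' q" using assms(2,3) by (auto simp: precedes_def prod_eq_iff)
  moreover have "precedes q' q'" by (simp add: precedes_def)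
  moreover have "precedes r q \<Longrightarrow> precedes r q'" for r
    using assms(2) by (auto simp: precedes_def)
  ultimately show "{r \<in> requests n \<tau>. precedes r q} \<subset> {r \<in> requests n \<tau>. precedes r q'}"
    using assms(1) by blast
qed

lemma precedes_total: "precedes q q' \<or> precedes q' q"
  by (auto simp: precedes_def)

lemma rank_inj: "inj_on (request_rank n \<tau>) (requests n \<tau>)"
proof (rule inj_onI)
  fix q q' assume q: "q \<in> requests n \<tau>" "q' \<in> requests n \<tau>"
    and eq: "request_rank n \<tau> q = request_rank n \<tau> q'"
  show "q = q'"
  proof (rule ccontr)
    assume "q \<noteq> q'"
    then show False using precedes_total[of q q'] rank_less[OF q(2), of q] rank_less[OF q(1), of q'] eq
      by (metis less_irrefl)
  qed
qed

lemma rank_less_iff: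
  assumes "q \<in> requests n \<tau>" "q' \<in> requests n \<tau>"
  shows "request_rank n \<tau> q < request_rank n \<tau> q' \<longleftrightarrow> precedes q q' \<and> q \<noteq> q'"
  using rank_less[OF assms(2), of q] rank_less[OF assms(1), of q'] precedes_total[of q q']
  by (metis less_asym less_irrefl)

lemma requested_label_rank:
  assumes "q \<in> requests n \<tau>"
  shows "requested_label n \<tau> (request_rank n \<tau> q) = snd q"
proof -
  have "(THE q'. q' \<in> requests n \<tau> \<and> request_rank n \<tau> q' = request_rank n \<tau> q) = q"
    using assms rank_inj by (intro the_equality) (auto dest: inj_onD)
  then show ?thesis using assms unfolding requested_label_def by auto
qed

text \<open>The ranks of the requests before \<open>t\<close> form an initial segment of the positive integers: they are
  distinct and bounded by their number.\<close>

lemma ranks_before: "request_rank n \<tau> ` before t = {1..num_requests_before n \<tau> t}"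
proof (rule card_subset_eq)
  show "finite {1..num_requests_before n \<tau> t}" by simp
  show "request_rank n \<tau> ` before t \<subseteq> {1..num_requests_before n \<tau> t}"
  proof
    fix k assume "k \<in> request_rank n \<tau> ` before t"
    then obtain q where q: "q \<in> before t" "k = request_rank n \<tau> q" by auto
    have "k \<le> card (before t)" unfolding q(2) request_rank_eq
      using q(1) by (intro card_mono finite_before) (auto simp: before_def precedes_def)
    moreover have "q \<in> {q' \<in> requests n \<tau>. precedes q' q}"
      using q(1) by (simp add: before_def precedes_def)
    then have "0 < k" unfolding q(2) request_rank_eq
      using finite_preceding[of q] card_gt_0_iff by blast
    ultimately show "k \<in> {1..num_requests_before n \<tau> t}" by (simp add: num_requests_before_eq)
  qed
  show "card (request_rank n \<tau> ` before t) = card {1..num_requests_before n \<tau> t}"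
    using rank_inj by (subst card_image) (auto simp: before_def num_requests_before_eq inj_on_def)
qed

text \<open>The rank enumeration turns the list dynamics into the step sequence of
  \<open>move_to_front_invariant\<close>; the labels named after the last request of \<open>i\<close> are those with a
  lexicographically later request before \<open>t\<close>.\<close>

lemma position_eq:
  assumes \<pi>: "\<pi> permutes {1..n}" and i: "i \<in> {1..n}" and s: "s \<in> \<tau> i" "s < t"
    and last: "\<And>s'. s' \<in> \<tau> i \<Longrightarrow> s < s' \<Longrightarrow> t \<le> s'"
  shows "position n \<pi> \<tau> t i =
    Suc (card {j \<in> {1..n} - {i}. \<exists>s'\<in>\<tau> j. s' < t \<and> (s < s' \<or> s = s' \<and> i < j)})"
proof -
  define N a where "N = num_requests_before n \<tau> t" and "a = requested_label n \<tau>"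
  define m where "m = request_rank n \<tau> (s, i)"
  have si: "(s, i) \<in> before t" using i s by (simp add: before_def requests_def)
  have a_rank: "a (request_rank n \<tau> q) = snd q" if "q \<in> before t" for q
    using requested_label_rank[of q] that unfolding a_def before_def by simp
  have "m \<in> {1..N}" using imageI[OF si, of "request_rank n \<tau>"] unfolding ranks_before m_def N_def .
  then have m: "0 < m" "m \<le> N" by simp_all
  have am: "a m = i" using a_rank[OF si] unfolding m_def by simp
  have label: "a k \<in> {1..n}" if "k \<in> {1..N}" for k
  proof -
    have "k \<in> request_rank n \<tau> ` before t" using that ranks_before[of t] unfolding N_def by simp
    then obtain q where "q \<in> before t" "k = request_rank n \<tau> q" by blast
    then show ?thesis using a_rank by (force simp: before_def requests_def)
  qed
  have inv: "\<forall>m. 0 < m \<longrightarrow> m \<le> N \<longrightarrow> a m \<notin> a ` {m<..N} \<longrightarrow>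
    position_after n \<pi> \<tau> N (a m) = Suc (card (a ` {m<..N}))"
  proof -
    have "inj_on \<pi> {1..n}" using \<pi> by (metis permutes_inj inj_on_subset subset_UNIV)
    moreover have "0 < \<pi> j" if "j \<in> {1..n}" for j using permutes_in_image[OF \<pi>, of j] that by simp
    ultimately show ?thesis
      using move_to_front_invariant[of N "position_after n \<pi> \<tau>" a "{1..n}" N] label
      by (simp add: a_def)
  qed
  have img: "a ` {m<..N} = {j. \<exists>s'. (s', j) \<in> before t \<and> precedes (s, i) (s', j) \<and> (s, i) \<noteq> (s', j)}"
    (is "_ = ?J")
  proof (intro equalityI subsetI)
    fix j assume "j \<in> a ` {m<..N}"
    then obtain k where k: "m < k" "k \<le> N" "j = a k" by auto
    then have "k \<in> request_rank n \<tau> ` before t" using ranks_before[of t] unfolding N_def by simp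
    then obtain q where q: "q \<in> before t" "k = request_rank n \<tau> q" by auto
    have "precedes (s, i) q \<and> (s, i) \<noteq> q"
      using k(1) rank_less_iff[of "(s, i)" q] si q unfolding m_def before_def by simp
    then show "j \<in> ?J" using a_rank[OF q(1)] q k(3) by (cases q) auto
  next
    fix j assume "j \<in> ?J"
    then obtain s' where q: "(s', j) \<in> before t" "precedes (s, i) (s', j)" "(s, i) \<noteq> (s', j)" by auto
    have "m < request_rank n \<tau> (s', j)"
      using rank_less_iff[of "(s, i)" "(s', j)"] si q unfolding m_def before_def by simp
    moreover have "request_rank n \<tau> (s', j) \<le> N" using ranks_before[of t] q(1) unfolding N_def by auto
    ultimately have "a (request_rank n \<tau> (s', j)) \<in> a ` {m<..N}" by simp
    then show "j \<in> a ` {m<..N}" using a_rank[OF q(1)] by simp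
  qed
  have notin: "i \<notin> ?J"
  proof
    assume "i \<in> ?J"
    then obtain s' where "s' \<in> \<tau> i" "s' < t" "s < s'"
      by (auto simp: before_def requests_def precedes_def)
    then show False using last[of s'] by simp
  qed
  have "position n \<pi> \<tau> t i = Suc (card ?J)"
    using inv m am notin img unfolding position_def N_def[symmetric] by auto
  also have "?J = {j \<in> {1..n} - {i}. \<exists>s'\<in>\<tau> j. s' < t \<and> (s < s' \<or> s = s' \<and> i < j)}"
    using notin by (auto simp: before_def requests_def precedes_def)
  finally show ?thesis .
qed

lemma next_label_eq:
  assumes i: "i \<in> {1..n}" and s: "s \<in> \<tau> i" "t \<le> s"
    and first: "\<And>j s'. j \<in> {1..n} \<Longrightarrow> s' \<in> \<tau> j \<Longrightarrow> t \<le> s' \<Longrightarrow> s < s' \<or> s = s' \<and> i \<le> j"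
  shows "next_label n \<tau> t = i"
proof -
  have si: "(s, i) \<in> requests n \<tau>" using i s by (simp add: requests_def)
  have "{q \<in> requests n \<tau>. precedes q (s, i)} = insert (s, i) (before t)"
  proof (intro equalityI subsetI)
    fix q assume q: "q \<in> {q \<in> requests n \<tau>. precedes q (s, i)}"
    show "q \<in> insert (s, i) (before t)"
    proof (cases "fst q < t")
      case False
      then have "s < fst q \<or> s = fst q \<and> i \<le> snd q"
        using q first[of "snd q" "fst q"] by (cases q) (auto simp: requests_def)
      then show ?thesis using q by (cases q) (auto simp: precedes_def)
    qed (use q in \<open>simp add: before_def\<close>)
  qed (use si s(2) in \<open>auto simp: before_def precedes_def\<close>)
  moreover have "(s, i) \<notin> before t" using s(2) by (simp add: before_def)
  ultimately have "request_rank n \<tau> (s, i) = num_requests_before n \<tau> t + 1"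
    using finite_before by (simp add: request_rank_eq num_requests_before_eq)
  then show ?thesis using requested_label_rank[OF si] unfolding next_label_def by simp
qed

lemma next_label_none:
  assumes "\<And>j. j \<in> {1..n} \<Longrightarrow> \<tau> j \<subseteq> {..<t}"
  shows "next_label n \<tau> t = 0"
proof -
  have "requests n \<tau> = before t" using assms by (force simp: before_def requests_def)
  then have "request_rank n \<tau> q \<noteq> num_requests_before n \<tau> t + 1" if "q \<in> requests n \<tau>" for q
    using ranks_before[of t] that by force
  then show ?thesis unfolding next_label_def requested_label_def by auto
qed

lemma first_request_exists:
  assumes "j \<in> {1..n}" "s \<in> \<tau> j" "t \<le> s"
  obtains i r where "i \<in> {1..n}" "r \<in> \<tau> i" "t \<le> r"
    "\<And>j s'. j \<in> {1..n} \<Longrightarrow> s' \<in> \<tau> j \<Longrightarrow> t \<le> s' \<Longrightarrow> r < s' \<or> r = s' \<and> i \<le> j"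
proof -
  let ?P = "\<lambda>q. q \<in> requests n \<tau> \<and> t \<le> fst q"
  have "?P (s, j)" using assms by (simp add: requests_def)
  then obtain q where q: "?P q" "\<And>q'. ?P q' \<Longrightarrow> request_rank n \<tau> q \<le> request_rank n \<tau> q'"
    using ex_has_least_nat[of ?P "(s, j)" "request_rank n \<tau>"] by blast
  have "precedes q q'" if "?P q'" for q'
    using q(2)[OF that] rank_less[of q q'] precedes_total[of q q'] q(1) by (metis leD)
  then have "fst q < s' \<or> fst q = s' \<and> snd q \<le> j"
    if "j \<in> {1..n}" "s' \<in> \<tau> j" "t \<le> s'" for j s'
    using that unfolding precedes_def requests_def by force
  then show thesis using that[of "snd q" "fst q"] q(1) by (cases q) (auto simp: requests_def)
qed

end

section \<open>Reading the search-cost off a time grid\<close>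

definition vacant :: "(nat \<Rightarrow> nat) \<Rightarrow> nat set \<Rightarrow> bool" where
  "vacant c A \<longleftrightarrow> (\<forall>q\<in>A. c q = 0)"

text \<open>The contribution of the object \<open>j\<close> to the event that \<open>i\<close> is the next requested object after
  time \<open>t\<close>, its last request before \<open>t\<close> falling in cell \<open>k\<close> and its next one in cell \<open>K + r\<close>. The
  cells \<open>0, \<dots>, K - 1\<close> cover \<open>[0, t)\<close>. Every \<open>j \<noteq> i\<close> must not be requested in between \<open>t\<close> and the
  next request of \<open>i\<close>, and it contributes a factor \<open>exp (- l)\<close> if it stands in front of \<open>i\<close>. Within
  one cell the order of the labels decides, which is what the \<open>of_bool\<close> shifts express. The point of
  the definition is that it is a function of the counts of the single object \<open>j\<close>.\<close>

definition row_weight :: "nat \<Rightarrow> real \<Rightarrow> nat \<Rightarrow> nat \<Rightarrow> nat \<Rightarrow> nat \<Rightarrow> (nat \<Rightarrow> nat) \<Rightarrow> real" where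
  "row_weight K l i k r j c =
    (if j = i
     then of_bool (0 < c k \<and> vacant c {k<..<K} \<and> 0 < c (K + r) \<and> vacant c {K..<K + r})
     else of_bool (vacant c {K..<K + r + of_bool (j < i)}) *
       (if vacant c {k + of_bool (j < i)..<K} then 1 else exp (- l)))"

abbreviation joint_weight :: "nat \<Rightarrow> nat \<Rightarrow> real \<Rightarrow> nat \<Rightarrow> nat \<Rightarrow> nat \<Rightarrow> (nat \<Rightarrow> nat \<Rightarrow> nat) \<Rightarrow> real" where
  "joint_weight n K l i k r c \<equiv> \<Prod>j=1..n. row_weight K l i k r j (c j)"

text \<open>The integrand \<open>exp (- l S) 1 {S > 0}\<close> of the transform, read off the counts \<open>c\<close> of requests in
  \<open>K\<close> cells before and \<open>R\<close> cells after time \<open>t\<close>. Being a sum of products over the objects, its mean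
  is computable for independent objects.\<close>

definition grid_transform :: "nat \<Rightarrow> nat \<Rightarrow> nat \<Rightarrow> real \<Rightarrow> (nat \<Rightarrow> nat \<Rightarrow> nat) \<Rightarrow> real" where
  "grid_transform n K R l c =
    (\<Sum>i=1..n. \<Sum>k<K. \<Sum>r<R. exp (- l) * joint_weight n K l i k r c)"

lemma sum_sum_single:
  fixes f :: "nat \<Rightarrow> nat \<Rightarrow> 'b :: comm_monoid_add"
  assumes "k0 < K" "r0 < R"
    and "\<And>k r. k < K \<Longrightarrow> r < R \<Longrightarrow> (k, r) \<noteq> (k0, r0) \<Longrightarrow> f k r = 0"
  shows "(\<Sum>k<K. \<Sum>r<R. f k r) = f k0 r0"
proof -
  have "(\<Sum>k<K. \<Sum>r<R. f k r) = (\<Sum>(k, r)\<in>{..<K} \<times> {..<R}. f k r)"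
    by (simp add: sum.cartesian_product)
  also have "\<dots> = (\<Sum>(k, r)\<in>{(k0, r0)}. f k r)"
    using assms by (intro sum.mono_neutral_right) auto
  finally show ?thesis by simp
qed

context request_configuration
begin

abbreviation none_earlier :: "real \<Rightarrow> real \<Rightarrow> bool" where
  "none_earlier t s \<equiv> \<forall>j\<in>{1..n}. \<forall>s'\<in>\<tau> j. t \<le> s' \<longrightarrow> s \<le> s'"

lemma equilibrium_search_cost_eq:
  assumes "next_label n \<tau> t = i" "i \<in> {1..n}"
  shows "equilibrium_search_cost n \<pi> \<tau> t =
    position n \<pi> \<tau> t i * of_bool (i \<in> requested_before n \<tau> t)"
proof -
  have "search_cost n \<pi> \<tau> t = (\<Sum>j\<in>{1..n}. if j = i then position n \<pi> \<tau> t j else 0)"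
    unfolding search_cost_def assms(1) by (intro sum.cong) auto
  also have "\<dots> = position n \<pi> \<tau> t i" using assms(2) by simp
  finally show ?thesis unfolding equilibrium_search_cost_def assms(1) by simp
qed

text \<open>The discretised value is exact as soon as the map to cells preserves the strict order of all
  request instants up to the first one after \<open>t\<close>. Only one summand survives then: the one where \<open>i\<close> is
  the next requested object and \<open>k\<close>, \<open>r\<close> are the cells of its neighbouring requests.\<close>

lemma grid_transform_eq:
  fixes cell :: "real \<Rightarrow> nat" and c :: "nat \<Rightarrow> nat \<Rightarrow> nat"
  assumes \<pi>: "\<pi> permutes {1..n}"
    and cell_mono: "\<And>s s'. 0 \<le> s \<Longrightarrow> s \<le> s' \<Longrightarrow> cell s \<le> cell s'"
    and cell_past: "\<And>s. 0 \<le> s \<Longrightarrow> cell s < K \<longleftrightarrow> s < t"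
    and occupied: "\<And>j q. j \<in> {1..n} \<Longrightarrow> q < K + R \<Longrightarrow> 0 < c j q \<longleftrightarrow> (\<exists>s\<in>\<tau> j. cell s = q)"
    and fine: "\<And>j s. j \<in> {1..n} \<Longrightarrow> s \<in> \<tau> j \<Longrightarrow> t \<le> s \<Longrightarrow>
      none_earlier t s \<Longrightarrow>
      cell s < K + R \<and> (\<forall>i\<in>{1..n}. \<forall>i'\<in>{1..n}. \<forall>r\<in>\<tau> i. \<forall>r'\<in>\<tau> i'. r < r' \<longrightarrow> r \<le> s \<longrightarrow> cell r < cell r')"
  shows "grid_transform n K R l c =
    exp (- l * real (equilibrium_search_cost n \<pi> \<tau> t)) *
      of_bool (0 < equilibrium_search_cost n \<pi> \<tau> t)"
proof -
  have pos: "0 \<le> s" if "j \<in> {1..n}" "s \<in> \<tau> j" for j s using nonneg that by auto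
  have future: "t \<le> s" if "j \<in> {1..n}" "s \<in> \<tau> j" "K \<le> cell s" for j s
    using cell_past[OF pos[OF that(1,2)]] that(3) by simp
  have vacant_iff: "vacant (c j) A \<longleftrightarrow> (\<forall>s\<in>\<tau> j. cell s \<notin> A)" if "j \<in> {1..n}" "A \<subseteq> {..<K + R}" for j A
    using occupied[OF that(1)] that(2) unfolding vacant_def by (metis gr0I lessThan_iff subsetD less_irrefl)
  show ?thesis
  proof (cases "\<exists>j\<in>{1..n}. \<exists>s\<in>\<tau> j. t \<le> s")
    case False
    have "joint_weight n K l i k r c = 0" if "i \<in> {1..n}" "r < R" for i k r
    proof (rule prod_zero)
      have "\<not> 0 < c i (K + r)"
      proof
        assume "0 < c i (K + r)"
        then obtain s where "s \<in> \<tau> i" "cell s = K + r" using occupied[of i "K + r"] \<open>i \<in> {1..n}\<close> \<open>r < R\<close> by auto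
        then show False using future[of i s] False \<open>i \<in> {1..n}\<close> by auto
      qed
      then show "\<exists>j\<in>{1..n}. row_weight K l i k r j (c j) = 0"
        using that(1) by (intro bexI[of _ i]) (auto simp: row_weight_def)
    qed simp
    then have "grid_transform n K R l c = 0"
      unfolding grid_transform_def by (intro sum.neutral ballI) (metis lessThan_iff mult_zero_right)
    moreover have "next_label n \<tau> t = 0" using False by (intro next_label_none) force
    then have "equilibrium_search_cost n \<pi> \<tau> t = 0"
      unfolding equilibrium_search_cost_def requested_before_def by simp
    ultimately show ?thesis by simp
  next
    case True
    then obtain j0 s0 where "j0 \<in> {1..n}" "s0 \<in> \<tau> j0" "t \<le> s0" by auto
    then obtain i s where i: "i \<in> {1..n}" and s: "s \<in> \<tau> i" "t \<le> s"
      and first: "\<And>j s'. j \<in> {1..n} \<Longrightarrow> s' \<in> \<tau> j \<Longrightarrow> t \<le> s' \<Longrightarrow> s < s' \<or> s = s' \<and> i \<le> j"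
      by (rule first_request_exists) blast
    have next_i: "next_label n \<tau> t = i" using next_label_eq[OF i s] first by blast
    have least: "none_earlier t s"
    proof (intro ballI impI)
      fix j s' assume "j \<in> {1..n}" "s' \<in> \<tau> j" "t \<le> s'"
      then show "s \<le> s'" using first[of j s'] by auto
    qed
    have cell_s: "cell s < K + R"
      and cell_strict: "\<And>i i' r r'. i \<in> {1..n} \<Longrightarrow> i' \<in> {1..n} \<Longrightarrow> r \<in> \<tau> i \<Longrightarrow> r' \<in> \<tau> i' \<Longrightarrow>
        r < r' \<Longrightarrow> r \<le> s \<Longrightarrow> cell r < cell r'"
      using fine[OF i s least] by blast+
    define r0 where "r0 = cell s - K"
    have K_s: "K \<le> cell s" using cell_past[of s] pos[OF i s(1)] s(2) by simp
    have r0: "cell s = K + r0" "r0 < R" using K_s cell_s unfolding r0_def by auto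
    have other: "joint_weight n K l i' k r c = 0"
      if "i' \<in> {1..n}" "i' \<noteq> i" "r < R" for i' k r
    proof (rule ccontr)
      assume "joint_weight n K l i' k r c \<noteq> 0"
      then have "row_weight K l i' k r i' (c i') \<noteq> 0" "row_weight K l i' k r i (c i) \<noteq> 0"
        using that(1) i by (auto simp: prod_zero_iff)
      then have *: "0 < c i' (K + r)" "vacant (c i) {K..<K + r + of_bool (i < i')}"
        using that(2) by (auto simp: row_weight_def split: if_splits)
      obtain s' where s': "s' \<in> \<tau> i'" "cell s' = K + r" using occupied[of i' "K + r"] \<open>i' \<in> {1..n}\<close> \<open>r < R\<close> *(1) by auto
      have "K + r + of_bool (i < i') \<le> K + R" using that(3) by simp
      then have "{K..<K + r + of_bool (i < i')} \<subseteq> {..<K + R}" by auto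
      from vacant_iff[OF i this] have "cell s \<notin> {K..<K + r + of_bool (i < i')}" using *(2) s(1) by blast
      then have ge: "K + r + of_bool (i < i') \<le> cell s" using K_s by simp
      have "s < s' \<or> s = s' \<and> i \<le> i'" using first[OF that(1) s'(1)] future[OF that(1) s'(1)] s'(2) by simp
      then show False
      proof
        assume "s < s'"
        then have "cell s < cell s'" using cell_strict[OF i that(1) s(1) s'(1)] by simp
        then show False using ge s'(2) by simp
      next
        assume "s = s' \<and> i \<le> i'"
        then show False using ge s'(2) that(2) by simp
      qed
    qed
    have "grid_transform n K R l c =
      (\<Sum>i'\<in>{1..n}. if i' = i then (\<Sum>k<K. \<Sum>r<R. exp (- l) * joint_weight n K l i k r c) else 0)"
      unfolding grid_transform_def
    proof (rule sum.cong[OF refl])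
      fix i' assume i': "i' \<in> {1..n}"
      show "(\<Sum>k<K. \<Sum>r<R. exp (- l) * joint_weight n K l i' k r c) =
        (if i' = i then \<Sum>k<K. \<Sum>r<R. exp (- l) * joint_weight n K l i k r c else 0)"
      proof (cases "i' = i")
        case False
        have "(\<Sum>k<K. \<Sum>r<R. exp (- l) * joint_weight n K l i' k r c) = 0"
          by (intro sum.neutral ballI) (metis other i' False lessThan_iff mult_zero_right)
        then show ?thesis using False by simp
      qed simp
    qed
    then have gt: "grid_transform n K R l c =
      (\<Sum>k<K. \<Sum>r<R. exp (- l) * joint_weight n K l i k r c)"
      using i by simp
    show ?thesis
    proof (cases "i \<in> requested_before n \<tau> t")
      case False
      have "joint_weight n K l i k r c = 0" if "k < K" for k r
      proof (rule prod_zero)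
        have "\<not> 0 < c i k"
        proof
          assume "0 < c i k"
          then obtain s' where s': "s' \<in> \<tau> i" "cell s' = k" using occupied[of i k] i \<open>k < K\<close> by auto
          then show False
            using False cell_past[OF pos[OF i s'(1)]] pos[OF i s'(1)] i \<open>k < K\<close> by (auto simp: requested_before_def)
        qed
        then show "\<exists>j\<in>{1..n}. row_weight K l i k r j (c j) = 0"
          using i by (intro bexI[of _ i]) (auto simp: row_weight_def)
      qed simp
      then have "grid_transform n K R l c = 0"
        unfolding gt by (intro sum.neutral ballI) (metis lessThan_iff mult_zero_right)
      moreover have "equilibrium_search_cost n \<pi> \<tau> t = 0"
        using equilibrium_search_cost_eq[OF next_i i] False by simp
      ultimately show ?thesis by simp
    next
      case True
      let ?past = "\<tau> i \<inter> {0..<t}"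
      define u where "u = Max ?past"
      have "?past \<noteq> {}" using True by (auto simp: requested_before_def)
      then have u_in: "u \<in> ?past" using Max_in[of ?past] locally_finite[OF i] unfolding u_def by simp
      have u_max: "s' \<le> u" if "s' \<in> \<tau> i" "s' < t" for s'
        using Max_ge[of ?past s'] locally_finite[OF i] that pos[OF i that(1)] unfolding u_def by simp
      have u: "u \<in> \<tau> i" "0 \<le> u" "u < t" "cell u < K" using u_in cell_past[of u] by auto
      define J where "J = {j \<in> {1..n} - {i}. \<exists>s'\<in>\<tau> j. s' < t \<and> (u < s' \<or> u = s' \<and> i < j)}"
      have cost: "equilibrium_search_cost n \<pi> \<tau> t = Suc (card J)"
      proof -
        have "t \<le> s'" if "s' \<in> \<tau> i" "u < s'" for s' using u_max[OF that(1)] that(2) by linarith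
        from position_eq[OF \<pi> i u(1,3) this] show ?thesis
          using equilibrium_search_cost_eq[OF next_i i] True unfolding J_def by simp
      qed
      have self: "row_weight K l i k r i (c i) = of_bool (k = cell u \<and> r = r0)"
        if "k < K" "r < R" for k r
      proof -
        have "row_weight K l i k r i (c i) = of_bool ((\<exists>s'\<in>\<tau> i. cell s' = k) \<and> (\<forall>s'\<in>\<tau> i. cell s' \<notin> {k<..<K}) \<and>
          (\<exists>s'\<in>\<tau> i. cell s' = K + r) \<and> (\<forall>s'\<in>\<tau> i. cell s' \<notin> {K..<K + r}))"
        proof -
          have "{k<..<K} \<subseteq> {..<K + R}" "{K..<K + r} \<subseteq> {..<K + R}" using that by auto
          note 1 = this[THEN vacant_iff[OF i]]
          have "k < K + R" "K + r < K + R" using that by auto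
          note 2 = this[THEN occupied[OF i]]
          show ?thesis unfolding row_weight_def 1 2 by (simp only: refl if_True conj_assoc)
        qed
        also have "\<dots> = of_bool (k = cell u \<and> r = r0)"
        proof (rule arg_cong[of _ _ of_bool], rule iffI)
          assume a: "(\<exists>s'\<in>\<tau> i. cell s' = k) \<and> (\<forall>s'\<in>\<tau> i. cell s' \<notin> {k<..<K}) \<and>
            (\<exists>s'\<in>\<tau> i. cell s' = K + r) \<and> (\<forall>s'\<in>\<tau> i. cell s' \<notin> {K..<K + r})"
          then obtain s1 s2 where s1: "s1 \<in> \<tau> i" "cell s1 = k" and s2: "s2 \<in> \<tau> i" "cell s2 = K + r"
            by auto
          have "s1 < t" using cell_past[OF pos[OF i s1(1)]] s1(2) that(1) by simp
          then have "k \<le> cell u" using cell_mono[of s1 u] u_max[OF s1(1)] pos[OF i s1(1)] s1(2) by simp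
          moreover have "\<not> k < cell u" using a u by auto
          moreover have "s \<le> s2" using first[OF i s2(1)] future[OF i s2(1)] s2(2) by auto
          then have "cell s \<le> K + r" using cell_mono[of s s2] pos[OF i s(1)] s2(2) by simp
          moreover have "\<not> cell s < K + r" using a s(1) K_s by auto
          ultimately show "k = cell u \<and> r = r0" using r0(1) by simp
        next
          assume kr: "k = cell u \<and> r = r0"
          have "cell s' \<notin> {cell u<..<K}" if "s' \<in> \<tau> i" for s'
            using cell_mono[OF pos[OF i that], of u] u_max[OF that] cell_past[OF pos[OF i that]] by auto
          moreover have "cell s' \<notin> {K..<K + r0}" if "s' \<in> \<tau> i" for s'
          proof
            assume a: "cell s' \<in> {K..<K + r0}"
            then have "s \<le> s'" using first[OF i that] future[OF i that] by auto
            then show False using cell_mono[of s s'] pos[OF i s(1)] a r0(1) by simp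
          qed
          ultimately show "(\<exists>s'\<in>\<tau> i. cell s' = k) \<and> (\<forall>s'\<in>\<tau> i. cell s' \<notin> {k<..<K}) \<and>
            (\<exists>s'\<in>\<tau> i. cell s' = K + r) \<and> (\<forall>s'\<in>\<tau> i. cell s' \<notin> {K..<K + r})"
            using kr u(1) s(1) r0(1) by auto
        qed
        finally show ?thesis .
      qed
      have others: "row_weight K l i (cell u) r0 j (c j) = (if j \<in> J then exp (- l) else 1)"
        if j: "j \<in> {1..n}" "j \<noteq> i" for j
      proof -
        have "cell s' \<notin> {K..<K + r0 + of_bool (j < i)}" if s': "s' \<in> \<tau> j" for s'
        proof
          assume a: "cell s' \<in> {K..<K + r0 + of_bool (j < i)}"
          then have "t \<le> s'" using future[OF j(1) s'] by simp
          from first[OF j(1) s' this] show False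
          proof
            assume "s < s'"
            then have "cell s < cell s'" using cell_strict[OF i j(1) s(1) s'] by simp
            then show False using a r0(1) by (auto split: if_splits simp: of_bool_def)
          next
            assume "s = s' \<and> i \<le> j"
            then show False using a r0(1) by simp
          qed
        qed
        moreover have "{K..<K + r0 + of_bool (j < i)} \<subseteq> {..<K + R}" using r0(2) by (auto simp: of_bool_def split: if_splits)
        ultimately have 1: "vacant (c j) {K..<K + r0 + of_bool (j < i)}" using vacant_iff[OF j(1)] by simp
        have "vacant (c j) {cell u + of_bool (j < i)..<K} \<longleftrightarrow> (\<forall>s'\<in>\<tau> j. cell s' \<notin> {cell u + of_bool (j < i)..<K})"
          by (rule vacant_iff[OF j(1)]) auto
        also have "\<dots> \<longleftrightarrow> j \<notin> J"
        proof -
          have "cell s' \<in> {cell u + of_bool (j < i)..<K} \<longleftrightarrow> s' < t \<and> (u < s' \<or> u = s' \<and> i < j)"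
            if s': "s' \<in> \<tau> j" for s'
          proof -
            have *: "u < s' \<Longrightarrow> cell u < cell s'" "s' < u \<Longrightarrow> cell s' < cell u"
              using cell_strict[OF i j(1) u(1) s'] cell_strict[OF j(1) i s' u(1)] u(3) s(2) by auto
            show ?thesis using * cell_past[OF pos[OF j(1) s']] j(2)
              by (cases "u = s'"; cases "u < s'") (auto simp: of_bool_def)
          qed
          then show ?thesis using j unfolding J_def by auto
        qed
        finally show ?thesis using 1 j(2) unfolding row_weight_def by simp
      qed
      have "grid_transform n K R l c = exp (- l) * (\<Prod>j=1..n. row_weight K l i (cell u) r0 j (c j))"
        unfolding gt
      proof (rule sum_sum_single[OF u(4) r0(2)])
        fix k r assume kr: "k < K" "r < R" "(k, r) \<noteq> (cell u, r0)"
        have "joint_weight n K l i k r c = 0"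
          using self[OF kr(1,2)] kr(3) i by (intro prod_zero) auto
        then show "exp (- l) * joint_weight n K l i k r c = 0" by simp
      qed
      also have "(\<Prod>j=1..n. row_weight K l i (cell u) r0 j (c j)) = (\<Prod>j=1..n. if j \<in> J then exp (- l) else 1)"
      proof (rule prod.cong[OF refl])
        fix j assume j: "j \<in> {1..n}"
        have "i \<notin> J" by (simp add: J_def)
        then show "row_weight K l i (cell u) r0 j (c j) = (if j \<in> J then exp (- l) else 1)"
          using others[OF j] self[OF u(4) r0(2)] by (cases "j = i") auto
      qed
      also have "\<dots> = (\<Prod>j\<in>J. exp (- l))"
      proof -
        have "{1..n} \<inter> J = J" by (auto simp: J_def)
        then show ?thesis by (subst prod.inter_restrict[symmetric]) auto
      qed
      also have "\<dots> = exp (- l * real (card J))" by (simp add: exp_of_nat_mult[symmetric] mult.commute)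
      also have "exp (- l) * \<dots> = exp (- l * real (Suc (card J)))" by (simp add: exp_add[symmetric] algebra_simps)
      finally show ?thesis using cost by simp
    qed
  qed
qed

lemma separating_gap:
  assumes "finite (F :: real set)"
  obtains \<delta> where "0 < \<delta>" "\<And>x y. x \<in> F \<Longrightarrow> y \<in> F \<Longrightarrow> x < y \<Longrightarrow> x + \<delta> \<le> y"
proof -
  let ?G = "insert 1 ((\<lambda>(x, y). y - x) ` {(x, y) \<in> F \<times> F. x < y})"
  have "finite {(x, y) \<in> F \<times> F. x < y}" using assms by (rule_tac finite_subset[of _ "F \<times> F"]) auto
  then have fin: "finite ?G" by simp
  have "Min ?G \<in> ?G" using fin by (intro Min_in) auto
  then have "0 < Min ?G" by auto
  moreover have "x + Min ?G \<le> y" if "x \<in> F" "y \<in> F" "x < y" for x y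
  proof -
    have "y - x \<in> ?G" using that by force
    then have "Min ?G \<le> y - x" using fin Min_le by blast
    then show ?thesis by simp
  qed
  ultimately show thesis using that by blast
qed

text \<open>Only finitely many instants matter, so a fine enough grid separates them. With \<open>K * K\<close> cells
  of width \<open>t / K\<close> after \<open>t\<close>, the grid is refined and at the same time its horizon \<open>K * t\<close> grows
  beyond the next request.\<close>

lemma eventually_grid_transform_eq:
  assumes \<pi>: "\<pi> permutes {1..n}" and t: "0 < t"
  shows "\<forall>\<^sub>F K in sequentially. \<forall>c.
    (\<forall>j\<in>{1..n}. \<forall>q<K + K * K. c j q = card (\<tau> j \<inter> {real q * (t / K)..<real (Suc q) * (t / K)})) \<longrightarrow>
    grid_transform n K (K * K) l c =
      exp (- l * real (equilibrium_search_cost n \<pi> \<tau> t)) *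
      of_bool (0 < equilibrium_search_cost n \<pi> \<tau> t)"
proof -
  \<comment> \<open>\<open>B\<close> bounds the first request instant after \<open>t\<close>, and \<open>\<delta>\<close> is a gap between distinct relevant
    instants.\<close>
  have "\<exists>B \<delta>. 0 < \<delta> \<and> (\<forall>j\<in>{1..n}. \<forall>s\<in>\<tau> j. t \<le> s \<longrightarrow> none_earlier t s \<longrightarrow>
    s \<le> B \<and> (\<forall>i\<in>{1..n}. \<forall>i'\<in>{1..n}. \<forall>r\<in>\<tau> i. \<forall>r'\<in>\<tau> i'. r < r' \<longrightarrow> r \<le> s \<longrightarrow> r + \<delta> \<le> r'))"
  proof (cases "\<exists>j\<in>{1..n}. \<exists>s\<in>\<tau> j. t \<le> s")
    case False
    then have "(0::real) < 1 \<and> (\<forall>j\<in>{1..n}. \<forall>s\<in>\<tau> j. t \<le> s \<longrightarrow> Q j s)" for Q :: "nat \<Rightarrow> real \<Rightarrow> bool"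
      by auto
    then show ?thesis by blast
  next
    case True
    then obtain j0 B where B: "j0 \<in> {1..n}" "B \<in> \<tau> j0" "t \<le> B" by auto
    define F where "F = (\<Union>i\<in>{1..n}. \<tau> i \<inter> {0..<B + 1})"
    have "finite F" unfolding F_def by (rule finite_UN_I) (use locally_finite in blast)+
    then obtain \<delta> where \<delta>: "0 < \<delta>" "\<And>x y. x \<in> F \<Longrightarrow> y \<in> F \<Longrightarrow> x < y \<Longrightarrow> x + \<delta> \<le> y"
      by (rule separating_gap) blast
    have gap: "r + min \<delta> 1 \<le> r'" if "i \<in> {1..n}" "i' \<in> {1..n}" "r \<in> \<tau> i" "r' \<in> \<tau> i'" "r < r'" "r \<le> B" for i i' r r'
    proof (cases "r' < B + 1")
      case True
      have "r \<in> F" "r' \<in> F" using that True nonneg[OF that(1)] nonneg[OF that(2)] unfolding F_def by auto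
      then show ?thesis using \<delta>(2)[of r r'] that(5) by simp
    qed (use that in auto)
    show ?thesis
    proof (rule exI[of _ B], rule exI[of _ "min \<delta> 1"], intro conjI ballI impI)
      show "0 < min \<delta> 1" using \<delta>(1) by simp
      show "s \<le> B" if "none_earlier t s" for s using that B by blast
      show "r + min \<delta> 1 \<le> r'" if "none_earlier t s"
        "i \<in> {1..n}" "i' \<in> {1..n}" "r \<in> \<tau> i" "r' \<in> \<tau> i'" "r < r'" "r \<le> s" for s i i' r r'
      proof -
        have "s \<le> B" using that(1) B by blast
        then show ?thesis using gap[OF that(2-6)] that(7) by simp
      qed
    qed
  qed
  then obtain B \<delta> where \<delta>: "0 < \<delta>" and
    gap0: "\<forall>j\<in>{1..n}. \<forall>s\<in>\<tau> j. t \<le> s \<longrightarrow> none_earlier t s \<longrightarrow>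
    s \<le> B \<and> (\<forall>i\<in>{1..n}. \<forall>i'\<in>{1..n}. \<forall>r\<in>\<tau> i. \<forall>r'\<in>\<tau> i'. r < r' \<longrightarrow> r \<le> s \<longrightarrow> r + \<delta> \<le> r')"
    by (elim exE conjE)
  have gap: "s \<le> B" "\<And>i i' r r'. i \<in> {1..n} \<Longrightarrow> i' \<in> {1..n} \<Longrightarrow> r \<in> \<tau> i \<Longrightarrow> r' \<in> \<tau> i' \<Longrightarrow> r < r' \<Longrightarrow> r \<le> s \<Longrightarrow> r + \<delta> \<le> r'"
    if s: "j \<in> {1..n}" "s \<in> \<tau> j" "t \<le> s" "none_earlier t s" for j s
    using mp[OF mp[OF bspec[OF bspec[OF gap0 s(1)] s(2)] s(3)] s(4)] by simp_all
  define K0 where "K0 = max 1 (max (nat \<lceil>t / \<delta>\<rceil>) (nat \<lceil>B / t\<rceil>))"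
  show ?thesis
  proof (rule eventually_sequentiallyI[of K0], intro allI impI)
    fix K c assume K: "K0 \<le> K" and
      c: "\<forall>j\<in>{1..n}. \<forall>q<K + K * K. c j q = card (\<tau> j \<inter> {real q * (t / K)..<real (Suc q) * (t / K)})"
    define h where "h = t / K"
    have K1: "1 \<le> K" and K\<delta>: "t / \<delta> \<le> K" and KB: "B / t \<le> K" using K unfolding K0_def by linarith+
    have h: "0 < h" using t K1 unfolding h_def by simp
    have hK: "real K * h = t" using K1 unfolding h_def by simp
    have h\<delta>: "h \<le> \<delta>" using K\<delta> \<delta> K1 unfolding h_def by (simp add: field_simps)
    have BK: "B \<le> real (K * K) * h"
      using KB t K1 unfolding h_def by (simp add: field_simps)
    define cell where "cell s = nat \<lfloor>s / h\<rfloor>" for s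
    have cell_less: "cell s < q \<longleftrightarrow> s < real q * h" if "0 \<le> s" for s q
    proof -
      have "cell s < q \<longleftrightarrow> \<lfloor>s / h\<rfloor> < int q" using that h unfolding cell_def by (simp add: nat_less_iff)
      also have "\<dots> \<longleftrightarrow> s / h < real q" by (simp add: floor_less_iff)
      also have "\<dots> \<longleftrightarrow> s < real q * h" using h by (simp add: field_simps)
      finally show ?thesis .
    qed
    have cell_eq: "cell s = q \<longleftrightarrow> s \<in> {real q * h..<real (Suc q) * h}" if "0 \<le> s" for s q
      using cell_less[OF that, of q] cell_less[OF that, of "Suc q"] by auto
    show "grid_transform n K (K * K) l c = exp (- l * real (equilibrium_search_cost n \<pi> \<tau> t)) *
      of_bool (0 < equilibrium_search_cost n \<pi> \<tau> t)"
    proof (rule grid_transform_eq[OF \<pi>, where cell = cell])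
      show "cell s \<le> cell s'" if "0 \<le> s" "s \<le> s'" for s s'
        unfolding cell_def using that h by (intro nat_mono floor_mono divide_right_mono) auto
      show "cell s < K \<longleftrightarrow> s < t" if "0 \<le> s" for s using cell_less[OF that, of K] hK by simp
      show "0 < c j q \<longleftrightarrow> (\<exists>s\<in>\<tau> j. cell s = q)" if j: "j \<in> {1..n}" and q: "q < K + K * K" for j q
      proof -
        have "finite (\<tau> j \<inter> {real q * h..<real (Suc q) * h})"
          using nonneg[OF j] by (intro finite_subset[OF _ locally_finite[OF j, of "real (Suc q) * h"]]) auto
        moreover have "c j q = card (\<tau> j \<inter> {real q * h..<real (Suc q) * h})"
          using c j q unfolding h_def by blast
        ultimately have "0 < c j q \<longleftrightarrow> \<tau> j \<inter> {real q * h..<real (Suc q) * h} \<noteq> {}"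
          by (simp add: card_gt_0_iff)
        also have "\<dots> \<longleftrightarrow> (\<exists>s\<in>\<tau> j. cell s = q)" using cell_eq nonneg[OF j] by blast
        finally show ?thesis .
      qed
      fix j s assume js: "j \<in> {1..n}" "s \<in> \<tau> j" "t \<le> s" "none_earlier t s"
      have "s < real (K + K * K) * h" using gap(1)[OF js] BK hK t by (simp add: algebra_simps)
      then have "cell s < K + K * K" using cell_less[of s "K + K * K"] js(3) t by simp
      moreover have "cell r < cell r'" if "i \<in> {1..n}" "i' \<in> {1..n}" "r \<in> \<tau> i" "r' \<in> \<tau> i'" "r < r'" "r \<le> s" for i i' r r'
      proof -
        have "r + h \<le> r'" using gap(2)[OF js that] h\<delta> by linarith
        moreover have "0 \<le> r" "0 \<le> r'" using nonneg[OF that(1)] nonneg[OF that(2)] that by auto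
        moreover have "real (cell r) * h \<le> r" using cell_less[of r "cell r"] \<open>0 \<le> r\<close> by simp
        ultimately have "real (Suc (cell r)) * h \<le> r'" by (simp add: algebra_simps)
        then show ?thesis using cell_less[OF \<open>0 \<le> r'\<close>, of "Suc (cell r)"] by simp
      qed
      ultimately show "cell s < K + K * K \<and>
        (\<forall>i\<in>{1..n}. \<forall>i'\<in>{1..n}. \<forall>r\<in>\<tau> i. \<forall>r'\<in>\<tau> i'. r < r' \<longrightarrow> r \<le> s \<longrightarrow> cell r < cell r')" by blast
    qed
  qed
qed

end

section \<open>Independent Poisson counts on a grid\<close>

text \<open>Objects of popularity \<open>0\<close> are never requested, so rate \<open>0\<close> has to be allowed.\<close>

definition poisson0_pmf :: "real \<Rightarrow> nat pmf" where
  "poisson0_pmf a = (if 0 < a then poisson_pmf a else return_pmf 0)"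

lemma pmf_poisson0: "0 \<le> a \<Longrightarrow> pmf (poisson0_pmf a) m = poisson_prob a m"
  by (cases m) (auto simp: poisson0_pmf_def poisson_prob_def)

lemma prob_poisson0:
  assumes "0 \<le> a"
  shows "measure_pmf.prob (poisson0_pmf a) {0} = exp (- a)"
    and "measure_pmf.prob (poisson0_pmf a) {0<..} = 1 - exp (- a)"
proof -
  show *: "measure_pmf.prob (poisson0_pmf a) {0} = exp (- a)"
    using pmf_poisson0[OF assms, of 0] by (simp add: measure_pmf_single poisson_prob_def)
  have "{0<..} = - {0 :: nat}" by auto
  then show "measure_pmf.prob (poisson0_pmf a) {0<..} = 1 - exp (- a)"
    using measure_pmf.prob_compl[of "{0}" "poisson0_pmf a"] * by (simp add: Compl_eq_Diff_UNIV)
qed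

definition row_pmf :: "nat \<Rightarrow> real \<Rightarrow> (nat \<Rightarrow> nat) pmf" where
  "row_pmf Q a = Pi_pmf {..<Q} 0 (\<lambda>_. poisson0_pmf a)"

definition grid_pmf :: "nat \<Rightarrow> nat \<Rightarrow> (nat \<Rightarrow> real) \<Rightarrow> (nat \<Rightarrow> nat \<Rightarrow> nat) pmf" where
  "grid_pmf n Q a = Pi_pmf {1..n} (\<lambda>_. 0) (\<lambda>i. row_pmf Q (a i))"

text \<open>Both kinds of row weights are built from events that prescribe which cells are occupied and
  which are vacant.\<close>

lemma prob_row_pattern:
  assumes "0 \<le> a" "A \<subseteq> {..<Q}" "B \<subseteq> {..<Q}" "A \<inter> B = {}"
  shows "measure_pmf.expectation (row_pmf Q a) (\<lambda>c. of_bool ((\<forall>q\<in>A. 0 < c q) \<and> vacant c B)) =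
    (1 - exp (- a)) ^ card A * exp (- a) ^ card B"
proof -
  define S where "S q = (if q \<in> A then {0<..} else if q \<in> B then {0} else UNIV :: nat set)" for q
  have fin: "finite A" "finite B" using assms(2,3) finite_subset by auto
  have "measure_pmf.expectation (row_pmf Q a) (\<lambda>c. of_bool ((\<forall>q\<in>A. 0 < c q) \<and> vacant c B)) =
    measure_pmf.expectation (row_pmf Q a) (indicator (Pi {..<Q} S))"
  proof (rule Bochner_Integration.integral_cong[OF refl])
    fix c :: "nat \<Rightarrow> nat"
    have "(\<forall>q\<in>A. 0 < c q) \<and> vacant c B \<longleftrightarrow> c \<in> Pi {..<Q} S"
    proof
      assume "(\<forall>q\<in>A. 0 < c q) \<and> vacant c B"
      then show "c \<in> Pi {..<Q} S" by (auto simp: S_def vacant_def)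
    next
      assume *: "c \<in> Pi {..<Q} S"
      have "0 < c q" if "q \<in> A" for q
      proof -
        have "c q \<in> S q" using * that assms(2) by blast
        then show ?thesis using that by (simp add: S_def)
      qed
      moreover have "c q = 0" if "q \<in> B" for q
      proof -
        have "c q \<in> S q" "q \<notin> A" using * that assms(3,4) by blast+
        then show ?thesis using that by (simp add: S_def)
      qed
      ultimately show "(\<forall>q\<in>A. 0 < c q) \<and> vacant c B" by (simp add: vacant_def)
    qed
    then show "of_bool ((\<forall>q\<in>A. 0 < c q) \<and> vacant c B) = indicator (Pi {..<Q} S) c"
      by (simp add: indicator_def)
  qed
  also have "\<dots> = measure_pmf.prob (row_pmf Q a) (Pi {..<Q} S)" by simp
  also have "\<dots> = (\<Prod>q<Q. measure_pmf.prob (poisson0_pmf a) (S q))"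
    unfolding row_pmf_def by (rule measure_Pi_pmf_Pi) simp
  also have "\<dots> = (\<Prod>q<Q. (if q \<in> A then 1 - exp (- a) else 1) * (if q \<in> B then exp (- a) else 1))"
    using assms(4) by (intro prod.cong refl) (auto simp: S_def prob_poisson0[OF assms(1)])
  also have "\<dots> = (\<Prod>q\<in>A. 1 - exp (- a)) * (\<Prod>q\<in>B. exp (- a))"
    using assms(2,3) by (simp add: prod.distrib prod.inter_restrict[symmetric] Int_absorb1)
  finally show ?thesis by simp
qed

text \<open>The mean of \<open>row_weight\<close> when the counts are independent Poisson variables with mean \<open>a\<close> in every cell.\<close>

definition row_value :: "nat \<Rightarrow> real \<Rightarrow> nat \<Rightarrow> nat \<Rightarrow> nat \<Rightarrow> nat \<Rightarrow> real \<Rightarrow> real" where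
  "row_value K l i k r j a =
    (if j = i then (1 - exp (- a)) ^ 2 * exp (- a) ^ (K - Suc k + r)
     else exp (- a) ^ (r + of_bool (j < i)) *
       (exp (- l) + (1 - exp (- l)) * exp (- a) ^ (K - (k + of_bool (j < i)))))"

lemma row_weight_bounds:
  assumes "0 \<le> l"
  shows "0 \<le> row_weight K l i k r j c" "row_weight K l i k r j c \<le> 1"
  using assms by (auto simp: row_weight_def)

lemma integrable_bounded_pmf:
  fixes f :: "'b \<Rightarrow> real"
  assumes "\<And>x. \<bar>f x\<bar> \<le> B"
  shows "integrable (measure_pmf p) f"
  using assms by (intro measure_pmf.integrable_const_bound[where B = B]) auto

lemma expectation_row_weight:
  assumes "0 \<le> a" "k < K" "r < R"
  shows "measure_pmf.expectation (row_pmf (K + R) a) (row_weight K l i k r j) = row_value K l i k r j a"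
proof (cases "j = i")
  case True
  have "measure_pmf.expectation (row_pmf (K + R) a) (row_weight K l i k r j) =
    measure_pmf.expectation (row_pmf (K + R) a)
      (\<lambda>c. of_bool ((\<forall>q\<in>{k, K + r}. 0 < c q) \<and> vacant c ({k<..<K} \<union> {K..<K + r})))"
    using True by (intro Bochner_Integration.integral_cong refl) (auto simp: row_weight_def vacant_def)
  also have "\<dots> = (1 - exp (- a)) ^ card {k, K + r} * exp (- a) ^ card ({k<..<K} \<union> {K..<K + r})"
    using assms by (intro prob_row_pattern) auto
  also have "card {k, K + r} = 2" using assms(2) by simp
  also have "card ({k<..<K} \<union> {K..<K + r}) = K - Suc k + r" by (subst card_Un_disjoint) auto
  finally show ?thesis using True by (simp add: row_value_def)
next
  case False
  define b where "b = (of_bool (j < i) :: nat)"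
  have b: "b \<le> 1" by (simp add: b_def)
  let ?E = "measure_pmf.expectation (row_pmf (K + R) a)"
  let ?F = "{K..<K + r + b}" and ?P = "{k + b..<K}"
  have "?E (row_weight K l i k r j) =
    ?E (\<lambda>c. exp (- l) * of_bool ((\<forall>q\<in>{}. 0 < c q) \<and> vacant c ?F) +
      (1 - exp (- l)) * of_bool ((\<forall>q\<in>{}. 0 < c q) \<and> vacant c (?F \<union> ?P)))"
    using False by (intro Bochner_Integration.integral_cong refl) (auto simp: row_weight_def vacant_def b_def)
  also have "\<dots> = exp (- l) * ?E (\<lambda>c. of_bool ((\<forall>q\<in>{}. 0 < c q) \<and> vacant c ?F)) +
      (1 - exp (- l)) * ?E (\<lambda>c. of_bool ((\<forall>q\<in>{}. 0 < c q) \<and> vacant c (?F \<union> ?P)))"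
    by (subst Bochner_Integration.integral_add) (auto intro!: integrable_bounded_pmf[of _ 1])
  also have "?E (\<lambda>c. of_bool ((\<forall>q\<in>{}. 0 < c q) \<and> vacant c ?F)) = (1 - exp (- a)) ^ card ({} :: nat set) * exp (- a) ^ card ?F"
    using assms b by (intro prob_row_pattern) auto
  also have "?E (\<lambda>c. of_bool ((\<forall>q\<in>{}. 0 < c q) \<and> vacant c (?F \<union> ?P))) =
      (1 - exp (- a)) ^ card ({} :: nat set) * exp (- a) ^ card (?F \<union> ?P)"
    using assms b by (intro prob_row_pattern) auto
  also have "card (?F \<union> ?P) = (r + b) + (K - (k + b))" by (subst card_Un_disjoint) auto
  finally show ?thesis using False by (simp add: row_value_def b_def power_add algebra_simps)
qed

definition grid_value :: "nat \<Rightarrow> nat \<Rightarrow> nat \<Rightarrow> real \<Rightarrow> (nat \<Rightarrow> real) \<Rightarrow> real" where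
  "grid_value n K R l a =
    (\<Sum>i=1..n. \<Sum>k<K. \<Sum>r<R. exp (- l) * (\<Prod>j=1..n. row_value K l i k r j (a j)))"

lemma expectation_grid_transform:
  assumes l: "0 \<le> l" and a: "\<And>j. j \<in> {1..n} \<Longrightarrow> 0 \<le> a j"
  shows "integrable (measure_pmf (grid_pmf n (K + R) a)) (grid_transform n K R l)"
    and "measure_pmf.expectation (grid_pmf n (K + R) a) (grid_transform n K R l) = grid_value n K R l a"
proof -
  let ?p = "grid_pmf n (K + R) a"
  have int: "integrable (measure_pmf ?p) (\<lambda>c. \<Prod>j=1..n. row_weight K l i k r j (c j))" for i k r
    using row_weight_bounds[OF l]
    by (intro integrable_bounded_pmf[of _ 1]) (auto simp: abs_of_nonneg prod_nonneg intro!: prod_le_1)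
  show "integrable (measure_pmf ?p) (grid_transform n K R l)"
    unfolding grid_transform_def[abs_def] using int by auto
  have "measure_pmf.expectation ?p (\<lambda>c. \<Prod>j=1..n. row_weight K l i k r j (c j)) =
    (\<Prod>j=1..n. row_value K l i k r j (a j))" if "k < K" "r < R" for i k r
  proof -
    have "measure_pmf.expectation ?p (\<lambda>c. \<Prod>j\<in>{1..n}. row_weight K l i k r j (c j)) =
      (\<Prod>j=1..n. measure_pmf.expectation (row_pmf (K + R) (a j)) (row_weight K l i k r j))"
      unfolding grid_pmf_def using row_weight_bounds[OF l]
      by (intro expectation_prod_Pi_pmf) (auto intro!: integrable_bounded_pmf[of _ 1] simp: abs_of_nonneg)
    also have "\<dots> = (\<Prod>j=1..n. row_value K l i k r j (a j))"
      by (intro prod.cong refl expectation_row_weight a that)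
    finally show ?thesis .
  qed
  then show "measure_pmf.expectation ?p (grid_transform n K R l) = grid_value n K R l a"
    unfolding grid_transform_def[abs_def] grid_value_def using int by simp
qed

lemma grid_transform_nonneg: "0 \<le> l \<Longrightarrow> 0 \<le> grid_transform n K R l c"
  unfolding grid_transform_def by (intro sum_nonneg mult_nonneg_nonneg prod_nonneg ballI row_weight_bounds) auto

lemma nn_integral_grid_transform:
  assumes "0 \<le> l" "\<And>j. j \<in> {1..n} \<Longrightarrow> 0 \<le> a j"
  shows "(\<integral>\<^sup>+c. ennreal (grid_transform n K R l c) \<partial>grid_pmf n (K + R) a) = ennreal (grid_value n K R l a)"
  using expectation_grid_transform[OF assms] grid_transform_nonneg[OF assms(1)]
  by (simp add: nn_integral_eq_integral)

section \<open>The joint law of the request counts\<close>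

text \<open>The value \<open>0\<close> outside the grid makes the counts range over a countable set of functions.\<close>

definition interval_counts :: "nat \<Rightarrow> nat \<Rightarrow> real \<Rightarrow> (nat \<Rightarrow> real set) \<Rightarrow> nat \<Rightarrow> nat \<Rightarrow> nat" where
  "interval_counts n Q h \<tau> = (\<lambda>j q. if j \<in> {1..n} \<and> q < Q
    then card (\<tau> j \<inter> {real q * h..<real (Suc q) * h}) else 0)"

locale poisson_request_model = prob_space M for M :: "'a measure" +
  fixes n :: nat and w :: "nat \<Rightarrow> 'a \<Rightarrow> real" and T :: "nat \<Rightarrow> 'a \<Rightarrow> real set"
  assumes w_measurable [measurable]: "\<And>i. i \<in> {1..n} \<Longrightarrow> w i \<in> borel_measurable M"
    and w_nonneg: "\<And>i \<omega>. i \<in> {1..n} \<Longrightarrow> \<omega> \<in> space M \<Longrightarrow> 0 \<le> w i \<omega>"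
    and poisson: "conditionally_poisson_requests M n w T"
begin

abbreviation pop :: "'a \<Rightarrow> nat \<Rightarrow> real" where
  "pop \<omega> \<equiv> \<lambda>i. popularity n w i \<omega>"

lemma pop_measurable [measurable]: "i \<in> {1..n} \<Longrightarrow> (\<lambda>\<omega>. pop \<omega> i) \<in> borel_measurable M"
  unfolding popularity_def by measurable

lemma pop_nonneg: "i \<in> {1..n} \<Longrightarrow> \<omega> \<in> space M \<Longrightarrow> 0 \<le> pop \<omega> i"
  unfolding popularity_def using w_nonneg by (auto intro!: divide_nonneg_nonneg sum_nonneg)

lemma request_configuration_at: "\<omega> \<in> space M \<Longrightarrow> request_configuration n (\<lambda>i. T i \<omega>)"
  using poisson unfolding conditionally_poisson_requests_def by unfold_locales blast+

lemma card_interval_measurable [measurable]: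
  assumes j: "j \<in> {1..n}" and ab: "0 \<le> a" "a \<le> b"
  shows "(\<lambda>\<omega>. card (T j \<omega> \<inter> {a..<b})) \<in> measurable M (count_space UNIV)"
proof -
  have [measurable]: "(\<lambda>\<omega>. card (T j \<omega> \<inter> {0..<u})) \<in> measurable M (count_space UNIV)" for u
    using poisson j unfolding conditionally_poisson_requests_def by blast
  have "card (T j \<omega> \<inter> {a..<b}) = card (T j \<omega> \<inter> {0..<b}) - card (T j \<omega> \<inter> {0..<a})"
    if "\<omega> \<in> space M" for \<omega>
  proof -
    have "finite (T j \<omega> \<inter> {0..<a})"
      using request_configuration.locally_finite[OF request_configuration_at[OF that] j] .
    moreover have "T j \<omega> \<inter> {0..<a} \<subseteq> T j \<omega> \<inter> {0..<b}" using ab by auto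
    ultimately have "card ((T j \<omega> \<inter> {0..<b}) - (T j \<omega> \<inter> {0..<a})) =
      card (T j \<omega> \<inter> {0..<b}) - card (T j \<omega> \<inter> {0..<a})" by (rule card_Diff_subset)
    moreover have "T j \<omega> \<inter> {a..<b} = (T j \<omega> \<inter> {0..<b}) - (T j \<omega> \<inter> {0..<a})" using ab by auto
    ultimately show ?thesis by simp
  qed
  note measurable_cong[OF this, THEN iffD2]
  then show ?thesis by this measurable
qed

lemma subalgebra_vector: "subalgebra M (generated_by_vector M n w)"
  unfolding subalgebra_def generated_by_vector_def
proof (intro conjI)
  have "(\<lambda>\<omega>. \<lambda>i\<in>{1..n}. w i \<omega>) \<in> measurable M (\<Pi>\<^sub>M i\<in>{1..n}. borel)"
    by (intro measurable_restrict) (rule w_measurable)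
  then show "sets (vimage_algebra (space M) (\<lambda>\<omega>. \<lambda>i\<in>{1..n}. w i \<omega>) (\<Pi>\<^sub>M i\<in>{1..n}. borel)) \<subseteq> sets M"
    by (rule sets_image_in_sets[OF refl])
qed simp

abbreviation counts :: "nat \<Rightarrow> real \<Rightarrow> 'a \<Rightarrow> nat \<Rightarrow> nat \<Rightarrow> nat" where
  "counts Q h \<omega> \<equiv> interval_counts n Q h (\<lambda>i. T i \<omega>)"

lemma counts_measurable [measurable]:
  assumes "0 \<le> h"
  shows "(\<lambda>\<omega>. counts Q h \<omega> j q) \<in> measurable M (count_space UNIV)"
proof (cases "j \<in> {1..n} \<and> q < Q")
  case True
  then have "j \<in> {1..n}" by simp
  note card_interval_measurable[OF this, of "real q * h" "real (Suc q) * h"]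
  then show ?thesis using True assms unfolding interval_counts_def by (simp add: algebra_simps)
qed (auto simp: interval_counts_def)

lemma sets_counts_eq [measurable]:
  assumes "0 \<le> h" and m: "\<And>j q. \<not> (j \<in> {1..n} \<and> q < Q) \<Longrightarrow> m j q = 0"
  shows "{\<omega> \<in> space M. counts Q h \<omega> = m} \<in> sets M"
    and "{\<omega> \<in> space M. counts Q h \<omega> = m} = {\<omega> \<in> space M. \<forall>i\<in>{1..n}. \<forall>j<Q. card (T i \<omega> \<inter> {real j * h..<real (Suc j) * h}) = m i j}"
proof -
  have eq: "interval_counts n Q h \<tau> = m \<longleftrightarrow> (\<forall>i\<in>{1..n}. \<forall>j\<in>{..<Q}. interval_counts n Q h \<tau> i j = m i j)" for \<tau>
  proof
    assume *: "\<forall>i\<in>{1..n}. \<forall>j\<in>{..<Q}. interval_counts n Q h \<tau> i j = m i j"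
    show "interval_counts n Q h \<tau> = m"
    proof (intro ext)
      fix i j show "interval_counts n Q h \<tau> i j = m i j"
        using * m[of i j] by (cases "i \<in> {1..n} \<and> j < Q") (auto simp: interval_counts_def)
    qed
  qed simp
  note [measurable] = counts_measurable[OF assms(1)]
  show "{\<omega> \<in> space M. counts Q h \<omega> = m} \<in> sets M" unfolding eq by measurable
  show "{\<omega> \<in> space M. counts Q h \<omega> = m} = {\<omega> \<in> space M. \<forall>i\<in>{1..n}. \<forall>j<Q. card (T i \<omega> \<inter> {real j * h..<real (Suc j) * h}) = m i j}"
    unfolding eq by (auto simp: interval_counts_def)
qed

abbreviation counts_law :: "nat \<Rightarrow> real \<Rightarrow> 'a \<Rightarrow> (nat \<Rightarrow> nat \<Rightarrow> nat) pmf" where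
  "counts_law Q h \<omega> \<equiv> grid_pmf n Q (\<lambda>i. pop \<omega> i * h)"

text \<open>Integrating the conditional law of the counts on an equidistant grid: their law is the mixture
  of the product Poisson laws over the random popularities.\<close>

lemma prob_counts_eq:
  assumes h: "0 \<le> h" and m: "\<And>j q. \<not> (j \<in> {1..n} \<and> q < Q) \<Longrightarrow> m j q = 0"
  shows "(\<lambda>\<omega>. pmf (counts_law Q h \<omega>) m) \<in> borel_measurable M"
    and "emeasure M {\<omega> \<in> space M. counts Q h \<omega> = m} =
      (\<integral>\<^sup>+\<omega>. ennreal (pmf (counts_law Q h \<omega>) m) \<partial>M)"
proof -
  let ?A = "{\<omega> \<in> space M. counts Q h \<omega> = m}"
  let ?s = "\<lambda>j. real j * h"
  let ?G = "generated_by_vector M n w"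
  let ?f = "\<lambda>\<omega>. \<Prod>i=1..n. \<Prod>j<Q. poisson_prob (pop \<omega> i * h) (m i j)"
  have pmf_eq: "pmf (counts_law Q h \<omega>) m = ?f \<omega>" if "\<omega> \<in> space M" for \<omega>
  proof -
    have "pmf (counts_law Q h \<omega>) m = (\<Prod>i=1..n. pmf (row_pmf Q (pop \<omega> i * h)) (m i))"
      unfolding grid_pmf_def using m by (intro pmf_Pi') auto
    also have "\<dots> = (\<Prod>i=1..n. \<Prod>j<Q. pmf (poisson0_pmf (pop \<omega> i * h)) (m i j))"
      unfolding row_pmf_def using m by (intro prod.cong refl pmf_Pi') auto
    also have "\<dots> = ?f \<omega>"
      using pop_nonneg[OF _ that] h by (intro prod.cong refl pmf_poisson0) auto
    finally show ?thesis .
  qed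
  have f_meas [measurable]: "?f \<in> borel_measurable M" unfolding poisson_prob_def by measurable
  show "(\<lambda>\<omega>. pmf (counts_law Q h \<omega>) m) \<in> borel_measurable M"
    by (subst measurable_cong[OF pmf_eq]) measurable
  have A: "?A \<in> sets M" by (rule sets_counts_eq(1)[OF h m])
  interpret sub: finite_measure_subalgebra M ?G
    by unfold_locales (rule subalgebra_vector)
  have "mono ?s" using h by (intro monoI mult_right_mono) auto
  moreover have "0 \<le> ?s 0" by simp
  ultimately have "AE \<omega> in M. real_cond_exp M ?G
      (indicator {\<omega>' \<in> space M. \<forall>i\<in>{1..n}. \<forall>j<Q. card (T i \<omega>' \<inter> {?s j..<?s (Suc j)}) = m i j}) \<omega>
    = (\<Prod>i=1..n. \<Prod>j<Q. poisson_prob (popularity n w i \<omega> * (?s (Suc j) - ?s j)) (m i j))"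
    using poisson[unfolded conditionally_poisson_requests_def, THEN conjunct2, THEN conjunct2,
      THEN spec[of _ Q], THEN spec[of _ ?s], THEN spec[of _ m]] by blast
  moreover have "?A = {\<omega>' \<in> space M. \<forall>i\<in>{1..n}. \<forall>j<Q. card (T i \<omega>' \<inter> {?s j..<?s (Suc j)}) = m i j}"
    by (rule sets_counts_eq(2)[OF h]) (rule m)
  moreover have "?s (Suc j) - ?s j = h" for j by (simp add: algebra_simps)
  ultimately have AE: "AE \<omega> in M. real_cond_exp M ?G (indicator ?A) \<omega> = ?f \<omega>"
    by (simp only:)
  have int: "integrable M (indicator ?A :: 'a \<Rightarrow> real)" using A by (simp add: integrable_indicator_iff emeasure_eq_measure)
  have f_int: "integrable M ?f"
    by (rule integrable_cong_AE_imp[OF sub.real_cond_exp_int(1)[OF int] f_meas]) (use AE in auto)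
  have f_nonneg: "AE \<omega> in M. 0 \<le> ?f \<omega>"
  proof (rule AE_I2)
    fix \<omega> assume "\<omega> \<in> space M"
    from pmf_eq[OF this, symmetric] show "0 \<le> ?f \<omega>" by (simp only: pmf_nonneg)
  qed
  have "measure M ?A = (\<integral>\<omega>. indicator ?A \<omega> \<partial>M)" using A by simp
  also have "\<dots> = (\<integral>\<omega>. real_cond_exp M ?G (indicator ?A) \<omega> \<partial>M)"
    using sub.real_cond_exp_int(2)[OF int] by simp
  also have "\<dots> = (\<integral>\<omega>. ?f \<omega> \<partial>M)" by (rule integral_cong_AE[OF _ f_meas AE]) simp
  finally have "emeasure M ?A = ennreal (\<integral>\<omega>. ?f \<omega> \<partial>M)" by (simp add: emeasure_eq_measure)
  also have "\<dots> = (\<integral>\<^sup>+\<omega>. ennreal (?f \<omega>) \<partial>M)"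
    by (rule nn_integral_eq_integral[OF f_int f_nonneg, symmetric])
  also have "\<dots> = (\<integral>\<^sup>+\<omega>. ennreal (pmf (counts_law Q h \<omega>) m) \<partial>M)"
    by (intro nn_integral_cong) (simp add: pmf_eq)
  finally show "emeasure M ?A = (\<integral>\<^sup>+\<omega>. ennreal (pmf (counts_law Q h \<omega>) m) \<partial>M)" .
qed

text \<open>The set is the support of a grid distribution with positive rates.\<close>

lemma countable_counts: "countable (PiE_dflt {1..n} (\<lambda>_. 0) (\<lambda>_. PiE_dflt {..<Q} 0 (\<lambda>_. UNIV)) :: (nat \<Rightarrow> nat \<Rightarrow> nat) set)"
proof -
  have "set_pmf (row_pmf Q 1) = PiE_dflt {..<Q} 0 (\<lambda>_. UNIV)"
    unfolding row_pmf_def poisson0_pmf_def by (subst set_Pi_pmf) (auto simp: o_def)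
  then have "set_pmf (grid_pmf n Q (\<lambda>_. 1)) = PiE_dflt {1..n} (\<lambda>_. 0) (\<lambda>_. PiE_dflt {..<Q} 0 (\<lambda>_. UNIV))"
    unfolding grid_pmf_def by (subst set_Pi_pmf) (auto simp: o_def)
  then show ?thesis by (metis countable_set_pmf)
qed

text \<open>The counts take countably many values, so the identity for point masses extends to arbitrary
  functions by interchanging a countable sum with the integral.\<close>

lemma nn_integral_counts:
  fixes f :: "(nat \<Rightarrow> nat \<Rightarrow> nat) \<Rightarrow> ennreal" and Q :: nat and h :: real
  assumes h: "0 \<le> h"
  defines "c \<equiv> \<lambda>\<omega>. counts Q h \<omega>"
  shows "(\<lambda>\<omega>. f (c \<omega>)) \<in> borel_measurable M"
    and "(\<integral>\<^sup>+\<omega>. f (c \<omega>) \<partial>M) = (\<integral>\<^sup>+\<omega>. (\<integral>\<^sup>+m. f m \<partial>counts_law Q h \<omega>) \<partial>M)"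
proof -
  define C :: "(nat \<Rightarrow> nat \<Rightarrow> nat) set" where "C = PiE_dflt {1..n} (\<lambda>_. 0) (\<lambda>_. PiE_dflt {..<Q} 0 (\<lambda>_. UNIV))"
  have C: "countable C" unfolding C_def by (rule countable_counts)
  have C0: "m j q = 0" if "m \<in> C" "\<not> (j \<in> {1..n} \<and> q < Q)" for m j q
  proof (cases "j \<in> {1..n}")
    case True
    then have "m j \<in> PiE_dflt {..<Q} 0 (\<lambda>_. UNIV)" using that(1) unfolding C_def PiE_dflt_def by blast
    then show ?thesis using True that(2) unfolding PiE_dflt_def by auto
  next
    case False
    then have "m j = (\<lambda>_. 0)" using that(1) unfolding C_def PiE_dflt_def by auto
    then show ?thesis by simp
  qed
  have cC: "c \<omega> \<in> C" for \<omega>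
    unfolding C_def c_def PiE_dflt_def interval_counts_def by auto
  let ?A = "\<lambda>m. {\<omega> \<in> space M. c \<omega> = m}"
  have A [measurable]: "?A m \<in> sets M" if "m \<in> C" for m
    using sets_counts_eq(1)[OF h C0[OF that]] unfolding c_def by simp
  have pmf_meas: "(\<lambda>\<omega>. ennreal (pmf (counts_law Q h \<omega>) m) * f m) \<in> borel_measurable M"
    if "m \<in> C" for m
  proof -
    have [measurable]: "(\<lambda>\<omega>. pmf (counts_law Q h \<omega>) m) \<in> borel_measurable M"
      by (rule prob_counts_eq(1)[OF h]) (rule C0[OF that])
    show ?thesis by measurable
  qed
  have f_eq: "f (c \<omega>) = (\<integral>\<^sup>+m. f m * indicator (?A m) \<omega> \<partial>count_space C)" if "\<omega> \<in> space M" for \<omega>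
  proof -
    have "(\<integral>\<^sup>+m. f m * indicator (?A m) \<omega> \<partial>count_space C) = (\<integral>\<^sup>+m. f m * indicator {c \<omega>} m \<partial>count_space C)"
      using that by (intro nn_integral_cong) (auto simp: indicator_def)
    also have "\<dots> = f (c \<omega>)" using cC by simp
    finally show ?thesis by simp
  qed
  show "(\<lambda>\<omega>. f (c \<omega>)) \<in> borel_measurable M"
  proof (rule measurable_compose_countable'[OF _ _ C, where f = "\<lambda>m _. f m" and g = c])
    show "c \<in> measurable M (count_space C)"
      using C cC A by (subst measurable_count_space_eq_countable) (auto simp: vimage_def Int_def conj_commute)
  qed simp
  have "(\<integral>\<^sup>+\<omega>. f (c \<omega>) \<partial>M) = (\<integral>\<^sup>+\<omega>. (\<integral>\<^sup>+m. f m * indicator (?A m) \<omega> \<partial>count_space C) \<partial>M)"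
    by (intro nn_integral_cong f_eq)
  also have "\<dots> = (\<integral>\<^sup>+m. (\<integral>\<^sup>+\<omega>. f m * indicator (?A m) \<omega> \<partial>M) \<partial>count_space C)"
    by (rule nn_integral_count_space_nn_integral[OF C]) measurable
  also have "\<dots> = (\<integral>\<^sup>+m. (\<integral>\<^sup>+\<omega>. ennreal (pmf (counts_law Q h \<omega>) m) * f m \<partial>M) \<partial>count_space C)"
  proof (rule nn_integral_cong)
    fix m assume "m \<in> space (count_space C)"
    then have m: "m \<in> C" by simp
    have [measurable]: "(\<lambda>\<omega>. pmf (counts_law Q h \<omega>) m) \<in> borel_measurable M"
      by (rule prob_counts_eq(1)[OF h]) (rule C0[OF m])
    have "emeasure M (?A m) = (\<integral>\<^sup>+\<omega>. ennreal (pmf (counts_law Q h \<omega>) m) \<partial>M)"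
      unfolding c_def by (rule prob_counts_eq(2)[OF h]) (rule C0[OF m])
    moreover have "?A m \<in> sets M" using A[OF m] .
    ultimately
    show "(\<integral>\<^sup>+\<omega>. f m * indicator (?A m) \<omega> \<partial>M) =
      (\<integral>\<^sup>+\<omega>. ennreal (pmf (counts_law Q h \<omega>) m) * f m \<partial>M)"
      by (simp only: nn_integral_cmult_indicator) (subst nn_integral_multc, measurable, rule mult.commute)
  qed
  also have "\<dots> = (\<integral>\<^sup>+\<omega>. (\<integral>\<^sup>+m. ennreal (pmf (counts_law Q h \<omega>) m) * f m \<partial>count_space C) \<partial>M)"
    by (rule nn_integral_count_space_nn_integral[OF C, symmetric]) (rule pmf_meas)
  also have "\<dots> = (\<integral>\<^sup>+\<omega>. (\<integral>\<^sup>+m. f m \<partial>counts_law Q h \<omega>) \<partial>M)"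
  proof (rule nn_integral_cong)
    fix \<omega> assume "\<omega> \<in> space M"
    have "pmf (grid_pmf n Q a) m = 0" if "m \<notin> C" for m a
    proof -
      have row: "set_pmf (row_pmf Q b) \<subseteq> PiE_dflt {..<Q} 0 (\<lambda>_. UNIV)" for b
        unfolding row_pmf_def by (rule order_trans[OF set_Pi_pmf_subset']) (auto simp: PiE_dflt_def)
      have "set_pmf (grid_pmf n Q a) \<subseteq> PiE_dflt {1..n} (\<lambda>_. 0) (\<lambda>i. set_pmf (row_pmf Q (a i)))"
        unfolding grid_pmf_def using set_Pi_pmf_subset'[of "{1..n}"] by (simp add: o_def)
      also have "\<dots> \<subseteq> C" unfolding C_def PiE_dflt_def[of "{1..n}"] using row by blast
      finally have "set_pmf (grid_pmf n Q a) \<subseteq> C" .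
      then show ?thesis using that by (auto simp: set_pmf_iff)
    qed
    then show "(\<integral>\<^sup>+m. ennreal (pmf (counts_law Q h \<omega>) m) * f m \<partial>count_space C) =
      (\<integral>\<^sup>+m. f m \<partial>counts_law Q h \<omega>)"
      unfolding nn_integral_measure_pmf by (intro nn_integral_count_space_eq) auto
  qed
  finally show "(\<integral>\<^sup>+\<omega>. f (c \<omega>) \<partial>M) = (\<integral>\<^sup>+\<omega>. (\<integral>\<^sup>+m. f m \<partial>counts_law Q h \<omega>) \<partial>M)" .
qed

end

section \<open>Refining the grid\<close>

lemma sum_of_bool_le_1:
  fixes K :: nat
  assumes "\<And>k k'. k < K \<Longrightarrow> k' < K \<Longrightarrow> P k \<Longrightarrow> P k' \<Longrightarrow> k = k'"
  shows "(\<Sum>k<K. of_bool (P k)) \<le> (1 :: real)"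
proof -
  have "(\<Sum>k<K. of_bool (P k)) = real (card ({..<K} \<inter> {k. P k}))" by simp
  also have "card ({..<K} \<inter> {k. P k}) \<le> 1"
    using assms by (subst One_nat_def, subst card_le_Suc0_iff_eq) auto
  finally show ?thesis by simp
qed

text \<open>At most one \<open>k\<close> is the cell of the last request of \<open>i\<close> before \<open>t\<close>, and at most one \<open>r\<close> gives the
  cell of its next one. This crude bound provides the domination when the grid is refined.\<close>

lemma grid_transform_le:
  assumes l: "0 \<le> l"
  shows "grid_transform n K R l c \<le> real n"
proof -
  have "(\<Sum>k<K. \<Sum>r<R. exp (- l) * joint_weight n K l i k r c) \<le> 1"
    if i: "i \<in> {1..n}" for i
  proof -
    let ?A = "\<lambda>k. of_bool (0 < c i k \<and> vacant (c i) {k<..<K}) :: real"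
    let ?B = "\<lambda>r. of_bool (0 < c i (K + r) \<and> vacant (c i) {K..<K + r}) :: real"
    have "exp (- l) * joint_weight n K l i k r c \<le> ?A k * ?B r" for k r
    proof -
      have "joint_weight n K l i k r c =
        row_weight K l i k r i (c i) * (\<Prod>j\<in>{1..n} - {i}. row_weight K l i k r j (c j))"
        using i by (simp add: prod.remove)
      also have "\<dots> \<le> row_weight K l i k r i (c i) * 1"
        using row_weight_bounds[OF l] by (intro mult_left_mono prod_le_1) auto
      also have "\<dots> = ?A k * ?B r" by (auto simp: row_weight_def)
      finally have "joint_weight n K l i k r c \<le> ?A k * ?B r" .
      then have "exp (- l) * joint_weight n K l i k r c \<le> 1 * (?A k * ?B r)"
        using l row_weight_bounds[OF l] by (intro mult_mono prod_nonneg) auto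
      then show ?thesis by simp
    qed
    then have "(\<Sum>k<K. \<Sum>r<R. exp (- l) * joint_weight n K l i k r c) \<le>
      (\<Sum>k<K. \<Sum>r<R. ?A k * ?B r)" by (intro sum_mono)
    also have "\<dots> = (\<Sum>k<K. ?A k) * (\<Sum>r<R. ?B r)" by (rule sum_product[symmetric])
    also have "\<dots> \<le> 1 * 1"
    proof (intro mult_mono sum_of_bool_le_1 sum_nonneg)
      show "k = k'" if "k < K" "k' < K" "0 < c i k \<and> vacant (c i) {k<..<K}" "0 < c i k' \<and> vacant (c i) {k'<..<K}" for k k'
        using that by (cases k k' rule: linorder_cases) (auto simp: vacant_def)
      show "r = r'" if "0 < c i (K + r) \<and> vacant (c i) {K..<K + r}" "0 < c i (K + r') \<and> vacant (c i) {K..<K + r'}" for r r'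
        using that by (cases r r' rule: linorder_cases) (auto simp: vacant_def)
    qed auto
    finally show ?thesis by simp
  qed
  then have "grid_transform n K R l c \<le> (\<Sum>i=1..n. 1)" unfolding grid_transform_def by (intro sum_mono)
  then show ?thesis by simp
qed

lemma grid_value_bounds:
  assumes "0 \<le> l" "\<And>j. j \<in> {1..n} \<Longrightarrow> 0 \<le> a j"
  shows "0 \<le> grid_value n K R l a" "grid_value n K R l a \<le> real n"
proof -
  have E: "integrable (measure_pmf (grid_pmf n (K + R) a)) (grid_transform n K R l)"
    "measure_pmf.expectation (grid_pmf n (K + R) a) (grid_transform n K R l) = grid_value n K R l a"
    using expectation_grid_transform[of l n a K R] assms by auto
  have "0 \<le> measure_pmf.expectation (grid_pmf n (K + R) a) (grid_transform n K R l)"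
    by (intro Bochner_Integration.integral_nonneg grid_transform_nonneg assms(1))
  then show "0 \<le> grid_value n K R l a" unfolding E(2) .
  have "measure_pmf.expectation (grid_pmf n (K + R) a) (grid_transform n K R l) \<le>
      measure_pmf.expectation (grid_pmf n (K + R) a) (\<lambda>_. real n)"
    using E(1) grid_transform_le[OF assms(1)] by (intro integral_mono) auto
  then show "grid_value n K R l a \<le> real n" unfolding E(2) by simp
qed

text \<open>The probability that \<open>i\<close> is the first object requested in the \<open>R\<close> cells after \<open>t\<close>.\<close>

definition first_request_sum :: "nat \<Rightarrow> nat \<Rightarrow> (nat \<Rightarrow> real) \<Rightarrow> nat \<Rightarrow> real" where
  "first_request_sum n R a i = (\<Sum>r<R. (1 - exp (- a i)) * exp (- a i) ^ r *
     (\<Prod>j\<in>{1..n} - {i}. exp (- a j) ^ (r + of_bool (j < i))))"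

text \<open>The mean of \<open>exp (- l S)\<close> for the search-cost \<open>S\<close> of \<open>i\<close>, when each other object \<open>j\<close> stands in front
  of \<open>i\<close> independently with probability \<open>1 - z j\<close>.\<close>

definition search_factor :: "nat \<Rightarrow> real \<Rightarrow> (nat \<Rightarrow> real) \<Rightarrow> nat \<Rightarrow> real" where
  "search_factor n l z i = exp (- l) * (\<Prod>j\<in>{1..n} - {i}. exp (- l) + (1 - exp (- l)) * z j)"

lemma search_factor_bounds:
  assumes l: "0 \<le> l" and z: "\<And>j. j \<in> {1..n} \<Longrightarrow> 0 \<le> z j \<and> z j \<le> 1"
  shows "0 \<le> search_factor n l z i" "search_factor n l z i \<le> 1"
proof -
  have *: "0 \<le> exp (- l) + (1 - exp (- l)) * z j \<and> exp (- l) + (1 - exp (- l)) * z j \<le> 1"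
    if j: "j \<in> {1..n} - {i}" for j
  proof -
    have "(1 - exp (- l)) * z j \<le> 1 - exp (- l)" using l z j by (intro mult_left_le) auto
    then show ?thesis using l z j by (auto intro!: add_nonneg_nonneg mult_nonneg_nonneg)
  qed
  have "0 \<le> (\<Prod>j\<in>{1..n} - {i}. exp (- l) + (1 - exp (- l)) * z j)"
    by (intro prod_nonneg ballI) (use * in blast)
  moreover have "(\<Prod>j\<in>{1..n} - {i}. exp (- l) + (1 - exp (- l)) * z j) \<le> 1"
    by (intro prod_le_1) (use * in blast)
  ultimately show "0 \<le> search_factor n l z i" "search_factor n l z i \<le> 1"
    unfolding search_factor_def using l by (auto intro!: mult_le_one)
qed

text \<open>Summation over the distance \<open>k\<close> of the cell of the last request of \<open>i\<close> to \<open>t\<close>; \<open>j\<close> stays behind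
  \<open>i\<close> if it is not requested in the \<open>k\<close> later cells nor, for \<open>i < j\<close>, in the same one.\<close>

definition last_request_sum :: "nat \<Rightarrow> nat \<Rightarrow> real \<Rightarrow> (nat \<Rightarrow> real) \<Rightarrow> nat \<Rightarrow> real" where
  "last_request_sum n K l a i = (\<Sum>k<K. (1 - exp (- a i)) * exp (- a i) ^ k *
     search_factor n l (\<lambda>j. exp (- a j) ^ (k + of_bool (i < j))) i)"

lemma sum_sum_factor:
  fixes F G :: "nat \<Rightarrow> real"
  shows "(\<Sum>k<K. \<Sum>r<R. F r * G k) = (\<Sum>r<R. F r) * (\<Sum>k<K. G k)"
  by (simp add: sum_distrib_left sum_distrib_right)

text \<open>The requests before and after \<open>t\<close> are independent.\<close>

lemma grid_value_factor:
  "grid_value n K R l a =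
    (\<Sum>i=1..n. first_request_sum n R a i * last_request_sum n K l a i)"
proof -
  let ?F = "\<lambda>i r. (1 - exp (- a i)) * exp (- a i) ^ r *
     (\<Prod>j\<in>{1..n} - {i}. exp (- a j) ^ (r + of_bool (j < i)))"
  let ?G = "\<lambda>i k. (1 - exp (- a i)) * exp (- a i) ^ k *
     search_factor n l (\<lambda>j. exp (- a j) ^ (k + of_bool (i < j))) i"
  have "(\<Sum>k<K. \<Sum>r<R. exp (- l) * (\<Prod>j=1..n. row_value K l i k r j (a j))) =
    first_request_sum n R a i * last_request_sum n K l a i" if i: "i \<in> {1..n}" for i
  proof -
    have *: "exp (- l) * (\<Prod>j=1..n. row_value K l i k r j (a j)) = ?F i r * ?G i (K - Suc k)" if k: "k < K" for k r
    proof -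
      have "(\<Prod>j=1..n. row_value K l i k r j (a j)) =
        row_value K l i k r i (a i) * (\<Prod>j\<in>{1..n} - {i}. row_value K l i k r j (a j))"
        using i by (simp add: prod.remove)
      also have "(\<Prod>j\<in>{1..n} - {i}. row_value K l i k r j (a j)) =
        (\<Prod>j\<in>{1..n} - {i}. exp (- a j) ^ (r + of_bool (j < i)) *
          (exp (- l) + (1 - exp (- l)) * exp (- a j) ^ (K - Suc k + of_bool (i < j))))"
      proof (rule prod.cong[OF refl])
        fix j assume "j \<in> {1..n} - {i}"
        then have ji: "j \<noteq> i" by simp
        have "K - (k + of_bool (j < i)) = K - Suc k + of_bool (i < j)"
          using k ji by (cases "j < i") auto
        then show "row_value K l i k r j (a j) = exp (- a j) ^ (r + of_bool (j < i)) *
          (exp (- l) + (1 - exp (- l)) * exp (- a j) ^ (K - Suc k + of_bool (i < j)))"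
          using ji by (simp only: row_value_def if_False)
      qed
      also have "\<dots> = (\<Prod>j\<in>{1..n} - {i}. exp (- a j) ^ (r + of_bool (j < i))) *
        (\<Prod>j\<in>{1..n} - {i}. exp (- l) + (1 - exp (- l)) * exp (- a j) ^ (K - Suc k + of_bool (i < j)))"
        by (rule prod.distrib)
      finally have e: "(\<Prod>j=1..n. row_value K l i k r j (a j)) = row_value K l i k r i (a i) * \<dots>" .
      show ?thesis unfolding e
        by (simp only: row_value_def refl if_True search_factor_def power_add power2_eq_square mult_ac)
    qed
    have "(\<Sum>k<K. \<Sum>r<R. exp (- l) * (\<Prod>j=1..n. row_value K l i k r j (a j))) =
      (\<Sum>k<K. \<Sum>r<R. ?F i r * ?G i (K - Suc k))"
      by (intro sum.cong refl *) simp
    also have "\<dots> = (\<Sum>r<R. ?F i r) * (\<Sum>k<K. ?G i (K - Suc k))"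
      by (rule sum_sum_factor)
    also have "(\<Sum>k<K. ?G i (K - Suc k)) = (\<Sum>k<K. ?G i k)" by (rule sum.nat_diff_reindex)
    finally show ?thesis unfolding first_request_sum_def last_request_sum_def .
  qed
  then show ?thesis unfolding grid_value_def by (rule sum.cong[OF refl])
qed

text \<open>Since the popularities sum to \<open>1\<close>, the sum over \<open>r\<close> is geometric with ratio \<open>exp (- h)\<close>, where
  \<open>h = s / K\<close>, and its value is close to \<open>(1 - exp (- p i h)) / (1 - exp (- h))\<close>.\<close>

lemma first_request_sum_tendsto:
  assumes p: "\<And>j. j \<in> {1..n} \<Longrightarrow> 0 \<le> p j" and sum1: "(\<Sum>j=1..n. p j) = 1"
    and i: "i \<in> {1..n}" and s: "0 < s"
  shows "(\<lambda>K. first_request_sum n (K * K) (\<lambda>j. p j * (s / real K)) i) \<longlonglongrightarrow> p i"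
proof -
  define S where "S = (\<Sum>j\<in>{1..n} - {i}. p j * of_bool (j < i))"
  have eq: "first_request_sum n (K * K) (\<lambda>j. p j * (s / real K)) i =
    (1 - exp (- (p i * (s / K)))) / (1 - exp (- (s / K))) * exp (- (S * (s / K))) * (1 - exp (- (s * K)))"
    if K: "0 < K" for K
  proof -
    define h where "h = s / real K"
    have h: "0 < h" using s K unfolding h_def by simp
    have "(1 - exp (- (p i * h))) * exp (- (p i * h)) ^ r *
        (\<Prod>j\<in>{1..n} - {i}. exp (- (p j * h)) ^ (r + of_bool (j < i))) =
      (1 - exp (- (p i * h))) * exp (- (S * h)) * exp (- h) ^ r" for r
    proof -
      have "(\<Prod>j\<in>{1..n} - {i}. exp (- (p j * h)) ^ (r + of_bool (j < i))) =
        exp (\<Sum>j\<in>{1..n} - {i}. - (p j * h) * real r - p j * h * of_bool (j < i))"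
        unfolding exp_sum[OF finite_Diff[OF finite_atLeastAtMost]]
        by (intro prod.cong refl) (simp add: exp_of_nat_mult[symmetric] algebra_simps exp_add[symmetric])
      also have "(\<Sum>j\<in>{1..n} - {i}. - (p j * h) * real r - p j * h * of_bool (j < i)) =
        - (h * real r * (\<Sum>j\<in>{1..n} - {i}. p j)) - S * h"
        unfolding S_def by (simp add: sum_subtractf sum_distrib_left sum_distrib_right sum_negf mult_ac
            del: sum_mult_of_bool_eq sum_of_bool_mult_eq)
      also have "(\<Sum>j\<in>{1..n} - {i}. p j) = 1 - p i"
        using i sum1 by (simp add: sum_diff1)
      finally show ?thesis
        by (simp add: exp_of_nat_mult[symmetric] exp_add[symmetric] algebra_simps)
    qed
    then have "first_request_sum n (K * K) (\<lambda>j. p j * h) i =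
      (1 - exp (- (p i * h))) * exp (- (S * h)) * (\<Sum>r<K * K. exp (- h) ^ r)"
      unfolding first_request_sum_def sum_distrib_left by (intro sum.cong refl)
    also have "(\<Sum>r<K * K. exp (- h) ^ r) = (1 - exp (- h) ^ (K * K)) / (1 - exp (- h))"
      using h by (subst sum_gp_strict) auto
    also have "exp (- h) ^ (K * K) = exp (- (s * K))"
      using K by (simp add: exp_of_nat_mult[symmetric] h_def)
    finally show ?thesis unfolding h_def by (simp add: mult_ac)
  qed
  \<comment> \<open>\<open>S\<close> collects the ties that are decided against \<open>i\<close>; its effect vanishes with the cell width.\<close>
  have "(\<lambda>K. (1 - exp (- (p i * (s / real K)))) / (1 - exp (- (s / real K)))) \<longlonglongrightarrow> p i"
  proof (cases "p i = 0")
    case False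
    then have "0 < p i" using p[OF i] by simp
    then show ?thesis using s by real_asymp
  qed simp
  moreover have "(\<lambda>K. exp (- (S * (s / real K)))) \<longlonglongrightarrow> 1" by real_asymp
  moreover have "(\<lambda>K. 1 - exp (- (s * real K))) \<longlonglongrightarrow> 1" using s by real_asymp
  ultimately have "(\<lambda>K. (1 - exp (- (p i * (s / K)))) / (1 - exp (- (s / K))) * exp (- (S * (s / K))) * (1 - exp (- (s * K))))
    \<longlonglongrightarrow> p i * 1 * 1" by (intro tendsto_mult)
  then show ?thesis unfolding mult_1_right
    by (rule Lim_transform_eventually)
      (use eq in \<open>auto intro!: eventually_sequentiallyI[of 1]\<close>)
qed

lemma has_integral_exponential_cell:
  fixes a b q :: real
  assumes "a \<le> b"
  shows "has_bochner_integral lborel (\<lambda>u. indicator {a..<b} u * (q * exp (- (q * u)))) (exp (- (q * a)) - exp (- (q * b)))"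
proof -
  have "has_bochner_integral lborel (\<lambda>u. (q * exp (- (q * u))) * indicator {a..b} u)
      ((\<lambda>u. - exp (- (q * u))) b - (\<lambda>u. - exp (- (q * u))) a)"
    using assms by (intro has_bochner_integral_FTC_Icc_real[where F = "\<lambda>u. - exp (- (q * u))"])
      (auto intro!: derivative_eq_intros)
  then have "has_bochner_integral lborel (\<lambda>u. indicator {a..b} u * (q * exp (- (q * u)))) (exp (- (q * a)) - exp (- (q * b)))"
    by (simp add: mult.commute)
  then show ?thesis
  proof (rule has_bochner_integral_cong_AE[THEN iffD1, rotated -1])
    show "AE u in lborel. indicator {a..b} u * (q * exp (- (q * u))) = indicator {a..<b} u * (q * exp (- (q * u)))"
      using AE_lborel_singleton[of b] by eventually_elim (auto simp: indicator_def)
  qed auto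
qed

text \<open>The sum is the exact integral of a function that is obtained from the limiting integrand by
  rounding the argument of the product to the grid; dominated convergence then removes the rounding.\<close>

lemma last_request_sum_tendsto:
  assumes p: "\<And>j. j \<in> {1..n} \<Longrightarrow> 0 \<le> p j" and i: "i \<in> {1..n}" and s: "0 < s" and l: "0 \<le> l"
  shows "(\<lambda>K. last_request_sum n K l (\<lambda>j. p j * (s / real K)) i) \<longlonglongrightarrow>
    (LBINT u:{0..<s}. p i * exp (- (p i * u)) * search_factor n l (\<lambda>j. exp (- (p j * u))) i)"
proof -
  let ?H = "\<lambda>v. search_factor n l (\<lambda>j. exp (- (p j * v j))) i"
  define f where "f K u = indicator {0..<s} u * (p i * exp (- (p i * u)) *
    ?H (\<lambda>j. (s / real K) * (\<lfloor>u / (s / real K)\<rfloor> + of_bool (i < j))))" for K :: nat and u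
  define g where "g u = indicator {0..<s} u * (p i * exp (- (p i * u)) * ?H (\<lambda>j. u))" for u
  have H01: "0 \<le> ?H v \<and> ?H v \<le> 1" if "\<And>j. j \<in> {1..n} \<Longrightarrow> 0 \<le> v j" for v
    using search_factor_bounds[of l n "\<lambda>j. exp (- (p j * v j))" i] l p that by simp
  have norm_le: "norm (x * (y * z)) \<le> x * y" if "0 \<le> x" "0 \<le> y" "0 \<le> z" "z \<le> 1" for x y z :: real
    using that by (simp add: abs_mult mult_left_le mult_left_mono)
  have int: "(\<integral>u. f K u \<partial>lborel) = last_request_sum n K l (\<lambda>j. p j * (s / real K)) i" if K: "0 < K" for K
  proof -
    define h where "h = s / real K"
    have h: "0 < h" and hK: "real K * h = s" using s K unfolding h_def by auto
    let ?C = "\<lambda>k. ?H (\<lambda>j. h * (real k + of_bool (i < j)))"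
    have f_eq: "f K u = (\<Sum>k<K. ?C k * (indicator {real k * h..<real (Suc k) * h} u * (p i * exp (- (p i * u)))))" for u
    proof (cases "u \<in> {0..<s}")
      case False
      have "u \<notin> {real k * h..<real (Suc k) * h}" if "k < K" for k
      proof
        assume "u \<in> {real k * h..<real (Suc k) * h}"
        moreover have "0 \<le> real k * h" "real (Suc k) * h \<le> real K * h"
          using h that by (auto intro!: mult_right_mono simp del: of_nat_Suc)
        ultimately show False using False hK by auto
      qed
      then show ?thesis using False by (simp add: f_def)
    next
      case True
      define k0 where "k0 = nat \<lfloor>u / h\<rfloor>"
      have fl: "\<lfloor>u / h\<rfloor> = int k0" using True h unfolding k0_def by simp
      have cell: "u \<in> {real k * h..<real (Suc k) * h} \<longleftrightarrow> k = k0" for k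
      proof -
        have "u \<in> {real k * h..<real (Suc k) * h} \<longleftrightarrow> real k \<le> u / h \<and> u / h < real k + 1"
          using h by (simp add: field_simps)
        also have "\<dots> \<longleftrightarrow> \<lfloor>u / h\<rfloor> = int k" by (simp add: floor_eq_iff)
        finally show ?thesis using fl by auto
      qed
      have "k0 < K"
      proof -
        have "u / h < real K" using True h hK by (simp add: field_simps)
        then have "\<lfloor>u / h\<rfloor> < int K" by (simp add: floor_less_iff)
        then show ?thesis using fl by simp
      qed
      have "(\<Sum>k<K. ?C k * (indicator {real k * h..<real (Suc k) * h} u * (p i * exp (- (p i * u))))) =
        (\<Sum>k<K. if k = k0 then ?C k0 * (p i * exp (- (p i * u))) else 0)"
        using cell by (intro sum.cong refl) (simp add: indicator_def)
      also have "\<dots> = ?C k0 * (p i * exp (- (p i * u)))" using \<open>k0 < K\<close> by simp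
      also have "\<dots> = f K u" using True fl unfolding f_def h_def[symmetric] by (simp add: mult.commute)
      finally show ?thesis by simp
    qed
    have "has_bochner_integral lborel (f K)
      (\<Sum>k<K. ?C k * (exp (- (p i * (real k * h))) - exp (- (p i * (real (Suc k) * h)))))"
      unfolding f_eq[abs_def] using h
      by (intro has_bochner_integral_sum has_bochner_integral_mult_right has_integral_exponential_cell)
        (auto intro!: mult_right_mono)
    then have "(\<integral>u. f K u \<partial>lborel) =
      (\<Sum>k<K. ?C k * (exp (- (p i * (real k * h))) - exp (- (p i * (real (Suc k) * h)))))"
      by (rule has_bochner_integral_integral_eq)
    also have "\<dots> = last_request_sum n K l (\<lambda>j. p j * h) i"
      unfolding last_request_sum_def
    proof (rule sum.cong[OF refl])
      fix k
      have e: "exp (- (p j * h)) ^ m = exp (- (p j * (h * real m)))" for j m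
        by (simp add: exp_of_nat_mult[symmetric] mult_ac)
      have d: "exp (- (p i * (real k * h))) - exp (- (p i * (real (Suc k) * h))) =
        (1 - exp (- (p i * h))) * exp (- (p i * h)) ^ k"
        unfolding e by (simp add: algebra_simps exp_add[symmetric])
      show "?C k * (exp (- (p i * (real k * h))) - exp (- (p i * (real (Suc k) * h)))) =
        (1 - exp (- (p i * h))) * exp (- (p i * h)) ^ k *
        search_factor n l (\<lambda>j. exp (- (p j * h)) ^ (k + of_bool (i < j))) i"
        unfolding d e of_nat_add of_nat_of_bool by (rule mult.commute)
    qed
    finally show ?thesis unfolding h_def .
  qed
  have "(\<lambda>K. \<integral>u. f K u \<partial>lborel) \<longlonglongrightarrow> (\<integral>u. g u \<partial>lborel)"
  proof (rule integral_dominated_convergence[where w = "\<lambda>u. indicator {0..<s} u * (p i * exp (- (p i * u)))"])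
    show "g \<in> borel_measurable lborel" unfolding g_def[abs_def] search_factor_def by measurable
    show "f K \<in> borel_measurable lborel" for K unfolding f_def[abs_def] search_factor_def by measurable
    show "integrable lborel (\<lambda>u. indicator {0..<s} u * (p i * exp (- (p i * u))))"
      using has_integral_exponential_cell[of 0 s "p i", OF less_imp_le[OF s]]
      by (simp only: has_bochner_integral_iff)
    show "AE u in lborel. (\<lambda>K. f K u) \<longlonglongrightarrow> g u"
    proof (rule AE_I2)
      fix u
      have "(\<lambda>K. (s / real K) * (\<lfloor>u / (s / real K)\<rfloor> + of_bool (i < j))) \<longlonglongrightarrow> u" for j
      proof (rule tendsto_sandwich[where f = "\<lambda>K. u - s / real K" and h = "\<lambda>K. u + s / real K"])
        have bounds: "u - h \<le> h * (\<lfloor>u / h\<rfloor> + of_bool (i < j)) \<and> h * (\<lfloor>u / h\<rfloor> + of_bool (i < j)) \<le> u + h"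
          if "0 < h" for h
        proof -
          have "u / h - 1 \<le> real_of_int \<lfloor>u / h\<rfloor> + of_bool (i < j)" "real_of_int \<lfloor>u / h\<rfloor> + of_bool (i < j) \<le> u / h + 1"
            by (auto simp: of_bool_def) linarith+
          then have "h * (u / h - 1) \<le> h * (real_of_int \<lfloor>u / h\<rfloor> + of_bool (i < j))"
            "h * (real_of_int \<lfloor>u / h\<rfloor> + of_bool (i < j)) \<le> h * (u / h + 1)"
            using that by (auto intro!: mult_left_mono)
          then show ?thesis using that by (simp add: algebra_simps)
        qed
        show "\<forall>\<^sub>F K in sequentially. u - s / real K \<le> (s / real K) * (\<lfloor>u / (s / real K)\<rfloor> + of_bool (i < j))"
          by (rule eventually_sequentiallyI[of 1], rule bounds[THEN conjunct1]) (use s in simp)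
        show "\<forall>\<^sub>F K in sequentially. (s / real K) * (\<lfloor>u / (s / real K)\<rfloor> + of_bool (i < j)) \<le> u + s / real K"
          by (rule eventually_sequentiallyI[of 1], rule bounds[THEN conjunct2]) (use s in simp)
        show "(\<lambda>K. u - s / real K) \<longlonglongrightarrow> u" "(\<lambda>K. u + s / real K) \<longlonglongrightarrow> u" by real_asymp+
      qed
      then show "(\<lambda>K. f K u) \<longlonglongrightarrow> g u" unfolding f_def g_def search_factor_def by (intro tendsto_intros)
    qed
    show "AE u in lborel. norm (f K u) \<le> indicator {0..<s} u * (p i * exp (- (p i * u)))" for K
    proof (rule AE_I2)
      fix u
      show "norm (f K u) \<le> indicator {0..<s} u * (p i * exp (- (p i * u)))"
      proof (cases "u \<in> {0..<s}")
        case True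
        have "0 \<le> ?H (\<lambda>j. (s / real K) * (\<lfloor>u / (s / real K)\<rfloor> + of_bool (i < j))) \<and>
          ?H (\<lambda>j. (s / real K) * (\<lfloor>u / (s / real K)\<rfloor> + of_bool (i < j))) \<le> 1"
          using True s by (intro H01 mult_nonneg_nonneg add_nonneg_nonneg) auto
        then show ?thesis unfolding f_def using p[OF i] by (intro norm_le) auto
      qed (simp add: f_def)
    qed
  qed
  then have "(\<lambda>K. last_request_sum n K l (\<lambda>j. p j * (s / real K)) i) \<longlonglongrightarrow> (\<integral>u. g u \<partial>lborel)"
    by (rule Lim_transform_eventually) (use int in \<open>auto intro!: eventually_sequentiallyI[of 1]\<close>)
  then show ?thesis unfolding g_def set_lebesgue_integral_def by simp
qed

text \<open>The transform for deterministic popularities \<open>p\<close>. Looking backwards from time \<open>s\<close>, the last request of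
  \<open>i\<close> is at an exponential distance \<open>u\<close>, and every other object \<open>j\<close> stands in front of \<open>i\<close>
  independently with probability \<open>1 - exp (- p j u)\<close>. The factor \<open>p i\<close> is the probability that \<open>i\<close> is
  the next requested object.\<close>

definition equilibrium_integral :: "nat \<Rightarrow> (nat \<Rightarrow> real) \<Rightarrow> real \<Rightarrow> real \<Rightarrow> real" where
  "equilibrium_integral n p s l =
    (\<Sum>i=1..n. p i * (LBINT u:{0..<s}. p i * exp (- (p i * u)) *
      search_factor n l (\<lambda>j. exp (- (p j * u))) i))"

lemma grid_value_tendsto:
  assumes p: "\<And>j. j \<in> {1..n} \<Longrightarrow> 0 \<le> p j"
    and total: "(\<Sum>j=1..n. p j) = 1 \<or> (\<forall>j\<in>{1..n}. p j = 0)"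
    and s: "0 < s" and l: "0 \<le> l"
  shows "(\<lambda>K. grid_value n K (K * K) l (\<lambda>j. p j * (s / real K))) \<longlonglongrightarrow> equilibrium_integral n p s l"
  using total
proof
  assume "\<forall>j\<in>{1..n}. p j = 0"
  then have "grid_value n K (K * K) l (\<lambda>j. p j * (s / real K)) = 0" "equilibrium_integral n p s l = 0" for K
    by (auto simp: grid_value_factor first_request_sum_def equilibrium_integral_def intro!: sum.neutral)
  then show ?thesis by simp
next
  assume sum1: "(\<Sum>j=1..n. p j) = 1"
  show ?thesis unfolding grid_value_factor equilibrium_integral_def
    by (intro tendsto_sum tendsto_mult tendsto_const first_request_sum_tendsto last_request_sum_tendsto p sum1 s l)
qed

context poisson_request_model
begin

text \<open>The measurability of the search-cost is a by-product, for it is a pointwise limit of functions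
  of finitely many counts.\<close>

lemma equilibrium_transform_eq:
  assumes \<pi>: "\<pi> permutes {1..n}" and s: "0 < s" and l: "0 \<le> l"
  shows "(\<lambda>\<omega>. equilibrium_integral n (pop \<omega>) s l) \<in> borel_measurable M"
    and "equilibrium_transform M n \<pi> T s l = (\<integral>\<omega>. equilibrium_integral n (pop \<omega>) s l \<partial>M)"
proof -
  define A where "A K \<omega> = grid_transform n K (K * K) l (interval_counts n (K + K * K) (s / real K) (\<lambda>i. T i \<omega>))" for K \<omega>
  define B where "B K \<omega> = grid_value n K (K * K) l (\<lambda>j. pop \<omega> j * (s / real K))" for K \<omega>
  define D where "D \<omega> = exp (- l * real (equilibrium_search_cost n \<pi> (\<lambda>i. T i \<omega>) s)) *
    of_bool (0 < equilibrium_search_cost n \<pi> (\<lambda>i. T i \<omega>) s)" for \<omega>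
  have h: "0 \<le> s / real K" for K :: nat using s by simp
  have A_meas [measurable]: "A K \<in> borel_measurable M" for K
  proof -
    have "(\<lambda>\<omega>. ennreal (A K \<omega>)) \<in> borel_measurable M" unfolding A_def by (rule nn_integral_counts(1)[OF h])
    then have "(\<lambda>\<omega>. enn2real (ennreal (A K \<omega>))) \<in> borel_measurable M" by measurable
    then show ?thesis using grid_transform_nonneg[OF l] unfolding A_def by simp
  qed
  have B_meas [measurable]: "B K \<in> borel_measurable M" for K
    unfolding B_def[abs_def] grid_value_def row_value_def by measurable
  have A_lim: "(\<lambda>K. A K \<omega>) \<longlonglongrightarrow> D \<omega>" if "\<omega> \<in> space M" for \<omega>
  proof (rule tendsto_eventually)
    interpret request_configuration n "\<lambda>i. T i \<omega>" by (rule request_configuration_at[OF that])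
    show "\<forall>\<^sub>F K in sequentially. A K \<omega> = D \<omega>"
      using eventually_grid_transform_eq[OF \<pi> s, of l]
    proof eventually_elim
      case (elim K)
      show ?case unfolding A_def D_def by (rule elim[rule_format]) (simp add: interval_counts_def)
    qed
  qed
  have B_lim: "(\<lambda>K. B K \<omega>) \<longlonglongrightarrow> equilibrium_integral n (pop \<omega>) s l" if "\<omega> \<in> space M" for \<omega>
    unfolding B_def
  proof (rule grid_value_tendsto[OF pop_nonneg[OF _ that] _ s l])
    show "(\<Sum>j=1..n. pop \<omega> j) = 1 \<or> (\<forall>j\<in>{1..n}. pop \<omega> j = 0)"
      by (cases "(\<Sum>j=1..n. w j \<omega>) = 0") (auto simp: popularity_def sum_divide_distrib[symmetric])
  qed
  have AB: "(\<integral>\<omega>. A K \<omega> \<partial>M) = (\<integral>\<omega>. B K \<omega> \<partial>M)" for K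
  proof -
    have ah: "0 \<le> pop \<omega> j * (s / real K)" if "\<omega> \<in> space M" "j \<in> {1..n}" for \<omega> j
      by (rule mult_nonneg_nonneg[OF pop_nonneg[OF that(2,1)] h])
    have "(\<integral>\<^sup>+\<omega>. ennreal (A K \<omega>) \<partial>M) = (\<integral>\<^sup>+\<omega>. (\<integral>\<^sup>+c. ennreal (grid_transform n K (K * K) l c)
        \<partial>grid_pmf n (K + K * K) (\<lambda>i. pop \<omega> i * (s / real K))) \<partial>M)"
      unfolding A_def by (rule nn_integral_counts(2)[OF h])
    also have "\<dots> = (\<integral>\<^sup>+\<omega>. ennreal (B K \<omega>) \<partial>M)"
      unfolding B_def using ah by (intro nn_integral_cong nn_integral_grid_transform[OF l]) auto
    finally have "(\<integral>\<^sup>+\<omega>. ennreal (A K \<omega>) \<partial>M) = (\<integral>\<^sup>+\<omega>. ennreal (B K \<omega>) \<partial>M)" .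
    moreover have "AE \<omega> in M. 0 \<le> A K \<omega>" using grid_transform_nonneg[OF l] unfolding A_def by simp
    moreover have "AE \<omega> in M. 0 \<le> B K \<omega>"
      using grid_value_bounds(1)[OF l ah] unfolding B_def by (intro AE_I2) auto
    ultimately show ?thesis by (simp add: integral_eq_nn_integral)
  qed
  show E_meas: "(\<lambda>\<omega>. equilibrium_integral n (pop \<omega>) s l) \<in> borel_measurable M"
    using B_lim by (rule borel_measurable_LIMSEQ_real) measurable
  have D_meas: "D \<in> borel_measurable M"
    using A_lim by (rule borel_measurable_LIMSEQ_real) measurable
  have "(\<lambda>K. \<integral>\<omega>. A K \<omega> \<partial>M) \<longlonglongrightarrow> (\<integral>\<omega>. D \<omega> \<partial>M)"
  proof (rule integral_dominated_convergence[where w = "\<lambda>_. real n"])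
    show "AE \<omega> in M. norm (A K \<omega>) \<le> real n" for K
      using grid_transform_le[OF l] grid_transform_nonneg[OF l] unfolding A_def by simp
  qed (use A_lim D_meas in auto)
  moreover have "(\<lambda>K. \<integral>\<omega>. B K \<omega> \<partial>M) \<longlonglongrightarrow> (\<integral>\<omega>. equilibrium_integral n (pop \<omega>) s l \<partial>M)"
  proof (rule integral_dominated_convergence[where w = "\<lambda>_. real n"])
    show "AE \<omega> in M. norm (B K \<omega>) \<le> real n" for K
    proof (rule AE_I2)
      fix \<omega> assume "\<omega> \<in> space M"
      then have "0 \<le> pop \<omega> j * (s / real K)" if "j \<in> {1..n}" for j
        by (rule mult_nonneg_nonneg[OF pop_nonneg[OF that] h])
      from grid_value_bounds[OF l this] show "norm (B K \<omega>) \<le> real n" unfolding B_def by simp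
    qed
  qed (use B_lim E_meas in auto)
  ultimately have "(\<integral>\<omega>. D \<omega> \<partial>M) = (\<integral>\<omega>. equilibrium_integral n (pop \<omega>) s l \<partial>M)"
    unfolding AB by (rule LIMSEQ_unique)
  then show "equilibrium_transform M n \<pi> T s l = (\<integral>\<omega>. equilibrium_integral n (pop \<omega>) s l \<partial>M)"
    unfolding equilibrium_transform_def D_def .
qed

end

section \<open>The law of large numbers for rescaled popularities\<close>

lemma space_Rplus [simp]: "space Rplus = {0..}"
  by (simp add: Rplus_def)

lemma prob_Rplus_simps:
  assumes "Q \<in> prob_Rplus"
  shows "prob_space Q" "sets Q = sets Rplus" "space Q = {0..}"
  using assms sets_eq_imp_space_eq[of Q Rplus] by (auto simp: prob_Rplus_def)

lemma measurable_prob_Rplus: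
  assumes "Q \<in> prob_Rplus" "f \<in> borel_measurable borel"
  shows "f \<in> borel_measurable Q"
  using measurable_restrict_space1[OF assms(2), of "{0..}"] prob_Rplus_simps(2)[OF assms(1)]
  by (simp add: Rplus_def cong: measurable_cong_sets)

text \<open>The empirical measure is the image of the uniform distribution on the indices.\<close>

lemma integral_empirical_measure:
  fixes f :: "real \<Rightarrow> real"
  assumes n: "1 \<le> n" and x: "\<And>i. i \<in> {1..n} \<Longrightarrow> 0 \<le> x i" and f: "f \<in> borel_measurable borel"
  shows "(\<integral>u. f u \<partial>empirical_measure n x) = (1 / real n) * (\<Sum>i=1..n. f (x i))"
proof -
  define x' where "x' i = (if i \<in> {1..n} then x i else 0)" for i
  have x'_meas: "x' \<in> measurable (measure_pmf (pmf_of_set {1..n})) Rplus"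
    using x by (auto simp: x'_def)
  have "empirical_measure n x = distr (measure_pmf (pmf_of_set {1..n})) Rplus x'"
    unfolding empirical_measure_def distr_def
  proof (rule measure_of_eq[OF sets.space_closed])
    fix A assume "A \<in> sigma_sets (space Rplus) (sets Rplus)"
    then have A: "A \<in> sets Rplus" by (simp only: sets.sigma_sets_eq)
    have "emeasure (measure_pmf (pmf_of_set {1..n})) (x' -` A \<inter> space (measure_pmf (pmf_of_set {1..n}))) =
      (\<integral>\<^sup>+i. indicator (x' -` A) i \<partial>pmf_of_set {1..n})" by simp
    also have "\<dots> = (\<Sum>i=1..n. indicator (x' -` A) i) / of_nat n"
      using n by (subst nn_integral_pmf_of_set) (auto simp del: nn_integral_indicator simp: ennreal_of_nat_eq_real_of_nat)
    also have "\<dots> = ennreal (1 / real n) * (\<Sum>i=1..n. emeasure (return Rplus (x i)) A)"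
    proof -
      have "(\<Sum>i=1..n. indicator (x' -` A) i) = (\<Sum>i=1..n. emeasure (return Rplus (x i)) A)"
        using A by (intro sum.cong) (auto simp: x'_def indicator_def)
      moreover have "ennreal (1 / real n) = inverse (of_nat n)"
        using n by (simp add: ennreal_of_nat_eq_real_of_nat inverse_ennreal inverse_eq_divide)
      ultimately show ?thesis by (simp add: divide_ennreal_def mult.commute)
    qed
    finally show "ennreal (1 / real n) * (\<Sum>i=1..n. emeasure (return Rplus (x i)) A) =
      emeasure (measure_pmf (pmf_of_set {1..n})) (x' -` A \<inter> space (measure_pmf (pmf_of_set {1..n})))" by simp
  qed
  moreover have "f \<in> borel_measurable Rplus" unfolding Rplus_def by (rule measurable_restrict_space1[OF f])
  ultimately have "(\<integral>u. f u \<partial>empirical_measure n x) = (\<integral>i. f (x' i) \<partial>measure_pmf (pmf_of_set {1..n}))"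
    by (simp only: integral_distr[OF x'_meas])
  also have "\<dots> = (\<Sum>i=1..n. f (x' i)) / real n" using n by (subst integral_pmf_of_set) auto
  also have "(\<Sum>i=1..n. f (x' i)) = (\<Sum>i=1..n. f (x i))" by (simp add: x'_def)
  finally show ?thesis by simp
qed

lemma topspace_weak_topology: "topspace weak_topology = prob_Rplus"
proof -
  have "prob_Rplus \<in> {{Q \<in> prob_Rplus. (\<integral>x. f x \<partial>Q) \<in> U} | (f :: real \<Rightarrow> real) U.
        continuous_on {0..} f \<and> bounded (f ` {0..}) \<and> open U}"
    by (intro CollectI exI[of _ "\<lambda>_. 0"] exI[of _ UNIV]) (auto simp: image_constant_conv)
  then show ?thesis unfolding weak_topology_def topology_generated_by_topspace by blast
qed

lemma continuous_map_weak_integral: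
  assumes f: "continuous_on {0..} f" "bounded (f ` {0..})"
  shows "continuous_map weak_topology euclideanreal (\<lambda>Q. \<integral>x. f x \<partial>Q)"
  unfolding continuous_map_def
proof (intro conjI allI impI)
  fix U :: "real set" assume "openin euclideanreal U"
  then have "{Q \<in> prob_Rplus. (\<integral>x. f x \<partial>Q) \<in> U} \<in> {{Q \<in> prob_Rplus. (\<integral>x. f x \<partial>Q) \<in> U} | (f :: real \<Rightarrow> real) U.
        continuous_on {0..} f \<and> bounded (f ` {0..}) \<and> open U}"
    using f by auto
  then show "openin weak_topology {Q \<in> topspace weak_topology. (\<integral>x. f x \<partial>Q) \<in> U}"
    unfolding topspace_weak_topology unfolding weak_topology_def by (rule topology_generated_by_Basis)
qed simp

lemma abs_integral_le:
  assumes "Q \<in> prob_Rplus" "\<And>x. 0 \<le> x \<Longrightarrow> \<bar>f x\<bar> \<le> B"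
  shows "\<bar>\<integral>x. f x \<partial>Q\<bar> \<le> (B :: real)"
proof -
  interpret prob_space Q using prob_Rplus_simps(1)[OF assms(1)] .
  show ?thesis
  proof (cases "integrable Q f")
    case True
    have "\<bar>\<integral>x. f x \<partial>Q\<bar> \<le> (\<integral>x. \<bar>f x\<bar> \<partial>Q)" by (rule integral_abs_bound)
    also have "\<dots> \<le> (\<integral>x. B \<partial>Q)"
      using True assms(2) prob_Rplus_simps(3)[OF assms(1)] by (intro integral_mono) auto
    finally show ?thesis by (simp add: prob_space)
  next
    case False
    then show ?thesis using assms(2)[of 0] by (simp add: not_integrable_integral_eq)
  qed
qed

text \<open>Convergence in law to a constant is convergence in probability: the functional
  \<open>Q \<mapsto> |Q f - P f|\<close> is bounded, weakly continuous and vanishes at \<open>P\<close>.\<close>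

lemma weak_convergence_test_function:
  fixes f :: "real \<Rightarrow> real"
  assumes conv: "converges_in_law_to_const M weak_topology X P" and P: "P \<in> prob_Rplus"
    and f: "continuous_on {0..} f" "\<And>x. 0 \<le> x \<Longrightarrow> \<bar>f x\<bar> \<le> B"
  shows "(\<lambda>n. \<integral>\<omega>. \<bar>(\<integral>x. f x \<partial>X n \<omega>) - (\<integral>x. f x \<partial>P)\<bar> \<partial>M n) \<longlonglongrightarrow> 0"
proof -
  let ?F = "\<lambda>Q. \<bar>(\<integral>x. f x \<partial>Q) - (\<integral>x. f x \<partial>P)\<bar>"
  have "bounded (f ` {0..})" using f(2) by (auto simp: bounded_iff)
  then have "continuous_map weak_topology euclideanreal (\<lambda>Q. \<integral>x. f x \<partial>Q)"
    by (rule continuous_map_weak_integral[OF f(1)])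
  then have "continuous_map weak_topology euclideanreal ?F"
    by (intro continuous_map_real_abs continuous_map_diff) auto
  moreover have "\<bar>?F Q\<bar> \<le> B + B" if "Q \<in> prob_Rplus" for Q
  proof -
    have "\<bar>\<integral>x. f x \<partial>Q\<bar> \<le> B" "\<bar>\<integral>x. f x \<partial>P\<bar> \<le> B"
      by (rule abs_integral_le[OF that], rule f(2), simp) (rule abs_integral_le[OF P], rule f(2), simp)
    then show ?thesis by linarith
  qed
  then have "bounded (?F ` topspace weak_topology)"
    unfolding topspace_weak_topology bounded_iff by auto
  ultimately have "(\<lambda>n. \<integral>\<omega>. ?F (X n \<omega>) \<partial>M n) \<longlonglongrightarrow> ?F P"
    using conv unfolding converges_in_law_to_const_def by blast
  then show ?thesis by simp
qed

lemma weak_conv_return_test: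
  fixes X :: "nat \<Rightarrow> 'a \<Rightarrow> real"
  assumes prob: "\<And>n. 1 \<le> n \<Longrightarrow> prob_space (M n)" and X: "\<And>n. 1 \<le> n \<Longrightarrow> X n \<in> borel_measurable (M n)"
    and conv: "weak_conv_m (\<lambda>n. distr (M n) borel (X n)) (return borel \<mu>)"
  shows "(\<lambda>n. \<integral>\<omega>. min 1 \<bar>X n \<omega> - \<mu>\<bar> \<partial>M n) \<longlonglongrightarrow> 0"
proof -
  \<comment> \<open>\<open>M 0\<close> is arbitrary, hence the shift.\<close>
  let ?D = "\<lambda>n. distr (M (Suc n)) borel (X (Suc n))"
  let ?f = "\<lambda>x :: real. min 1 \<bar>x - \<mu>\<bar>"
  have "real_distribution (?D n)" for n
    unfolding real_distribution_def real_distribution_axioms_def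
    using prob_space.prob_space_distr[OF prob X, of "Suc n"] by auto
  moreover have "real_distribution (return borel \<mu>)"
    unfolding real_distribution_def real_distribution_axioms_def by (auto intro: prob_space_return)
  moreover have "weak_conv_m ?D (return borel \<mu>)"
    using conv unfolding weak_conv_m_def weak_conv_def by (auto intro: filterlim_sequentially_Suc[THEN iffD2])
  moreover have "isCont ?f x" for x by (intro continuous_intros)
  moreover have "norm (?f x) \<le> 1" for x by simp
  ultimately have "(\<lambda>n. \<integral>x. ?f x \<partial>?D n) \<longlonglongrightarrow> (\<integral>x. ?f x \<partial>return borel \<mu>)"
    by (rule weak_conv_imp_integral_bdd_continuous_conv)
  moreover have "(\<integral>x. ?f x \<partial>?D n) = (\<integral>\<omega>. ?f (X (Suc n) \<omega>) \<partial>M (Suc n))" for n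
    using X[of "Suc n"] by (intro integral_distr) auto
  moreover have "(\<integral>x. ?f x \<partial>return borel \<mu>) = 0" by (subst integral_return) auto
  ultimately have "(\<lambda>n. \<integral>\<omega>. ?f (X (Suc n) \<omega>) \<partial>M (Suc n)) \<longlonglongrightarrow> 0" by simp
  then show ?thesis by (rule filterlim_sequentially_Suc[THEN iffD1])
qed

text \<open>Replacing the normalising factors by the one that makes the empirical mean equal to \<open>\<mu>\<close> moves
  the weights, on average, only by the deviation of their mean from \<open>\<mu>\<close>.\<close>

lemma scaled_popularity_average:
  fixes x :: "nat \<Rightarrow> real"
  assumes n: "1 \<le> n" and x: "\<And>i. i \<in> {1..n} \<Longrightarrow> 0 \<le> x i" and \<mu>: "0 \<le> \<mu>"
  defines "y \<equiv> \<lambda>i. real n * \<mu> * (x i / (\<Sum>j=1..n. x j))"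
  shows "(1 / real n) * (\<Sum>i=1..n. \<bar>y i - x i\<bar>) \<le> \<bar>(1 / real n) * (\<Sum>i=1..n. x i) - \<mu>\<bar>"
proof (cases "(\<Sum>j=1..n. x j) = 0")
  case True
  then have "\<forall>i\<in>{1..n}. x i = 0" using x by (subst (asm) sum_nonneg_eq_0_iff) auto
  then have "x i = 0" if "i \<in> {1..n}" for i using that by blast
  then have "(\<Sum>i=1..n. \<bar>y i - x i\<bar>) = 0" by (simp add: y_def)
  then show ?thesis by simp
next
  case False
  define S where "S = (\<Sum>j=1..n. x j)"
  have "0 \<le> S" unfolding S_def using x by (intro sum_nonneg) auto
  then have S: "0 < S" using False unfolding S_def by simp
  define c where "c = \<bar>real n * \<mu> / S - 1\<bar>"
  have "\<bar>y i - x i\<bar> = c * x i" if "i \<in> {1..n}" for i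
  proof -
    have "y i - x i = (real n * \<mu> / S - 1) * x i" by (simp add: y_def S_def algebra_simps)
    then show ?thesis using x[OF that] by (simp add: c_def abs_mult)
  qed
  then have "(\<Sum>i=1..n. \<bar>y i - x i\<bar>) = c * S" by (simp add: S_def sum_distrib_left)
  also have "\<dots> = \<bar>(real n * \<mu> / S - 1) * S\<bar>" using S by (simp add: c_def abs_mult)
  also have "(real n * \<mu> / S - 1) * S = real n * \<mu> - S" using S by (simp add: field_simps)
  finally have "(1 / real n) * (\<Sum>i=1..n. \<bar>y i - x i\<bar>) = \<bar>(1 / real n) * (real n * \<mu> - S)\<bar>"
    using n by (simp add: abs_mult)
  also have "(1 / real n) * (real n * \<mu> - S) = - ((1 / real n) * S - \<mu>)" using n by (simp add: field_simps)
  finally show ?thesis by (simp add: S_def)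
qed

locale lln_popularities =
  fixes P :: "real measure" and \<mu> :: real and M :: "nat \<Rightarrow> 'a measure"
    and w :: "nat \<Rightarrow> nat \<Rightarrow> 'a \<Rightarrow> real"
  assumes P: "P \<in> prob_Rplus"
    and first_moment: "integrable P (\<lambda>x. x)" "\<mu> = (\<integral>x. x \<partial>P)" "\<mu> \<noteq> 0"
    and prob: "\<And>n. n \<ge> 1 \<Longrightarrow> prob_space (M n)"
    and w_measurable: "\<And>n i. n \<ge> 1 \<Longrightarrow> i \<in> {1..n} \<Longrightarrow> w n i \<in> borel_measurable (M n)"
    and w_nonneg: "\<And>n i \<omega>. n \<ge> 1 \<Longrightarrow> i \<in> {1..n} \<Longrightarrow> \<omega> \<in> space (M n) \<Longrightarrow> 0 \<le> w n i \<omega>"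
    and LLN: "LLN P M w"
begin

lemma mean_pos: "0 < \<mu>"
proof -
  have "0 \<le> (\<integral>x. x \<partial>P)"
    using prob_Rplus_simps(3)[OF P] by (intro integral_nonneg_AE) auto
  then show ?thesis using first_moment by simp
qed

text \<open>The popularities on the time scale of the theorem. Unless all weights vanish, they are the
  weights normalised to have empirical mean \<open>\<mu>\<close>, and the factors \<open>Z n\<close> of the law of large numbers cancel in them.\<close>

definition intensity :: "nat \<Rightarrow> 'a \<Rightarrow> nat \<Rightarrow> real" where
  "intensity n \<omega> i = real n * \<mu> * popularity n (w n) i \<omega>"

definition average :: "(real \<Rightarrow> real) \<Rightarrow> nat \<Rightarrow> 'a \<Rightarrow> real" where
  "average f n \<omega> = (1 / real n) * (\<Sum>i=1..n. f (intensity n \<omega> i))"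

lemma intensity_nonneg: "1 \<le> n \<Longrightarrow> i \<in> {1..n} \<Longrightarrow> \<omega> \<in> space (M n) \<Longrightarrow> 0 \<le> intensity n \<omega> i"
  unfolding intensity_def popularity_def using w_nonneg mean_pos
  by (intro mult_nonneg_nonneg divide_nonneg_nonneg sum_nonneg) auto

lemma intensity_measurable:
  assumes n: "1 \<le> n" "i \<in> {1..n}"
  shows "(\<lambda>\<omega>. intensity n \<omega> i) \<in> borel_measurable (M n)"
proof -
  note [measurable] = w_measurable[OF n(1)]
  show ?thesis unfolding intensity_def popularity_def using n(2) by measurable
qed

lemma average_intensity_le:
  assumes n: "1 \<le> n"
  shows "average (\<lambda>y. y) n \<omega> \<le> \<mu>"
proof -
  have "(\<Sum>i=1..n. intensity n \<omega> i) = real n * \<mu> * (\<Sum>i=1..n. popularity n (w n) i \<omega>)"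
    by (simp add: intensity_def sum_distrib_left)
  moreover have "(\<Sum>i=1..n. popularity n (w n) i \<omega>) \<le> 1"
    by (simp add: popularity_def sum_divide_distrib[symmetric])
  ultimately have "(\<Sum>i=1..n. intensity n \<omega> i) \<le> real n * \<mu>"
    using mean_pos by (simp add: mult_left_le)
  then show ?thesis unfolding average_def using n by (simp add: field_simps)
qed

text \<open>Lipschitz test functions do not notice the change from \<open>Z n * w n i\<close> to the intensities, beyond
  the deviation of the empirical mean. This deviation is truncated at \<open>1\<close>, because the means converge
  in law only; the bound \<open>B\<close> on the test function compensates for that.\<close>

lemma average_tendsto:
  fixes f :: "real \<Rightarrow> real"
  assumes f_meas: "f \<in> borel_measurable borel"
    and bound: "\<And>x. 0 \<le> x \<Longrightarrow> \<bar>f x\<bar> \<le> B"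
    and lipschitz: "\<And>x y. 0 \<le> x \<Longrightarrow> 0 \<le> y \<Longrightarrow> \<bar>f x - f y\<bar> \<le> L * \<bar>x - y\<bar>"
  shows "(\<lambda>n. \<integral>\<omega>. \<bar>average f n \<omega> - (\<integral>x. f x \<partial>P)\<bar> \<partial>M n) \<longlonglongrightarrow> 0"
proof -
  obtain Z where Z_meas: "\<And>n. 1 \<le> n \<Longrightarrow> Z n \<in> borel_measurable (M n)"
    and Z_pos: "\<And>n \<omega>. 1 \<le> n \<Longrightarrow> \<omega> \<in> space (M n) \<Longrightarrow> 0 < Z n \<omega>"
    and emp: "converges_in_law_to_const M weak_topology (\<lambda>n \<omega>. empirical_measure n (\<lambda>i. Z n \<omega> * w n i \<omega>)) P"
    and mean: "weak_conv_m (\<lambda>n. distr (M n) borel (\<lambda>\<omega>. (1 / real n) * (\<Sum>i=1..n. Z n \<omega> * w n i \<omega>)))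
          (return borel \<mu>)"
    using LLN unfolding LLN_def first_moment(2) by blast
  define x where "x n \<omega> i = Z n \<omega> * w n i \<omega>" for n \<omega> i
  define D where "D n \<omega> = \<bar>(\<integral>u. f u \<partial>empirical_measure n (x n \<omega>)) - (\<integral>u. f u \<partial>P)\<bar>" for n \<omega>
  define m where "m n \<omega> = min 1 \<bar>(1 / real n) * (\<Sum>i=1..n. x n \<omega> i) - \<mu>\<bar>" for n \<omega>
  have x_nonneg: "0 \<le> x n \<omega> i" if "1 \<le> n" "\<omega> \<in> space (M n)" "i \<in> {1..n}" for n \<omega> i
    unfolding x_def using Z_pos[OF that(1,2)] w_nonneg[OF that(1,3,2)] by simp
  have L: "0 \<le> L" using lipschitz[of 0 1] by simp
  have B: "0 \<le> B" using bound[of 0] by simp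
  have cont: "continuous_on {0..} f"
  proof (rule lipschitz_on_continuous_on)
    show "L-lipschitz_on {0..} f" using L lipschitz by (intro lipschitz_onI) (auto simp: dist_real_def)
  qed
  have D_lim: "(\<lambda>n. \<integral>\<omega>. D n \<omega> \<partial>M n) \<longlonglongrightarrow> 0"
    using weak_convergence_test_function[OF emp P cont bound] unfolding D_def x_def .
  have x_meas [measurable]: "(\<lambda>\<omega>. x n \<omega> i) \<in> borel_measurable (M n)" if "1 \<le> n" "i \<in> {1..n}" for n i
    unfolding x_def using Z_meas[OF that(1)] w_measurable[OF that] by measurable
  have m_lim: "(\<lambda>n. \<integral>\<omega>. m n \<omega> \<partial>M n) \<longlonglongrightarrow> 0"
    unfolding m_def x_def
  proof (rule weak_conv_return_test[OF prob _ mean])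
    fix n :: nat assume n: "1 \<le> n"
    note [measurable] = w_measurable[OF n] Z_meas[OF n]
    show "(\<lambda>\<omega>. (1 / real n) * (\<Sum>i=1..n. Z n \<omega> * w n i \<omega>)) \<in> borel_measurable (M n)" by measurable
  qed
  have key: "\<bar>average f n \<omega> - (\<integral>u. f u \<partial>P)\<bar> \<le> (L + 2 * B) * m n \<omega> + D n \<omega> \<and>
      D n \<omega> = \<bar>(1 / real n) * (\<Sum>i=1..n. f (x n \<omega> i)) - (\<integral>u. f u \<partial>P)\<bar> \<and> D n \<omega> \<le> 2 * B"
    if n: "1 \<le> n" and \<omega>: "\<omega> \<in> space (M n)" for n \<omega>
  proof -
    let ?S = "\<Sum>j=1..n. x n \<omega> j"
    have emp_f: "(\<integral>u. f u \<partial>empirical_measure n (x n \<omega>)) = (1 / real n) * (\<Sum>i=1..n. f (x n \<omega> i))"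
      by (rule integral_empirical_measure[OF n x_nonneg[OF n \<omega>] f_meas])
    have y: "intensity n \<omega> i = real n * \<mu> * (x n \<omega> i / ?S)" for i
      using Z_pos[OF n \<omega>]
      by (simp add: intensity_def popularity_def x_def sum_distrib_left[symmetric])
    have avg_le: "\<bar>(1 / real n) * (\<Sum>i=1..n. f (z i))\<bar> \<le> B" if z: "\<And>i. i \<in> {1..n} \<Longrightarrow> 0 \<le> z i" for z
    proof -
      have "\<bar>\<Sum>i=1..n. f (z i)\<bar> \<le> (\<Sum>i=1..n. \<bar>f (z i)\<bar>)" by (rule sum_abs)
      also have "\<dots> \<le> (\<Sum>i=1..n. B)" using z bound by (intro sum_mono) auto
      finally show ?thesis using n by (simp add: abs_mult field_simps)
    qed
    let ?d = "\<bar>average f n \<omega> - (1 / real n) * (\<Sum>i=1..n. f (x n \<omega> i))\<bar>"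
    have d1: "?d \<le> L * \<bar>(1 / real n) * ?S - \<mu>\<bar>"
    proof -
      have "?d = (1 / real n) * \<bar>\<Sum>i=1..n. f (intensity n \<omega> i) - f (x n \<omega> i)\<bar>"
        unfolding average_def by (simp add: sum_subtractf right_diff_distrib[symmetric] abs_mult diff_divide_distrib[symmetric])
      also have "\<dots> \<le> (1 / real n) * (\<Sum>i=1..n. L * \<bar>intensity n \<omega> i - x n \<omega> i\<bar>)"
        using lipschitz intensity_nonneg[OF n _ \<omega>] x_nonneg[OF n \<omega>]
        by (intro mult_left_mono order_trans[OF sum_abs] sum_mono) auto
      also have "\<dots> = L * ((1 / real n) * (\<Sum>i=1..n. \<bar>intensity n \<omega> i - x n \<omega> i\<bar>))"
        by (simp add: sum_distrib_left mult_ac)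
      also have "\<dots> \<le> L * \<bar>(1 / real n) * ?S - \<mu>\<bar>"
        unfolding y using scaled_popularity_average[of n "x n \<omega>" \<mu>] n x_nonneg[OF n \<omega>] mean_pos L
        by (intro mult_left_mono) auto
      finally show ?thesis .
    qed
    have avg_y: "\<bar>average f n \<omega>\<bar> \<le> B"
      unfolding average_def by (rule avg_le) (rule intensity_nonneg[OF n _ \<omega>])
    have avg_x: "\<bar>(1 / real n) * (\<Sum>i=1..n. f (x n \<omega> i))\<bar> \<le> B"
      by (rule avg_le) (rule x_nonneg[OF n \<omega>])
    have d2: "?d \<le> 2 * B" using avg_y avg_x by linarith
    have "?d \<le> (L + 2 * B) * m n \<omega>"
    proof (cases "\<bar>(1 / real n) * ?S - \<mu>\<bar> \<le> 1")
      case True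
      then have "m n \<omega> = \<bar>(1 / real n) * ?S - \<mu>\<bar>" by (simp add: m_def)
      then have "?d \<le> L * m n \<omega>" "0 \<le> 2 * B * m n \<omega>" using d1 B by simp_all
      then show ?thesis by (simp add: algebra_simps)
    next
      case False
      then have "m n \<omega> = 1" by (simp add: m_def)
      then show ?thesis using d2 L by simp
    qed
    moreover have "\<bar>(1 / real n) * (\<Sum>i=1..n. f (x n \<omega> i)) - (\<integral>u. f u \<partial>P)\<bar> \<le> 2 * B"
    proof -
      have "\<bar>\<integral>u. f u \<partial>P\<bar> \<le> B" by (rule abs_integral_le[OF P]) (rule bound)
      then show ?thesis using avg_x by linarith
    qed
    ultimately show ?thesis unfolding D_def emp_f by linarith
  qed
  have le: "(\<integral>\<omega>. \<bar>average f n \<omega> - (\<integral>u. f u \<partial>P)\<bar> \<partial>M n) \<le> (L + 2 * B) * (\<integral>\<omega>. m n \<omega> \<partial>M n) + (\<integral>\<omega>. D n \<omega> \<partial>M n)"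
    if n: "1 \<le> n" for n
  proof -
    interpret prob_space "M n" by (rule prob[OF n])
    note [measurable] = x_meas[OF n] intensity_measurable[OF n] f_meas
    have m_int: "integrable (M n) (m n)"
      by (rule integrable_const_bound[where B = 1]) (auto simp: m_def[abs_def])
    have D_meas: "D n \<in> borel_measurable (M n)"
      using key[OF n] by (subst measurable_cong[where g = "\<lambda>\<omega>. \<bar>(1 / real n) * (\<Sum>i=1..n. f (x n \<omega> i)) - (\<integral>u. f u \<partial>P)\<bar>"]) auto
    have D_int: "integrable (M n) (D n)"
    proof (rule integrable_const_bound[where B = "2 * B", OF _ D_meas], rule AE_I2)
      fix \<omega> assume "\<omega> \<in> space (M n)"
      then have "D n \<omega> \<le> 2 * B" using key[OF n] by blast
      then show "norm (D n \<omega>) \<le> 2 * B" by (simp add: D_def)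
    qed
    have "(\<integral>\<omega>. \<bar>average f n \<omega> - (\<integral>u. f u \<partial>P)\<bar> \<partial>M n) \<le> (\<integral>\<omega>. (L + 2 * B) * m n \<omega> + D n \<omega> \<partial>M n)"
    proof (rule integral_mono_AE')
      have k: "\<bar>average f n \<omega> - (\<integral>u. f u \<partial>P)\<bar> \<le> (L + 2 * B) * m n \<omega> + D n \<omega>" if "\<omega> \<in> space (M n)" for \<omega>
        using key[OF n that] by blast
      then show "AE \<omega> in M n. \<bar>average f n \<omega> - (\<integral>u. f u \<partial>P)\<bar> \<le> (L + 2 * B) * m n \<omega> + D n \<omega>" by (rule AE_I2)
      show "AE \<omega> in M n. 0 \<le> (L + 2 * B) * m n \<omega> + D n \<omega>"
        by (rule AE_I2) (rule order_trans[OF abs_ge_zero k])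
    qed (use m_int D_int in simp)
    also have "\<dots> = (L + 2 * B) * (\<integral>\<omega>. m n \<omega> \<partial>M n) + (\<integral>\<omega>. D n \<omega> \<partial>M n)" using m_int D_int by simp
    finally show ?thesis .
  qed
  show ?thesis
  proof (rule tendsto_sandwich[where f = "\<lambda>_. 0" and
      h = "\<lambda>n. (L + 2 * B) * (\<integral>\<omega>. m n \<omega> \<partial>M n) + (\<integral>\<omega>. D n \<omega> \<partial>M n)"])
    show "(\<lambda>n. (L + 2 * B) * (\<integral>\<omega>. m n \<omega> \<partial>M n) + (\<integral>\<omega>. D n \<omega> \<partial>M n)) \<longlonglongrightarrow> 0"
      using tendsto_add[OF tendsto_mult_left[OF m_lim, of "L + 2 * B"] D_lim] by simp
    show "\<forall>\<^sub>F n in sequentially. (\<integral>\<omega>. \<bar>average f n \<omega> - (\<integral>x. f x \<partial>P)\<bar> \<partial>M n) \<le>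
      (L + 2 * B) * (\<integral>\<omega>. m n \<omega> \<partial>M n) + (\<integral>\<omega>. D n \<omega> \<partial>M n)"
      using le by (rule eventually_sequentiallyI[of 1])
  qed simp_all
qed

end

section \<open>Analytic estimates\<close>

text \<open>Convergence in mean for each \<open>v\<close> suffices for the mean of the integral over \<open>v\<close>: apply Fubini,
  then dominated convergence in \<open>v\<close>.\<close>

lemma expectation_integral_tendsto_0:
  fixes W :: "nat \<Rightarrow> 'a \<Rightarrow> real \<Rightarrow> real" and g :: "real \<Rightarrow> real"
  assumes prob: "\<And>n. prob_space (M n)"
    and meas: "\<And>n. (\<lambda>(\<omega>, v). W n \<omega> v) \<in> borel_measurable (M n \<Otimes>\<^sub>M lborel)"
    and bound: "\<And>n \<omega> v. \<omega> \<in> space (M n) \<Longrightarrow> 0 \<le> W n \<omega> v \<and> W n \<omega> v \<le> g v"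
    and g: "integrable lborel g"
    and lim: "\<And>v. (\<lambda>n. \<integral>\<omega>. W n \<omega> v \<partial>M n) \<longlonglongrightarrow> 0"
  shows "integrable (M n) (\<lambda>\<omega>. \<integral>v. W n \<omega> v \<partial>lborel)"
    and "(\<lambda>n. \<integral>\<omega>. (\<integral>v. W n \<omega> v \<partial>lborel) \<partial>M n) \<longlonglongrightarrow> 0"
proof -
  have *: "integrable (M n) (\<lambda>\<omega>. \<integral>v. W n \<omega> v \<partial>lborel)"
    "(\<integral>\<omega>. (\<integral>v. W n \<omega> v \<partial>lborel) \<partial>M n) = (\<integral>v. (\<integral>\<omega>. W n \<omega> v \<partial>M n) \<partial>lborel)"
    "(\<lambda>v. \<integral>\<omega>. W n \<omega> v \<partial>M n) \<in> borel_measurable lborel"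
    "\<And>v. norm (\<integral>\<omega>. W n \<omega> v \<partial>M n) \<le> g v" for n
  proof -
    interpret prob_space "M n" by (rule prob)
    interpret pair_sigma_finite "M n" lborel ..
    note [measurable] = meas[of n]
    have W_meas: "(\<lambda>v. W n \<omega> v) \<in> borel_measurable lborel" if "\<omega> \<in> space (M n)" for \<omega>
      using measurable_compose[OF measurable_Pair1'[OF that] meas[of n]] by simp
    have W_int: "integrable lborel (\<lambda>v. W n \<omega> v)" if "\<omega> \<in> space (M n)" for \<omega>
    proof (rule Bochner_Integration.integrable_bound[OF g W_meas[OF that]], rule AE_I2)
      show "norm (W n \<omega> v) \<le> norm (g v)" for v using bound[OF that, of v] by simp
    qed
    have int_le: "(\<integral>v. W n \<omega> v \<partial>lborel) \<le> (\<integral>v. g v \<partial>lborel)" if "\<omega> \<in> space (M n)" for \<omega>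
      using bound[OF that] by (intro integral_mono W_int that g) auto
    have int_nonneg: "0 \<le> (\<integral>v. W n \<omega> v \<partial>lborel)" if "\<omega> \<in> space (M n)" for \<omega>
      using bound[OF that] by (intro Bochner_Integration.integral_nonneg) auto
    have I_meas: "(\<lambda>\<omega>. \<integral>v. W n \<omega> v \<partial>lborel) \<in> borel_measurable (M n)"
      by (rule lborel.borel_measurable_lebesgue_integral) (rule meas)
    show int: "integrable (M n) (\<lambda>\<omega>. \<integral>v. W n \<omega> v \<partial>lborel)"
      using int_le int_nonneg
      by (intro integrable_const_bound[where B = "\<integral>v. g v \<partial>lborel"] I_meas AE_I2) auto
    have "integrable (M n \<Otimes>\<^sub>M lborel) (\<lambda>(\<omega>, v). W n \<omega> v)"
    proof (rule Fubini_integrable[OF meas])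
      have "integrable (M n) (\<lambda>\<omega>. \<integral>v. norm (W n \<omega> v) \<partial>lborel) \<longleftrightarrow> integrable (M n) (\<lambda>\<omega>. \<integral>v. W n \<omega> v \<partial>lborel)"
        using bound by (intro Bochner_Integration.integrable_cong refl Bochner_Integration.integral_cong) auto
      then show "integrable (M n) (\<lambda>\<omega>. \<integral>v. norm (case (\<omega>, v) of (\<omega>, v) \<Rightarrow> W n \<omega> v) \<partial>lborel)" using int by simp
      show "AE \<omega> in M n. integrable lborel (\<lambda>v. case (\<omega>, v) of (\<omega>, v) \<Rightarrow> W n \<omega> v)"
        using W_int by (intro AE_I2) simp
    qed
    then show "(\<integral>\<omega>. (\<integral>v. W n \<omega> v \<partial>lborel) \<partial>M n) = (\<integral>v. (\<integral>\<omega>. W n \<omega> v \<partial>M n) \<partial>lborel)"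
      by (rule Fubini_integral[symmetric])
    have "(\<lambda>(v, \<omega>). W n \<omega> v) \<in> borel_measurable (lborel \<Otimes>\<^sub>M M n)"
      using measurable_compose[OF measurable_pair_swap' meas[of n]] by (simp add: split_beta')
    then show "(\<lambda>v. \<integral>\<omega>. W n \<omega> v \<partial>M n) \<in> borel_measurable lborel"
      by (rule sigma_finite_measure.borel_measurable_lebesgue_integral[OF prob_space_imp_sigma_finite[OF prob]])
    show "norm (\<integral>\<omega>. W n \<omega> v \<partial>M n) \<le> g v" for v
    proof -
      have "(\<lambda>\<omega>. W n \<omega> v) \<in> borel_measurable (M n)"
        using measurable_compose[OF measurable_Pair2'[of v lborel "M n"] meas[of n]] by simp
      then have "integrable (M n) (\<lambda>\<omega>. W n \<omega> v)"
        using bound by (intro integrable_const_bound[where B = "g v"] AE_I2) auto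
      then have "(\<integral>\<omega>. W n \<omega> v \<partial>M n) \<le> (\<integral>\<omega>. g v \<partial>M n)" using bound by (intro integral_mono) auto
      moreover have "0 \<le> (\<integral>\<omega>. W n \<omega> v \<partial>M n)" using bound by (intro integral_nonneg_AE AE_I2) auto
      ultimately show ?thesis by (simp add: prob_space)
    qed
  qed
  show "integrable (M n) (\<lambda>\<omega>. \<integral>v. W n \<omega> v \<partial>lborel)" by (rule *(1))
  have "(\<lambda>n. \<integral>v. (\<integral>\<omega>. W n \<omega> v \<partial>M n) \<partial>lborel) \<longlonglongrightarrow> integral\<^sup>L lborel (\<lambda>v :: real. 0 :: real)"
  proof (rule integral_dominated_convergence[where w = g])
    show "AE v in lborel. norm (\<integral>\<omega>. W n \<omega> v \<partial>M n) \<le> g v" for n by (rule AE_I2) (rule *(4))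
    show "AE v in lborel. (\<lambda>n. \<integral>\<omega>. W n \<omega> v \<partial>M n) \<longlonglongrightarrow> 0" by (rule AE_I2) (rule lim)
  qed (use *(3) g in simp_all)
  then show "(\<lambda>n. \<integral>\<omega>. (\<integral>v. W n \<omega> v \<partial>lborel) \<partial>M n) \<longlonglongrightarrow> 0" unfolding *(2) by simp
qed

lemma exp_convexity_gap:
  fixes a s :: real
  assumes "0 \<le> a" "0 \<le> s" "s \<le> 1"
  shows "\<bar>exp (- a) + (1 - exp (- a)) * (1 - s) - exp (- (a * s))\<bar> \<le> a\<^sup>2"
proof -
  have lower: "exp (- (a * s)) \<le> exp (- a) + (1 - exp (- a)) * (1 - s)"
    using convex_onD[OF exp_convex, of s 0 "- a"] assms by (simp add: algebra_simps)
  have "exp (- a) \<le> 1 / (1 + a)"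
    using exp_ge_add_one_self[of a] assms(1) by (simp add: exp_minus field_simps)
  also have "1 / (1 + a) \<le> 1 - a + a\<^sup>2"
  proof -
    have "1 \<le> (1 - a + a\<^sup>2) * (1 + a)"
      using assms(1) by (simp add: algebra_simps power2_eq_square)
    then show ?thesis using assms(1) by (simp add: field_simps)
  qed
  finally have "s * (a - (1 - exp (- a))) \<le> s * a\<^sup>2" using assms(2) by (intro mult_left_mono) auto
  also have "\<dots> \<le> a\<^sup>2" using assms by (simp add: mult_left_le_one_le)
  finally have "exp (- a) + (1 - exp (- a)) * (1 - s) - (1 - a * s) \<le> a\<^sup>2" by (simp add: algebra_simps)
  moreover have "1 - a * s \<le> exp (- (a * s))" using exp_ge_add_one_self[of "- (a * s)"] by simp
  ultimately show ?thesis using lower by linarith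
qed

text \<open>This identity is what conserves mass: integrating the kernel over \<open>v\<close> turns the average of
  intensities, or the law \<open>P\<close>, into its mean.\<close>

lemma nn_integral_exponential_kernel:
  fixes y :: real
  assumes "0 \<le> y"
  shows "(\<integral>\<^sup>+v. ennreal (indicator {0<..} v * (y\<^sup>2 * exp (- (y * v)))) \<partial>lborel) = ennreal y"
proof (cases "y = 0")
  case False
  then have y: "0 < y" using assms by simp
  have "(\<integral>\<^sup>+v. ennreal (indicator {0<..} v * (y\<^sup>2 * exp (- (y * v)))) \<partial>lborel) =
    (\<integral>\<^sup>+v. ennreal (y\<^sup>2 * exp (- (y * v))) * indicator {0..} v \<partial>lborel)"
  proof (rule nn_integral_cong_AE)
    show "AE v in lborel. ennreal (indicator {0<..} v * (y\<^sup>2 * exp (- (y * v)))) =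
      ennreal (y\<^sup>2 * exp (- (y * v))) * indicator {0..} v"
      using AE_lborel_singleton[of 0] by eventually_elim (auto simp: indicator_def)
  qed
  also have "\<dots> = ennreal (0 - (- y * exp (- (y * 0))))"
  proof (rule nn_integral_FTC_atLeast)
    show "((\<lambda>v. - y * exp (- (y * v))) \<longlongrightarrow> 0) at_top" using y by real_asymp
    show "((\<lambda>v. - y * exp (- (y * v))) has_real_derivative y\<^sup>2 * exp (- (y * v))) (at v)" for v
      by (auto intro!: derivative_eq_intros simp: power2_eq_square)
  qed auto
  finally show ?thesis by simp
qed simp

lemma kernel_bounds:
  fixes v x :: real
  assumes v: "0 < v" and x: "0 \<le> x"
  shows "\<bar>x * exp (- (x * v))\<bar> \<le> 1 / v" "\<bar>x\<^sup>2 * exp (- (x * v))\<bar> \<le> 4 / v\<^sup>2"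
proof -
  have xv: "0 \<le> x * v" using assms by simp
  have "x * v \<le> exp (x * v)" using exp_ge_add_one_self[of "x * v"] by linarith
  then have "x * v * exp (- (x * v)) \<le> 1" by (simp add: exp_minus field_simps)
  then show "\<bar>x * exp (- (x * v))\<bar> \<le> 1 / v" using assms by (simp add: field_simps abs_mult)
  have "x * v / 2 \<le> exp (x * v / 2)" using exp_ge_add_one_self[of "x * v / 2"] by linarith
  then have "(x * v / 2)\<^sup>2 \<le> (exp (x * v / 2))\<^sup>2" using xv by (intro power_mono) auto
  also have "(exp (x * v / 2))\<^sup>2 = exp (x * v)" by (simp add: exp_double[symmetric])
  finally have "(x * v / 2)\<^sup>2 * exp (- (x * v)) \<le> 1" by (simp add: exp_minus field_simps)
  then show "\<bar>x\<^sup>2 * exp (- (x * v))\<bar> \<le> 4 / v\<^sup>2" using assms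
    by (simp add: field_simps abs_mult power_mult_distrib power_divide)
qed

lemma kernel_lipschitz:
  fixes v x y :: real
  assumes v: "0 < v" and "0 \<le> x" "0 \<le> y"
  shows "\<bar>x\<^sup>2 * exp (- (x * v)) - y\<^sup>2 * exp (- (y * v))\<bar> \<le> 6 / v * \<bar>x - y\<bar>"
proof -
  have "norm (x\<^sup>2 * exp (- (x * v)) - y\<^sup>2 * exp (- (y * v))) \<le> 6 / v * norm (x - y)"
  proof (rule field_differentiable_bound[where S = "{0..}" and f = "\<lambda>x. x\<^sup>2 * exp (- (x * v))"
        and f' = "\<lambda>x. 2 * (x * exp (- (x * v))) - v * (x\<^sup>2 * exp (- (x * v)))"])
    show "((\<lambda>x. x\<^sup>2 * exp (- (x * v))) has_field_derivative
      2 * (z * exp (- (z * v))) - v * (z\<^sup>2 * exp (- (z * v)))) (at z within {0..})" for z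
      by (auto intro!: derivative_eq_intros simp: algebra_simps)
    fix z :: real assume "z \<in> {0..}"
    then have z: "0 \<le> z" by simp
    have "\<bar>v * (z\<^sup>2 * exp (- (z * v)))\<bar> \<le> v * (4 / v\<^sup>2)"
      using kernel_bounds(2)[OF v z] v by (simp only: abs_mult) (intro mult_mono, auto)
    also have "v * (4 / v\<^sup>2) = 4 * (1 / v)" using v by (simp add: power2_eq_square)
    finally have "\<bar>v * (z\<^sup>2 * exp (- (z * v)))\<bar> \<le> 4 * (1 / v)" .
    moreover have "\<bar>2 * (z * exp (- (z * v)))\<bar> \<le> 2 * (1 / v)"
      using kernel_bounds(1)[OF v z] by linarith
    ultimately show "norm (2 * (z * exp (- (z * v))) - v * (z\<^sup>2 * exp (- (z * v)))) \<le> 6 / v"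
      unfolding real_norm_def by linarith
  qed (use assms in auto)
  then show ?thesis by simp
qed

lemma exp_lipschitz:
  fixes v x y :: real
  assumes v: "0 \<le> v" and "0 \<le> x" "0 \<le> y"
  shows "\<bar>exp (- (x * v)) - exp (- (y * v))\<bar> \<le> v * \<bar>x - y\<bar>"
proof -
  have "norm (exp (- (x * v)) - exp (- (y * v))) \<le> v * norm (x - y)"
    using assms
    by (intro field_differentiable_bound[where S = "{0..}" and f = "\<lambda>x. exp (- (x * v))"
        and f' = "\<lambda>x. - v * exp (- (x * v))"])
      (auto intro!: derivative_eq_intros mult_left_le simp: abs_mult)
  then show ?thesis by simp
qed

text \<open>With \<open>a = l / n\<close>, each factor \<open>1 - (1 - exp (- a)) s\<close> is within \<open>a\<^sup>2\<close> of \<open>exp (- a s)\<close>, where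
  \<open>s = 1 - exp (- y j v)\<close>; only the factor of \<open>i\<close> itself is off by the order of \<open>a\<close>. Products of numbers in the
  unit interval differ by at most the sum of the differences of their factors.\<close>

lemma search_factor_approx:
  assumes n: "1 \<le> n" and i: "i \<in> {1..n}" and l: "0 \<le> l" and y: "\<And>j. j \<in> {1..n} \<Longrightarrow> 0 \<le> y j" and v: "0 \<le> v"
  shows "\<bar>search_factor n (l / real n) (\<lambda>j. exp (- (y j * v))) i -
    exp (- l * (1 - (1 / real n) * (\<Sum>j=1..n. exp (- (y j * v)))))\<bar> \<le> (l\<^sup>2 + l) / real n"
proof -
  define a where "a = l / real n"
  have a: "0 \<le> a" using l by (simp add: a_def)
  define s where "s j = 1 - exp (- (y j * v))" for j
  have s: "0 \<le> s j" "s j \<le> 1" if "j \<in> {1..n}" for j using y[OF that] v by (auto simp: s_def)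
  define z where "z j = (if j = i then exp (- a) else exp (- a) + (1 - exp (- a)) * (1 - s j))" for j
  have prod_z: "search_factor n a (\<lambda>j. exp (- (y j * v))) i = (\<Prod>j=1..n. z j)"
  proof -
    have "(\<Prod>j=1..n. z j) = z i * (\<Prod>j\<in>{1..n} - {i}. z j)" using i by (simp add: prod.remove)
    then show ?thesis unfolding search_factor_def by (simp add: z_def s_def)
  qed
  have prod_exp: "exp (- l * (1 - (1 / real n) * (\<Sum>j=1..n. exp (- (y j * v))))) = (\<Prod>j=1..n. exp (- (a * s j)))"
  proof -
    have "(\<Sum>j=1..n. - (a * s j)) = - a * (real n - (\<Sum>j=1..n. exp (- (y j * v))))"
      by (simp add: s_def sum_negf sum_distrib_left[symmetric] sum_subtractf)
    also have "\<dots> = - l * (1 - (1 / real n) * (\<Sum>j=1..n. exp (- (y j * v))))"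
      using n by (simp add: a_def field_simps)
    finally show ?thesis by (simp add: exp_sum[symmetric])
  qed
  have "norm ((\<Prod>j=1..n. z j) - (\<Prod>j=1..n. exp (- (a * s j)))) \<le> (\<Sum>j=1..n. norm (z j - exp (- (a * s j))))"
  proof (rule norm_prod_diff)
    fix j assume j: "j \<in> {1..n}"
    have "(1 - exp (- a)) * (1 - s j) \<le> 1 - exp (- a)" "0 \<le> (1 - exp (- a)) * (1 - s j)"
      using a s[OF j] by (auto intro!: mult_left_le mult_nonneg_nonneg)
    then show "norm (z j) \<le> 1" using a by (auto simp: z_def)
    show "norm (exp (- (a * s j))) \<le> 1" using a s[OF j] by simp
  qed
  also have "\<dots> \<le> (\<Sum>j=1..n. a\<^sup>2 + (if j = i then a else 0))"
  proof (rule sum_mono)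
    fix j assume j: "j \<in> {1..n}"
    show "norm (z j - exp (- (a * s j))) \<le> a\<^sup>2 + (if j = i then a else 0)"
    proof (cases "j = i")
      case True
      have "a * s j \<le> a" using a s[OF j] by (simp add: mult_left_le)
      then have "exp (- a) \<le> exp (- (a * s j))" "exp (- (a * s j)) \<le> 1" using a s[OF j] by auto
      moreover have "1 - a \<le> exp (- a)" using exp_ge_add_one_self[of "- a"] by simp
      ultimately have "\<bar>exp (- a) - exp (- (a * s j))\<bar> \<le> a" by linarith
      then show ?thesis using True by (simp add: z_def add_increasing)
    next
      case False
      then show ?thesis using exp_convexity_gap[OF a s[OF j]] by (simp add: z_def)
    qed
  qed
  also have "\<dots> = real n * a\<^sup>2 + a" using i by (simp add: sum.distrib)
  also have "\<dots> = (l\<^sup>2 + l) / real n" using n by (simp add: a_def power2_eq_square field_simps)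
  finally show ?thesis unfolding a_def[symmetric] prod_z prod_exp by simp
qed

text \<open>Substitution \<open>u = n \<mu> v\<close>.\<close>

lemma equilibrium_integral_rescaled:
  fixes p :: "nat \<Rightarrow> real" and \<mu> t a :: real
  assumes n: "1 \<le> n" and \<mu>: "0 < \<mu>" and t: "0 < t" and a: "0 \<le> a"
    and p: "\<And>j. j \<in> {1..n} \<Longrightarrow> 0 \<le> p j"
  defines "y \<equiv> \<lambda>i. real n * \<mu> * p i"
  shows "integrable lborel (\<lambda>v. indicator {0..<t} v *
      ((1 / real n) * (\<Sum>i=1..n. (y i)\<^sup>2 * exp (- (y i * v)) * search_factor n a (\<lambda>j. exp (- (y j * v))) i)))"
    and "equilibrium_integral n p (real n * \<mu> * t) a = (1 / \<mu>) * (\<integral>v. indicator {0..<t} v *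
      ((1 / real n) * (\<Sum>i=1..n. (y i)\<^sup>2 * exp (- (y i * v)) * search_factor n a (\<lambda>j. exp (- (y j * v))) i)) \<partial>lborel)"
proof -
  define c where "c = real n * \<mu>"
  have c: "0 < c" using n \<mu> by (simp add: c_def)
  have y_nonneg: "0 \<le> y i" if "i \<in> {1..n}" for i using p[OF that] \<mu> by (simp add: y_def)
  let ?f = "\<lambda>i v. indicator {0..<t} v * ((y i)\<^sup>2 * exp (- (y i * v)) * search_factor n a (\<lambda>j. exp (- (y j * v))) i)"
  have int: "integrable lborel (?f i)" if i: "i \<in> {1..n}" for i
  proof (rule Bochner_Integration.integrable_bound)
    show "integrable lborel (\<lambda>v. y i * (indicator {0..<t} v * (y i * exp (- (y i * v)))))"
      using has_integral_exponential_cell[of 0 t "y i", OF less_imp_le[OF t]]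
      by (intro integrable_mult_right) (simp only: has_bochner_integral_iff)
    show "?f i \<in> borel_measurable lborel" unfolding search_factor_def by measurable
    show "AE v in lborel. norm (?f i v) \<le> norm (y i * (indicator {0..<t} v * (y i * exp (- (y i * v)))))"
    proof (rule AE_I2)
      fix v
      show "norm (?f i v) \<le> norm (y i * (indicator {0..<t} v * (y i * exp (- (y i * v)))))"
      proof (cases "v \<in> {0..<t}")
        case True
        then have "0 \<le> search_factor n a (\<lambda>j. exp (- (y j * v))) i" "search_factor n a (\<lambda>j. exp (- (y j * v))) i \<le> 1"
          using search_factor_bounds[of a n "\<lambda>j. exp (- (y j * v))" i] a y_nonneg by auto
        then show ?thesis using True
          by (simp add: abs_mult power2_eq_square mult.assoc[symmetric] mult_left_le)
      qed simp
    qed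
  qed
  have sum_eq: "(\<lambda>v. indicator {0..<t} v *
      ((1 / real n) * (\<Sum>i=1..n. (y i)\<^sup>2 * exp (- (y i * v)) * search_factor n a (\<lambda>j. exp (- (y j * v))) i))) =
      (\<lambda>v. (1 / real n) * (\<Sum>i=1..n. ?f i v))"
    by (rule ext, subst mult.left_commute, simp only: sum_distrib_left)
  show "integrable lborel (\<lambda>v. indicator {0..<t} v *
      ((1 / real n) * (\<Sum>i=1..n. (y i)\<^sup>2 * exp (- (y i * v)) * search_factor n a (\<lambda>j. exp (- (y j * v))) i)))"
    unfolding sum_eq using int by (intro integrable_mult_right Bochner_Integration.integrable_sum) auto
  have summand: "p i * (LBINT u:{0..<c * t}. p i * exp (- (p i * u)) * search_factor n a (\<lambda>j. exp (- (p j * u))) i) =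
      (1 / c) * (\<integral>v. ?f i v \<partial>lborel)" if i: "i \<in> {1..n}" for i
  proof -
    have "(LBINT u:{0..<c * t}. p i * exp (- (p i * u)) * search_factor n a (\<lambda>j. exp (- (p j * u))) i) =
      \<bar>c\<bar> *\<^sub>R (\<integral>v. indicator {0..<c * t} (0 + c * v) *\<^sub>R (p i * exp (- (p i * (0 + c * v))) *
      search_factor n a (\<lambda>j. exp (- (p j * (0 + c * v)))) i) \<partial>lborel)"
      unfolding set_lebesgue_integral_def using c by (intro lborel_integral_real_affine) simp
    also have "\<dots> = c * (\<integral>v. indicator {0..<t} v * (p i * exp (- (y i * v)) *
      search_factor n a (\<lambda>j. exp (- (y j * v))) i) \<partial>lborel)"
    proof -
      have "indicator {0..<c * t} (c * v) = (indicator {0..<t} v :: real)" for v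
        using c by (auto simp: indicator_def zero_le_mult_iff)
      moreover have "p j * (c * v) = y j * v" for j v by (simp add: y_def c_def)
      ultimately show ?thesis using c by (simp only: add_0_left abs_of_pos real_scaleR_def)
    qed
    finally have "p i * (LBINT u:{0..<c * t}. p i * exp (- (p i * u)) * search_factor n a (\<lambda>j. exp (- (p j * u))) i) =
      (\<integral>v. p i * c * (indicator {0..<t} v * (p i * exp (- (y i * v)) *
      search_factor n a (\<lambda>j. exp (- (y j * v))) i)) \<partial>lborel)"
      by simp
    also have "\<dots> = (\<integral>v. (1 / c) * ?f i v \<partial>lborel)"
    proof (rule Bochner_Integration.integral_cong[OF refl])
      fix v
      have "(y i)\<^sup>2 = c * c * (p i * p i)" by (simp add: y_def c_def power2_eq_square)
      then show "p i * c * (indicator {0..<t} v * (p i * exp (- (y i * v)) *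
        search_factor n a (\<lambda>j. exp (- (y j * v))) i)) = (1 / c) * ?f i v"
        using c by (simp add: field_simps)
    qed
    finally show ?thesis by simp
  qed
  have "equilibrium_integral n p (real n * \<mu> * t) a = (\<Sum>i=1..n. (1 / c) * (\<integral>v. ?f i v \<partial>lborel))"
    unfolding equilibrium_integral_def c_def[symmetric] by (rule sum.cong[OF refl summand])
  also have "\<dots> = (1 / \<mu>) * ((1 / real n) * (\<Sum>i=1..n. \<integral>v. ?f i v \<partial>lborel))"
    by (simp only: sum_distrib_left[symmetric] c_def) (simp add: field_simps)
  also have "(\<Sum>i=1..n. \<integral>v. ?f i v \<partial>lborel) = (\<integral>v. (\<Sum>i=1..n. ?f i v) \<partial>lborel)"
    by (rule Bochner_Integration.integral_sum[symmetric]) (rule int)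
  also have "(1 / real n) * \<dots> = (\<integral>v. (1 / real n) * (\<Sum>i=1..n. ?f i v) \<partial>lborel)"
    by (rule integral_mult_right_zero[symmetric])
  finally show "equilibrium_integral n p (real n * \<mu> * t) a = (1 / \<mu>) * (\<integral>v. indicator {0..<t} v *
      ((1 / real n) * (\<Sum>i=1..n. (y i)\<^sup>2 * exp (- (y i * v)) * search_factor n a (\<lambda>j. exp (- (y j * v))) i)) \<partial>lborel)"
    unfolding sum_eq .
qed

section \<open>Passage to the limit\<close>

context lln_popularities
begin

text \<open>The indicator removes \<open>v = 0\<close>, where the integral diverges if \<open>P\<close> has no second moment.\<close>

definition limit_density :: "real \<Rightarrow> real" where
  "limit_density v = indicator {0<..} v * (\<integral>x. x\<^sup>2 * exp (- (x * v)) \<partial>P)"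

definition transform :: "real \<Rightarrow> real" where
  "transform v = (\<integral>x. exp (- (x * v)) \<partial>P)"

definition empirical_density :: "nat \<Rightarrow> 'a \<Rightarrow> real \<Rightarrow> real" where
  "empirical_density n \<omega> v = indicator {0<..} v * average (\<lambda>x. x\<^sup>2 * exp (- (x * v))) n \<omega>"

lemma id_measurable_P: "(\<lambda>x. x) \<in> borel_measurable P"
  by (rule measurable_prob_Rplus[OF P]) simp

lemma kernel_integrable:
  assumes "0 < v"
  shows "integrable P (\<lambda>x. x\<^sup>2 * exp (- (x * v)))"
proof -
  interpret P: prob_space P by (rule prob_Rplus_simps(1)[OF P])
  show ?thesis
  proof (rule P.integrable_const_bound[where B = "4 / v\<^sup>2"])
    show "AE x in P. norm (x\<^sup>2 * exp (- (x * v))) \<le> 4 / v\<^sup>2"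
      using kernel_bounds(2)[OF assms] prob_Rplus_simps(3)[OF P] by (intro AE_I2) simp
    show "(\<lambda>x. x\<^sup>2 * exp (- (x * v))) \<in> borel_measurable P"
      by (rule measurable_prob_Rplus[OF P]) measurable
  qed
qed

lemma kernel_mean_measurable [measurable]: "(\<lambda>v. \<integral>x. x\<^sup>2 * exp (- (x * v)) \<partial>P) \<in> borel_measurable borel"
  and limit_density_measurable [measurable]: "limit_density \<in> borel_measurable borel"
  and transform_measurable [measurable]: "transform \<in> borel_measurable borel"
proof -
  interpret P: prob_space P by (rule prob_Rplus_simps(1)[OF P])
  have [measurable]: "(\<lambda>p. snd p) \<in> borel_measurable (borel \<Otimes>\<^sub>M P)"
    by (rule measurable_compose[OF measurable_snd id_measurable_P])
  have "(\<lambda>(v, x). x\<^sup>2 * exp (- (x * v))) \<in> borel_measurable (borel \<Otimes>\<^sub>M P)"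
    unfolding split_beta' by measurable
  then show [measurable]: "(\<lambda>v. \<integral>x. x\<^sup>2 * exp (- (x * v)) \<partial>P) \<in> borel_measurable borel"
    by (rule P.borel_measurable_lebesgue_integral)
  show "limit_density \<in> borel_measurable borel" unfolding limit_density_def[abs_def] by measurable
  have "(\<lambda>(v, x). exp (- (x * v))) \<in> borel_measurable (borel \<Otimes>\<^sub>M P)"
    unfolding split_beta' by measurable
  then show "transform \<in> borel_measurable borel"
    unfolding transform_def[abs_def] by (rule P.borel_measurable_lebesgue_integral)
qed

lemma limit_density_nonneg: "0 \<le> limit_density v"
  unfolding limit_density_def by (intro mult_nonneg_nonneg Bochner_Integration.integral_nonneg) auto

lemma transform_bounds:
  assumes "0 \<le> v"
  shows "0 \<le> transform v" "transform v \<le> 1"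
proof -
  show "0 \<le> transform v" unfolding transform_def by (intro Bochner_Integration.integral_nonneg) auto
  have "\<bar>transform v\<bar> \<le> 1"
    unfolding transform_def by (rule abs_integral_le[OF P]) (use assms in simp)
  then show "transform v \<le> 1" by simp
qed

text \<open>By Tonelli, the exponential kernel integrates to the mean of \<open>P\<close>. This makes \<open>limit_density\<close> a
  dominating function although it may be unbounded near \<open>0\<close>.\<close>

lemma limit_density_integral:
  shows "integrable lborel limit_density" "(\<integral>v. limit_density v \<partial>lborel) = \<mu>"
proof -
  interpret P: prob_space P by (rule prob_Rplus_simps(1)[OF P])
  interpret pair_sigma_finite P lborel ..
  let ?f = "\<lambda>x v. ennreal (indicator {0<..} v * (x\<^sup>2 * exp (- (x * v))))"
  have [measurable]: "(\<lambda>p. fst p) \<in> borel_measurable (P \<Otimes>\<^sub>M lborel)"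
    by (rule measurable_compose[OF measurable_fst id_measurable_P])
  have meas: "(\<lambda>(x, v). ?f x v) \<in> borel_measurable (P \<Otimes>\<^sub>M lborel)"
    unfolding split_beta' by measurable
  have "(\<integral>\<^sup>+v. ennreal (limit_density v) \<partial>lborel) = (\<integral>\<^sup>+v. (\<integral>\<^sup>+x. ?f x v \<partial>P) \<partial>lborel)"
  proof (rule nn_integral_cong)
    fix v :: real
    show "ennreal (limit_density v) = (\<integral>\<^sup>+x. ?f x v \<partial>P)"
    proof (cases "0 < v")
      case True
      then show ?thesis using nn_integral_eq_integral[OF kernel_integrable[OF True]]
        by (simp add: limit_density_def)
    qed (simp add: limit_density_def)
  qed
  also have "\<dots> = (\<integral>\<^sup>+x. (\<integral>\<^sup>+v. ?f x v \<partial>lborel) \<partial>P)" by (rule Fubini'[OF meas])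
  also have "\<dots> = (\<integral>\<^sup>+x. ennreal x \<partial>P)"
    using prob_Rplus_simps(3)[OF P] by (intro nn_integral_cong nn_integral_exponential_kernel) simp
  also have "\<dots> = ennreal \<mu>"
    unfolding first_moment(2) using prob_Rplus_simps(3)[OF P]
    by (intro nn_integral_eq_integral first_moment(1) AE_I2) simp
  finally have *: "(\<integral>\<^sup>+v. ennreal (limit_density v) \<partial>lborel) = ennreal \<mu>" .
  have m: "limit_density \<in> borel_measurable lborel" by measurable
  show int: "integrable lborel limit_density"
    by (rule integrableI_nn_integral_finite[OF m _ *]) (simp add: limit_density_nonneg)
  have "ennreal (\<integral>v. limit_density v \<partial>lborel) = ennreal \<mu>"
    using nn_integral_eq_integral[OF int] * limit_density_nonneg by simp
  then show "(\<integral>v. limit_density v \<partial>lborel) = \<mu>"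
    using mean_pos limit_density_nonneg by (simp add: Bochner_Integration.integral_nonneg)
qed

lemma empirical_density_integral:
  assumes n: "1 \<le> n" and \<omega>: "\<omega> \<in> space (M n)"
  shows "integrable lborel (empirical_density n \<omega>)" "(\<integral>v. empirical_density n \<omega> v \<partial>lborel) \<le> \<mu>"
proof -
  let ?f = "\<lambda>i v. indicator {0<..} v * ((intensity n \<omega> i)\<^sup>2 * exp (- (intensity n \<omega> i * v)))"
  have f: "integrable lborel (?f i)" "(\<integral>v. ?f i v \<partial>lborel) = intensity n \<omega> i" if i: "i \<in> {1..n}" for i
  proof -
    note y = intensity_nonneg[OF n i \<omega>]
    show int: "integrable lborel (?f i)"
      by (rule integrableI_nn_integral_finite[OF _ _ nn_integral_exponential_kernel[OF y]]) auto
    have "ennreal (\<integral>v. ?f i v \<partial>lborel) = ennreal (intensity n \<omega> i)"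
      unfolding nn_integral_exponential_kernel[OF y, symmetric]
      by (rule nn_integral_eq_integral[OF int, symmetric]) simp
    moreover have "0 \<le> (\<integral>v. ?f i v \<partial>lborel)" by (intro Bochner_Integration.integral_nonneg) simp
    ultimately show "(\<integral>v. ?f i v \<partial>lborel) = intensity n \<omega> i" using y by simp
  qed
  have eq: "empirical_density n \<omega> = (\<lambda>v. (1 / real n) * (\<Sum>i=1..n. ?f i v))"
    unfolding empirical_density_def average_def by (rule ext, subst mult.left_commute, simp only: sum_distrib_left)
  show "integrable lborel (empirical_density n \<omega>)"
    unfolding eq by (intro integrable_mult_right Bochner_Integration.integrable_sum f(1))
  have "(\<integral>v. empirical_density n \<omega> v \<partial>lborel) = (1 / real n) * (\<integral>v. (\<Sum>i=1..n. ?f i v) \<partial>lborel)"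
    unfolding eq by (rule integral_mult_right_zero)
  also have "(\<integral>v. (\<Sum>i=1..n. ?f i v) \<partial>lborel) = (\<Sum>i=1..n. \<integral>v. ?f i v \<partial>lborel)"
    by (rule Bochner_Integration.integral_sum) (rule f(1))
  also have "\<dots> = (\<Sum>i=1..n. intensity n \<omega> i)" by (rule sum.cong[OF refl]) (rule f(2))
  finally show "(\<integral>v. empirical_density n \<omega> v \<partial>lborel) \<le> \<mu>"
    using average_intensity_le[OF n, of \<omega>] by (simp add: average_def)
qed

lemma empirical_density_nonneg: "0 \<le> empirical_density n \<omega> v"
  unfolding empirical_density_def average_def by (intro mult_nonneg_nonneg sum_nonneg) auto

abbreviation empirical_transform :: "nat \<Rightarrow> 'a \<Rightarrow> real \<Rightarrow> real" where
  "empirical_transform n \<omega> v \<equiv> average (\<lambda>x. exp (- (x * v))) n \<omega>"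

lemma average_exp_bounds:
  assumes "1 \<le> n" "\<omega> \<in> space (M n)" "0 \<le> v"
  shows "0 \<le> empirical_transform n \<omega> v" "empirical_transform n \<omega> v \<le> 1"
proof -
  show "0 \<le> empirical_transform n \<omega> v"
    unfolding average_def by (intro mult_nonneg_nonneg sum_nonneg) auto
  have "(\<Sum>i=1..n. exp (- (intensity n \<omega> i * v))) \<le> (\<Sum>i=1..n. 1)"
    using intensity_nonneg[OF assms(1) _ assms(2)] assms(3) by (intro sum_mono) auto
  then show "empirical_transform n \<omega> v \<le> 1"
    unfolding average_def using assms(1) by (simp add: field_simps)
qed

text \<open>The empirical densities have no common integrable bound near \<open>v = 0\<close>, but the negative part of their deviation
  from the limit does: it is bounded by the limit. Since their mass is at most \<open>\<mu>\<close>, the mass of the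
  limit, the negative part controls the \<open>L\<^sup>1\<close> distance (the argument of Scheffe's lemma).\<close>

definition density_deficit :: "nat \<Rightarrow> 'a \<Rightarrow> real \<Rightarrow> real" where
  "density_deficit n \<omega> v = max 0 (limit_density v - empirical_density n \<omega> v)"

definition transform_error :: "nat \<Rightarrow> 'a \<Rightarrow> real \<Rightarrow> real" where
  "transform_error n \<omega> v = limit_density v * \<bar>empirical_transform n \<omega> v - transform v\<bar>"

lemma joint_measurable:
  assumes n: "1 \<le> n"
  shows "(\<lambda>(\<omega>, v). density_deficit n \<omega> v) \<in> borel_measurable (M n \<Otimes>\<^sub>M lborel)"
    and "(\<lambda>(\<omega>, v). transform_error n \<omega> v) \<in> borel_measurable (M n \<Otimes>\<^sub>M lborel)"
proof -
  have y [measurable]: "(\<lambda>p. intensity n (fst p) i) \<in> borel_measurable (M n \<Otimes>\<^sub>M lborel)" if "i \<in> {1..n}" for i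
    using measurable_compose[OF measurable_fst intensity_measurable[OF n that]] .
  show "(\<lambda>(\<omega>, v). density_deficit n \<omega> v) \<in> borel_measurable (M n \<Otimes>\<^sub>M lborel)"
    "(\<lambda>(\<omega>, v). transform_error n \<omega> v) \<in> borel_measurable (M n \<Otimes>\<^sub>M lborel)"
    unfolding split_beta' density_deficit_def transform_error_def empirical_density_def average_def by measurable
qed

lemma error_bounds:
  assumes "1 \<le> n" "\<omega> \<in> space (M n)"
  shows "0 \<le> density_deficit n \<omega> v \<and> density_deficit n \<omega> v \<le> limit_density v"
    and "0 \<le> transform_error n \<omega> v \<and> transform_error n \<omega> v \<le> limit_density v"
proof -
  show "0 \<le> density_deficit n \<omega> v \<and> density_deficit n \<omega> v \<le> limit_density v"
    using empirical_density_nonneg[of n \<omega> v] limit_density_nonneg[of v] by (auto simp: density_deficit_def)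
  show "0 \<le> transform_error n \<omega> v \<and> transform_error n \<omega> v \<le> limit_density v"
  proof (cases "0 < v")
    case True
    then have "\<bar>empirical_transform n \<omega> v - transform v\<bar> \<le> 1"
      using average_exp_bounds[OF assms, of v] transform_bounds[of v] by (auto simp: abs_le_iff)
    then show ?thesis using limit_density_nonneg[of v]
      by (auto simp: transform_error_def intro!: mult_left_le mult_nonneg_nonneg)
  qed (simp add: transform_error_def limit_density_def)
qed

lemma average_exp_tendsto:
  assumes "0 < v"
  shows "(\<lambda>n. \<integral>\<omega>. \<bar>empirical_transform n \<omega> v - transform v\<bar> \<partial>M n) \<longlonglongrightarrow> 0"
  unfolding transform_def using assms exp_lipschitz[of v]
  by (intro average_tendsto[where B = 1 and L = v]) auto

lemma average_kernel_tendsto: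
  assumes "0 < v"
  shows "(\<lambda>n. \<integral>\<omega>. \<bar>average (\<lambda>x. x\<^sup>2 * exp (- (x * v))) n \<omega> - (\<integral>x. x\<^sup>2 * exp (- (x * v)) \<partial>P)\<bar> \<partial>M n) \<longlonglongrightarrow> 0"
  using kernel_bounds(2)[OF assms] kernel_lipschitz[OF assms]
  by (intro average_tendsto[where B = "4 / v\<^sup>2" and L = "6 / v"]) auto

lemma density_deficit_tendsto: "(\<lambda>n. \<integral>\<omega>. density_deficit n \<omega> v \<partial>M n) \<longlonglongrightarrow> 0"
proof (cases "0 < v")
  case True
  let ?k = "\<lambda>x. x\<^sup>2 * exp (- (x * v))"
  show ?thesis
  proof (rule tendsto_sandwich[where f = "\<lambda>_. 0"
        and h = "\<lambda>n. \<integral>\<omega>. \<bar>average ?k n \<omega> - (\<integral>x. ?k x \<partial>P)\<bar> \<partial>M n"])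
    show "\<forall>\<^sub>F n in sequentially. (\<integral>\<omega>. density_deficit n \<omega> v \<partial>M n) \<le>
      (\<integral>\<omega>. \<bar>average ?k n \<omega> - (\<integral>x. ?k x \<partial>P)\<bar> \<partial>M n)"
    proof (rule eventually_sequentiallyI[of 1])
      fix n :: nat assume n: "1 \<le> n"
      interpret prob_space "M n" by (rule prob[OF n])
      have [measurable]: "average ?k n \<in> borel_measurable (M n)"
      proof -
        note [measurable] = intensity_measurable[OF n]
        show ?thesis unfolding average_def[abs_def] by measurable
      qed
      have "\<bar>average ?k n \<omega>\<bar> \<le> 4 / v\<^sup>2" if \<omega>: "\<omega> \<in> space (M n)" for \<omega>
      proof -
        have "\<bar>\<Sum>i=1..n. ?k (intensity n \<omega> i)\<bar> \<le> (\<Sum>i=1..n. \<bar>?k (intensity n \<omega> i)\<bar>)" by (rule sum_abs)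
        also have "\<dots> \<le> (\<Sum>i=1..n. 4 / v\<^sup>2)"
          by (intro sum_mono kernel_bounds(2) True intensity_nonneg[OF n _ \<omega>])
        finally show ?thesis unfolding average_def abs_mult using n by (simp add: field_simps)
      qed
      then have int: "integrable (M n) (average ?k n)"
        by (intro integrable_const_bound[where B = "4 / v\<^sup>2"] AE_I2) auto
      show "(\<integral>\<omega>. density_deficit n \<omega> v \<partial>M n) \<le> (\<integral>\<omega>. \<bar>average ?k n \<omega> - (\<integral>x. ?k x \<partial>P)\<bar> \<partial>M n)"
      proof (rule integral_mono_AE')
        show "AE \<omega> in M n. density_deficit n \<omega> v \<le> \<bar>average ?k n \<omega> - (\<integral>x. ?k x \<partial>P)\<bar>"
          using True by (intro AE_I2) (simp add: density_deficit_def empirical_density_def limit_density_def)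
      qed (use int in auto)
    qed
    show "\<forall>\<^sub>F n in sequentially. 0 \<le> (\<integral>\<omega>. density_deficit n \<omega> v \<partial>M n)"
      by (intro always_eventually allI Bochner_Integration.integral_nonneg) (simp add: density_deficit_def)
  qed (use average_kernel_tendsto[OF True] in simp_all)
qed (simp add: density_deficit_def empirical_density_def limit_density_def)

lemma transform_error_tendsto: "(\<lambda>n. \<integral>\<omega>. transform_error n \<omega> v \<partial>M n) \<longlonglongrightarrow> 0"
proof (cases "0 < v")
  case True
  show ?thesis
    using tendsto_mult_left[OF average_exp_tendsto[OF True], of "limit_density v"]
    by (simp add: transform_error_def)
qed (simp add: transform_error_def limit_density_def)

lemma error_integrals_tendsto:
  fixes E :: "nat \<Rightarrow> 'a \<Rightarrow> real \<Rightarrow> real"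
  assumes "E = density_deficit \<or> E = transform_error"
  shows "1 \<le> n \<Longrightarrow> integrable (M n) (\<lambda>\<omega>. \<integral>v. E n \<omega> v \<partial>lborel)"
    and "(\<lambda>n. \<integral>\<omega>. (\<integral>v. E n \<omega> v \<partial>lborel) \<partial>M n) \<longlonglongrightarrow> 0"
proof -
  \<comment> \<open>The assumptions concern the indices from \<open>1\<close> on, hence the shift.\<close>
  have prob': "prob_space (M (Suc n))" for n using prob by simp
  have meas: "(\<lambda>(\<omega>, v). E (Suc n) \<omega> v) \<in> borel_measurable (M (Suc n) \<Otimes>\<^sub>M lborel)" for n
    using assms joint_measurable[of "Suc n"] by auto
  have bound: "0 \<le> E (Suc n) \<omega> v \<and> E (Suc n) \<omega> v \<le> limit_density v" if "\<omega> \<in> space (M (Suc n))" for n \<omega> v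
    using assms error_bounds[of "Suc n" \<omega> v] that by auto
  have lim: "(\<lambda>n. \<integral>\<omega>. E (Suc n) \<omega> v \<partial>M (Suc n)) \<longlonglongrightarrow> 0" for v
  proof -
    have "(\<lambda>n. \<integral>\<omega>. E n \<omega> v \<partial>M n) \<longlonglongrightarrow> 0"
      using assms density_deficit_tendsto[of v] transform_error_tendsto[of v] by blast
    then show ?thesis by (rule filterlim_sequentially_Suc[THEN iffD2])
  qed
  note * = expectation_integral_tendsto_0[where M = "\<lambda>n. M (Suc n)" and W = "\<lambda>n. E (Suc n)",
    OF prob' meas bound limit_density_integral(1) lim]
  show "integrable (M n) (\<lambda>\<omega>. \<integral>v. E n \<omega> v \<partial>lborel)" if "1 \<le> n"
    using *(1)[of "n - 1"] that by simp
  show "(\<lambda>n. \<integral>\<omega>. (\<integral>v. E n \<omega> v \<partial>lborel) \<partial>M n) \<longlonglongrightarrow> 0"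
    using *(2) by (rule filterlim_sequentially_Suc[THEN iffD1])
qed

text \<open>Three comparisons: exact factors against \<open>exp (- l (1 - \<phi>))\<close> with the empirical transform \<open>\<phi>\<close>,
  the empirical density against its limit, and the empirical transform against its limit. The identity
  \<open>|x| = x + 2 max 0 (- x)\<close> prepares the second one for integration.\<close>

lemma pointwise_error:
  assumes n: "1 \<le> n" and \<omega>: "\<omega> \<in> space (M n)" and l: "0 \<le> l" and v: "0 < v"
  defines "y \<equiv> intensity n \<omega>"
  shows "\<bar>(1 / real n) * (\<Sum>i=1..n. (y i)\<^sup>2 * exp (- (y i * v)) * search_factor n (l / real n) (\<lambda>j. exp (- (y j * v))) i) -
      limit_density v * exp (- l * (1 - transform v))\<bar> \<le>
    (l\<^sup>2 + l) / real n * empirical_density n \<omega> v + (empirical_density n \<omega> v - limit_density v) +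
      2 * density_deficit n \<omega> v + l * transform_error n \<omega> v"
proof -
  let ?\<phi> = "empirical_transform n \<omega> v"
  let ?h = "exp (- l * (1 - ?\<phi>))" and ?H = "exp (- l * (1 - transform v))"
  let ?k = "\<lambda>i. (y i)\<^sup>2 * exp (- (y i * v))"
  let ?q = "\<lambda>i. search_factor n (l / real n) (\<lambda>j. exp (- (y j * v))) i"
  have y: "0 \<le> y i" if "i \<in> {1..n}" for i unfolding y_def by (rule intensity_nonneg[OF n that \<omega>])
  have empirical_density: "empirical_density n \<omega> v = (1 / real n) * (\<Sum>i=1..n. ?k i)"
    using v by (simp add: empirical_density_def average_def y_def)
  have "\<bar>(1 / real n) * (\<Sum>i=1..n. ?k i * ?q i) - empirical_density n \<omega> v * ?h\<bar> =
    (1 / real n) * \<bar>\<Sum>i=1..n. ?k i * (?q i - ?h)\<bar>"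
  proof -
    have "(1 / real n) * (\<Sum>i=1..n. ?k i * ?q i) - empirical_density n \<omega> v * ?h =
      (1 / real n) * (\<Sum>i=1..n. ?k i * (?q i - ?h))"
      unfolding empirical_density by (simp add: right_diff_distrib sum_subtractf sum_distrib_right diff_divide_distrib)
    then show ?thesis by (simp only: abs_mult) simp
  qed
  also have "\<dots> \<le> (1 / real n) * (\<Sum>i=1..n. ?k i * ((l\<^sup>2 + l) / real n))"
  proof (intro mult_left_mono order_trans[OF sum_abs] sum_mono)
    fix i assume i: "i \<in> {1..n}"
    have "\<bar>?q i - ?h\<bar> \<le> (l\<^sup>2 + l) / real n"
      using search_factor_approx[OF n i l y less_imp_le[OF v]] by (simp add: average_def y_def)
    then have "?k i * \<bar>?q i - ?h\<bar> \<le> ?k i * ((l\<^sup>2 + l) / real n)" by (intro mult_left_mono) auto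
    then show "\<bar>?k i * (?q i - ?h)\<bar> \<le> ?k i * ((l\<^sup>2 + l) / real n)" by (simp add: abs_mult)
  qed simp
  also have "\<dots> = (l\<^sup>2 + l) / real n * empirical_density n \<omega> v"
    unfolding empirical_density sum_distrib_right[symmetric] by (simp only: mult_ac)
  finally have 1: "\<bar>(1 / real n) * (\<Sum>i=1..n. ?k i * ?q i) - empirical_density n \<omega> v * ?h\<bar> \<le>
    (l\<^sup>2 + l) / real n * empirical_density n \<omega> v" .
  have \<phi>: "0 \<le> l * (1 - ?\<phi>)" "0 \<le> l * (1 - transform v)"
    using average_exp_bounds[OF n \<omega>, of v] transform_bounds[of v] v l by auto
  have "\<bar>empirical_density n \<omega> v * ?h - limit_density v * ?h\<bar> = \<bar>empirical_density n \<omega> v - limit_density v\<bar> * ?h"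
    by (simp add: left_diff_distrib[symmetric] abs_mult)
  also have "\<dots> \<le> \<bar>empirical_density n \<omega> v - limit_density v\<bar>" using \<phi>(1) by (intro mult_left_le) auto
  also have "\<dots> = (empirical_density n \<omega> v - limit_density v) + 2 * density_deficit n \<omega> v"
    by (simp add: density_deficit_def max_def)
  finally have 2: "\<bar>empirical_density n \<omega> v * ?h - limit_density v * ?h\<bar> \<le>
    (empirical_density n \<omega> v - limit_density v) + 2 * density_deficit n \<omega> v" .
  have "\<bar>?h - ?H\<bar> \<le> \<bar>l * (1 - ?\<phi>) - l * (1 - transform v)\<bar>"
    using exp_lipschitz[of 1 "l * (1 - ?\<phi>)" "l * (1 - transform v)"] \<phi> by simp
  also have "l * (1 - ?\<phi>) - l * (1 - transform v) = - (l * (?\<phi> - transform v))" by (simp add: algebra_simps)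
  finally have "\<bar>?h - ?H\<bar> \<le> l * \<bar>?\<phi> - transform v\<bar>" using l by (simp add: abs_mult)
  then have "limit_density v * \<bar>?h - ?H\<bar> \<le> limit_density v * (l * \<bar>?\<phi> - transform v\<bar>)"
    by (intro mult_left_mono limit_density_nonneg)
  then have 3: "\<bar>limit_density v * ?h - limit_density v * ?H\<bar> \<le> l * transform_error n \<omega> v"
    using limit_density_nonneg[of v]
    by (simp add: right_diff_distrib[symmetric] abs_mult transform_error_def mult_ac)
  show ?thesis using 1 2 3 by linarith
qed

abbreviation rescaled_integral :: "real \<Rightarrow> real \<Rightarrow> nat \<Rightarrow> 'a \<Rightarrow> real" where
  "rescaled_integral t l n \<omega> \<equiv>
    equilibrium_integral n (\<lambda>i. popularity n (w n) i \<omega>) (real n * \<mu> * t) (l / real n)"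

abbreviation limit_integral :: "real \<Rightarrow> real \<Rightarrow> real" where
  "limit_integral t l \<equiv> \<integral>v. indicator {0..<t} v * (limit_density v * exp (- l * (1 - transform v))) \<partial>lborel"

text \<open>In the integral of the pointwise bound, the difference of the masses of the two densities is at most \<open>0\<close> and drops
  out.\<close>

lemma integral_error:
  assumes n: "1 \<le> n" and \<omega>: "\<omega> \<in> space (M n)" and l: "0 \<le> l" and t: "0 < t"
  shows "\<bar>rescaled_integral t l n \<omega> -
      (1 / \<mu>) * limit_integral t l\<bar> \<le>
    (l\<^sup>2 + l) / real n + (2 / \<mu>) * (\<integral>v. density_deficit n \<omega> v \<partial>lborel) +
      (l / \<mu>) * (\<integral>v. transform_error n \<omega> v \<partial>lborel)"
proof -
  let ?y = "intensity n \<omega>"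
  let ?A = "\<lambda>v. indicator {0..<t} v * ((1 / real n) *
    (\<Sum>i=1..n. (?y i)\<^sup>2 * exp (- (?y i * v)) * search_factor n (l / real n) (\<lambda>j. exp (- (?y j * v))) i))"
  let ?B = "\<lambda>v. indicator {0..<t} v * (limit_density v * exp (- l * (1 - transform v)))"
  let ?c = "(l\<^sup>2 + l) / real n"
  let ?D = "\<lambda>v. ?c * empirical_density n \<omega> v + (empirical_density n \<omega> v - limit_density v) +
      2 * density_deficit n \<omega> v + l * transform_error n \<omega> v"
  interpret prob_space "M n" by (rule prob[OF n])
  have pop: "0 \<le> popularity n (w n) i \<omega>" if "i \<in> {1..n}" for i
    unfolding popularity_def using w_nonneg[OF n _ \<omega>] that by (intro divide_nonneg_nonneg sum_nonneg) auto
  have c: "0 \<le> ?c" using l by simp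
  have A: "integrable lborel ?A"
    "rescaled_integral t l n \<omega> =
      (1 / \<mu>) * (\<integral>v. ?A v \<partial>lborel)"
    unfolding intensity_def[abs_def] using l
    by (intro equilibrium_integral_rescaled n mean_pos t pop divide_nonneg_nonneg; simp)+
  have B: "integrable lborel ?B"
  proof (rule Bochner_Integration.integrable_bound[OF limit_density_integral(1)])
    show "AE v in lborel. norm (?B v) \<le> norm (limit_density v)"
    proof (rule AE_I2)
      fix v
      show "norm (?B v) \<le> norm (limit_density v)"
      proof (cases "v \<in> {0..<t}")
        case True
        then have "exp (- l * (1 - transform v)) \<le> 1" using l transform_bounds[of v] by simp
        then show ?thesis using True limit_density_nonneg[of v] by (simp add: abs_mult mult_left_le)
      qed simp
    qed
  qed measurable
  have meas: "(\<lambda>v. E n \<omega> v) \<in> borel_measurable lborel"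
    if "(\<lambda>(\<omega>, v). E n \<omega> v) \<in> borel_measurable (M n \<Otimes>\<^sub>M lborel)" for E :: "nat \<Rightarrow> 'a \<Rightarrow> real \<Rightarrow> real"
    using measurable_compose[OF measurable_Pair1'[OF \<omega>] that] by simp
  have def_int: "integrable lborel (density_deficit n \<omega>)"
    using error_bounds(1)[OF n \<omega>]
    by (intro Bochner_Integration.integrable_bound[OF limit_density_integral(1)] AE_I2
        meas[of density_deficit, OF joint_measurable(1)[OF n]]) (simp add: limit_density_nonneg)
  have tra_int: "integrable lborel (transform_error n \<omega>)"
    using error_bounds(2)[OF n \<omega>]
    by (intro Bochner_Integration.integrable_bound[OF limit_density_integral(1)] AE_I2
        meas[of transform_error, OF joint_measurable(2)[OF n]]) (simp add: limit_density_nonneg)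
  note ints = empirical_density_integral(1)[OF n \<omega>] limit_density_integral(1) def_int tra_int
  have "\<bar>(\<integral>v. ?A v \<partial>lborel) - (\<integral>v. ?B v \<partial>lborel)\<bar> = \<bar>\<integral>v. ?A v - ?B v \<partial>lborel\<bar>"
    using A(1) B by simp
  also have "\<dots> \<le> (\<integral>v. \<bar>?A v - ?B v\<bar> \<partial>lborel)" by (rule integral_abs_bound)
  also have "\<dots> \<le> (\<integral>v. ?D v \<partial>lborel)"
  proof (rule integral_mono_AE)
    show "integrable lborel (\<lambda>v. \<bar>?A v - ?B v\<bar>)" using A(1) B by simp
    show "integrable lborel ?D" using ints by simp
    show "AE v in lborel. \<bar>?A v - ?B v\<bar> \<le> ?D v"
      using AE_lborel_singleton[of 0]
    proof eventually_elim
      case (elim v)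
      show ?case
      proof (cases "0 < v \<and> v < t")
        case True
        then show ?thesis using pointwise_error[OF n \<omega> l, of v] by simp
      next
        case False
        then have "\<bar>?A v - ?B v\<bar> = 0" using elim by simp
        moreover have "0 \<le> ?c * empirical_density n \<omega> v" using c empirical_density_nonneg by (rule mult_nonneg_nonneg)
        moreover have "0 \<le> (empirical_density n \<omega> v - limit_density v) + 2 * density_deficit n \<omega> v"
          by (simp add: density_deficit_def max_def)
        moreover have "0 \<le> l * transform_error n \<omega> v"
          using error_bounds(2)[OF n \<omega>] l by (intro mult_nonneg_nonneg) auto
        ultimately show ?thesis by linarith
      qed
    qed
  qed
  also have "\<dots> = ?c * (\<integral>v. empirical_density n \<omega> v \<partial>lborel) + ((\<integral>v. empirical_density n \<omega> v \<partial>lborel) - \<mu>) +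
      2 * (\<integral>v. density_deficit n \<omega> v \<partial>lborel) + l * (\<integral>v. transform_error n \<omega> v \<partial>lborel)"
    using ints by (simp add: limit_density_integral(2))
  also have "\<dots> \<le> ?c * \<mu> + 0 + 2 * (\<integral>v. density_deficit n \<omega> v \<partial>lborel) + l * (\<integral>v. transform_error n \<omega> v \<partial>lborel)"
    using empirical_density_integral(2)[OF n \<omega>] c l by (intro add_mono mult_left_mono) auto
  finally have "(1 / \<mu>) * \<bar>(\<integral>v. ?A v \<partial>lborel) - (\<integral>v. ?B v \<partial>lborel)\<bar> \<le>
    (1 / \<mu>) * (?c * \<mu> + 0 + 2 * (\<integral>v. density_deficit n \<omega> v \<partial>lborel) + l * (\<integral>v. transform_error n \<omega> v \<partial>lborel))"
    using mean_pos by (intro mult_left_mono) auto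
  also have "\<dots> = ?c + (2 / \<mu>) * (\<integral>v. density_deficit n \<omega> v \<partial>lborel) + (l / \<mu>) * (\<integral>v. transform_error n \<omega> v \<partial>lborel)"
    using mean_pos by (simp add: distrib_left)
  finally show ?thesis unfolding A(2) right_diff_distrib[symmetric] abs_mult using mean_pos by simp
qed

lemma expected_integral_tendsto:
  assumes l: "0 \<le> l" and t: "0 < t"
    and meas: "\<And>n. 1 \<le> n \<Longrightarrow>
      (\<lambda>\<omega>. rescaled_integral t l n \<omega>) \<in> borel_measurable (M n)"
  shows "(\<lambda>n. \<integral>\<omega>. rescaled_integral t l n \<omega> \<partial>M n)
    \<longlonglongrightarrow> (1 / \<mu>) * limit_integral t l"
proof -
  define F where "F n \<omega> = rescaled_integral t l n \<omega>" for n \<omega>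
  define c where "c = (1 / \<mu>) * limit_integral t l"
  let ?I = "\<lambda>n \<omega>. \<integral>v. density_deficit n \<omega> v \<partial>lborel" and ?J = "\<lambda>n \<omega>. \<integral>v. transform_error n \<omega> v \<partial>lborel"
  have le: "\<bar>(\<integral>\<omega>. F n \<omega> \<partial>M n) - c\<bar> \<le>
    (l\<^sup>2 + l) / real n + (2 / \<mu>) * (\<integral>\<omega>. ?I n \<omega> \<partial>M n) + (l / \<mu>) * (\<integral>\<omega>. ?J n \<omega> \<partial>M n)" if n: "1 \<le> n" for n
  proof -
    interpret prob_space "M n" by (rule prob[OF n])
    let ?D = "\<lambda>\<omega>. (l\<^sup>2 + l) / real n + (2 / \<mu>) * ?I n \<omega> + (l / \<mu>) * ?J n \<omega>"
    have D: "integrable (M n) ?D"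
      by (intro Bochner_Integration.integrable_add integrable_mult_right integrable_const error_integrals_tendsto(1) n) auto
    have err: "\<bar>F n \<omega> - c\<bar> \<le> ?D \<omega>" if "\<omega> \<in> space (M n)" for \<omega>
      unfolding F_def c_def by (rule integral_error[OF n that l t])
    have [measurable]: "F n \<in> borel_measurable (M n)" unfolding F_def by (rule meas[OF n])
    have diff: "integrable (M n) (\<lambda>\<omega>. F n \<omega> - c)"
    proof (rule Bochner_Integration.integrable_bound[OF D])
      show "AE \<omega> in M n. norm (F n \<omega> - c) \<le> norm (?D \<omega>)"
      proof (rule AE_I2)
        fix \<omega> assume "\<omega> \<in> space (M n)"
        from err[OF this] show "norm (F n \<omega> - c) \<le> norm (?D \<omega>)" unfolding real_norm_def by linarith
      qed
    qed measurable
    then have "integrable (M n) (\<lambda>\<omega>. (F n \<omega> - c) + c)" by (rule Bochner_Integration.integrable_add) simp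
    then have "integrable (M n) (F n)" by simp
    then have "\<bar>(\<integral>\<omega>. F n \<omega> \<partial>M n) - c\<bar> = \<bar>\<integral>\<omega>. F n \<omega> - c \<partial>M n\<bar>" by (simp add: prob_space)
    also have "\<dots> \<le> (\<integral>\<omega>. \<bar>F n \<omega> - c\<bar> \<partial>M n)" by (rule integral_abs_bound)
    also have "\<dots> \<le> (\<integral>\<omega>. ?D \<omega> \<partial>M n)" using diff by (intro integral_mono D err) simp_all
    also have "\<dots> = (l\<^sup>2 + l) / real n + (2 / \<mu>) * (\<integral>\<omega>. ?I n \<omega> \<partial>M n) + (l / \<mu>) * (\<integral>\<omega>. ?J n \<omega> \<partial>M n)"
      using error_integrals_tendsto(1)[of density_deficit n] error_integrals_tendsto(1)[of transform_error n] n
      by (simp add: prob_space)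
    finally show ?thesis .
  qed
  have "(\<lambda>n. (l\<^sup>2 + l) / real n + (2 / \<mu>) * (\<integral>\<omega>. ?I n \<omega> \<partial>M n) + (l / \<mu>) * (\<integral>\<omega>. ?J n \<omega> \<partial>M n))
    \<longlonglongrightarrow> 0 + (2 / \<mu>) * 0 + (l / \<mu>) * 0"
    by (intro tendsto_add tendsto_mult_left error_integrals_tendsto(2) lim_const_over_n) auto
  then have "(\<lambda>n. (l\<^sup>2 + l) / real n + (2 / \<mu>) * (\<integral>\<omega>. ?I n \<omega> \<partial>M n) + (l / \<mu>) * (\<integral>\<omega>. ?J n \<omega> \<partial>M n)) \<longlonglongrightarrow> 0"
    by simp
  then have "(\<lambda>n. (\<integral>\<omega>. F n \<omega> \<partial>M n) - c) \<longlonglongrightarrow> 0"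
  proof (rule Lim_null_comparison[rotated])
    show "\<forall>\<^sub>F n in sequentially. norm ((\<integral>\<omega>. F n \<omega> \<partial>M n) - c) \<le>
      (l\<^sup>2 + l) / real n + (2 / \<mu>) * (\<integral>\<omega>. ?I n \<omega> \<partial>M n) + (l / \<mu>) * (\<integral>\<omega>. ?J n \<omega> \<partial>M n)"
      using le by (intro eventually_sequentiallyI[of 1]) simp
  qed
  then have "(\<lambda>n. \<integral>\<omega>. F n \<omega> \<partial>M n) \<longlonglongrightarrow> c" by (simp add: LIM_zero_iff)
  then show ?thesis unfolding F_def c_def .
qed

end

theorem theorem3p2:
  fixes P :: "real measure" and \<mu> :: real
    and M :: "nat \<Rightarrow> 'a measure"
    and w :: "nat \<Rightarrow> nat \<Rightarrow> 'a \<Rightarrow> real"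
    and \<pi> :: "nat \<Rightarrow> nat \<Rightarrow> nat"
    and T :: "nat \<Rightarrow> nat \<Rightarrow> 'a \<Rightarrow> real set"
    and l t :: real
  assumes P: "P \<in> prob_Rplus"
    and first_moment: "integrable P (\<lambda>x. x)" "\<mu> = (\<integral>x. x \<partial>P)" "\<mu> \<noteq> 0"
    and prob: "\<And>n. n \<ge> 1 \<Longrightarrow> prob_space (M n)"
    and w_measurable: "\<And>n i. n \<ge> 1 \<Longrightarrow> i \<in> {1..n} \<Longrightarrow> w n i \<in> borel_measurable (M n)"
    and w_nonneg: "\<And>n i \<omega>. n \<ge> 1 \<Longrightarrow> i \<in> {1..n} \<Longrightarrow> \<omega> \<in> space (M n) \<Longrightarrow> 0 \<le> w n i \<omega>"
    and LLN: "LLN P M w"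
    and initial_list: "\<And>n. n \<ge> 1 \<Longrightarrow> \<pi> n permutes {1..n}"
    and request_processes:
      "\<And>n. n \<ge> 1 \<Longrightarrow> conditionally_poisson_requests (M n) n (w n) (T n)"
    and l: "l \<ge> 0" and t: "t \<ge> 0"
  shows "(\<lambda>n. equilibrium_transform (M n) n (\<pi> n) (T n) (real n * \<mu> * t) (l / real n))
    \<longlonglongrightarrow> (1 / \<mu>) *
      (LBINT u:{0..t}. (\<integral>x. x\<^sup>2 * exp (- x * u) \<partial>P) * exp (- l * (1 - laplace P u)))"
proof -
  interpret lln_popularities P \<mu> M w
    using P first_moment prob w_measurable w_nonneg LLN by (rule lln_popularities.intro)
  let ?L = "LBINT u:{0..t}. (\<integral>x. x\<^sup>2 * exp (- x * u) \<partial>P) * exp (- l * (1 - laplace P u))"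
  show ?thesis
  proof (cases "t = 0")
    case True
    have "equilibrium_transform (M n) n (\<pi> n) (T n) 0 a = 0" for n a
    proof -
      have "requested_before n \<tau> 0 = {}" for \<tau> by (auto simp: requested_before_def)
      then show ?thesis by (simp add: equilibrium_transform_def equilibrium_search_cost_def)
    qed
    moreover have "?L = 0"
      unfolding set_lebesgue_integral_def
    proof (rule integral_eq_zero_AE)
      show "AE u in lborel. indicator {0..t} u *\<^sub>R ((\<integral>x. x\<^sup>2 * exp (- x * u) \<partial>P) * exp (- l * (1 - laplace P u))) = 0"
        using AE_lborel_singleton[of 0] by eventually_elim (simp add: True)
    qed
    ultimately show ?thesis using True by simp
  next
    case False
    with t have t0: "0 < t" by simp
    have req: "poisson_request_model (M n) n (w n) (T n)" if n: "1 \<le> n" for n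
      unfolding poisson_request_model_def poisson_request_model_axioms_def
      using prob[OF n] w_measurable[OF n] w_nonneg[OF n] request_processes[OF n] by blast
    have pos: "0 < real n * \<mu> * t" "0 \<le> l / real n" if "1 \<le> n" for n :: nat
      using that mean_pos t0 l by auto
    have "(\<lambda>n. \<integral>\<omega>. rescaled_integral t l n \<omega> \<partial>M n)
      \<longlonglongrightarrow> (1 / \<mu>) * limit_integral t l"
      by (rule expected_integral_tendsto[OF l t0])
        (rule poisson_request_model.equilibrium_transform_eq(1)[OF req initial_list pos])
    moreover have "limit_integral t l = ?L"
      unfolding set_lebesgue_integral_def
    proof (rule Bochner_Integration.integral_cong_AE)
      have "(\<integral>x. x\<^sup>2 * exp (- x * u) \<partial>P) = limit_density u" if "0 < u" for u
        using that by (simp add: limit_density_def)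
      moreover have L: "laplace P u = transform u" for u
        unfolding laplace_def transform_def by (simp add: mult.commute)
      ultimately have eq: "indicator {0..<t} u * (limit_density u * exp (- l * (1 - transform u))) =
        indicator {0..t} u *\<^sub>R ((\<integral>x. x\<^sup>2 * exp (- x * u) \<partial>P) * exp (- l * (1 - laplace P u)))"
        if "u \<noteq> 0" "u \<noteq> t" for u
        using that by (cases "0 < u") (auto simp: indicator_def)
      show AE: "AE u in lborel. indicator {0..<t} u * (limit_density u * exp (- l * (1 - transform u))) =
        indicator {0..t} u *\<^sub>R ((\<integral>x. x\<^sup>2 * exp (- x * u) \<partial>P) * exp (- l * (1 - laplace P u)))"
        using AE_lborel_singleton[of 0] AE_lborel_singleton[of t] by eventually_elim (rule eq)
      show "(\<lambda>u. indicator {0..t} u *\<^sub>R ((\<integral>x. x\<^sup>2 * exp (- x * u) \<partial>P) * exp (- l * (1 - laplace P u))))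
        \<in> borel_measurable lborel"
        unfolding L using kernel_mean_measurable by simp
    qed measurable
    ultimately have "(\<lambda>n. \<integral>\<omega>. rescaled_integral t l n \<omega> \<partial>M n)
      \<longlonglongrightarrow> (1 / \<mu>) * ?L" by simp
    then show ?thesis
    proof (rule Lim_transform_eventually)
      show "\<forall>\<^sub>F n in sequentially. (\<integral>\<omega>. rescaled_integral t l n \<omega> \<partial>M n) =
        equilibrium_transform (M n) n (\<pi> n) (T n) (real n * \<mu> * t) (l / real n)"
        using poisson_request_model.equilibrium_transform_eq(2)[OF req initial_list pos]
        by (intro eventually_sequentiallyI[of 1]) simp
    qed
  qed
qed

end
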